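(* Fix an integer $m\ge 1$. Let $T_N=(A_{i-j})_{i,j=1}^N$, $N\in\mathbb N$, be the $mN\times mN$ real symmetric random block Toeplitz matrices described in the context, and let $X_N=T_N/\sqrt{mN}$. Then, as $N\to\infty$, the eigenvalue distribution $\mu_{X_N}$ converges weakly, almost surely, to a symmetric probability distribution $\gamma_T^{(m)}$ on $\mathbb R$ which is determined by its even moments: for every integer $k\ge 1$, $$m_{2k}(\gamma_T^{(m)})=\sum_{\pi\in\mathcal P_2(2k)}m^{k-1-f(\pi)}\int_{[0,1]\times[-1,1]^k}\prod_{j=1}^{2k}I_{[0,1]}\Big(x_0+\sum_{q=1}^{j}\epsilon_\pi(q)\,x_{\pi(q)}\Big)\prod_{l=0}^{k}\mathrm d x_l .$$
   Context: Random matrix model. For $m,N\in\mathbb N$, $T_N=(A_{i-j})_{i,j=1}^N$ is the $mN\times mN$ block matrix whose $(i,j)$ block is $A_{i-j}$, where $A_s=(a_{ij}(s))_{i,j=1}^m$ for $-(N-1)\le s\le N-1$ are $m\times m$ matrices with real random entries (the entries may depend on $N$ and $m$; all random variables are defined on a common probability space). Assume: (i) $A_{-s}=(A_s)^T$ for all $s$ (so $T_N$ is symmetric; in particular $A_0$ is symmetric); (ii) for each $N$ and $m$, apart from the identities forced by (i), the entries are independent, i.e. the family $\{a_{ij}(s):1\le s\le N-1,\,1\le i,j\le m\}\cup\{a_{ij}(0):1\le i\le j\le m\}$ is independent; (iii) $E(a_{ij}(s))=0$ and $E(|a_{ij}(s)|^2)=1$ for all $-(N-1)\le s\le N-1$,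 $1\le i,j\le m$; (iv) for every $k\in\mathbb N$, $C_{k,m}:=\sup\{E|a_{ij}(s)|^k: N\in\mathbb N,\ -(N-1)\le s\le N-1,\ 1\le i,j\le m\}<+\infty$ and $\sup_{m\in\mathbb N}C_{k,m}=C_k<+\infty$. Eigenvalue distribution. For a real symmetric $n\times n$ random matrix $A$ with eigenvalues $\lambda_1(\omega),\dots,\lambda_n(\omega)$, here $\mu_A$ is the random probability measure $\frac1n\sum_{j=1}^n\delta_{\lambda_j(\omega)}$. Partitions. $[n]=\{1,\dots,n\}$. $\mathcal P_2(2k)$ is the set of partitions $\pi=\{V_1,\dots,V_k\}$ of $[2k]$ all of whose blocks have exactly two elements; the blocks are labelled and $\pi(q)=i$ means $q\in V_i$. Put $\epsilon_\pi(q)=1$ if $q$ is the smaller element of $V_{\pi(q)}$ and $\epsilon_\pi(q)=-1$ if $q$ is the larger element of $V_{\pi(q)}$. For $\pi=\{V_1,\dots,V_k\}\in\mathcal P_2(2k)$ with $V_r=\{a_r,b_r\}$, $f(\pi)$ is the number of linearly independent equations (the rank) of the linear system in the unknowns $t_1,\dots,t_{2k}$ (with $t_{2k+1}=t_1$): $t_{a_i}=t_{b_i+1}$ and $t_{b_i}=t_{a_i+1}$ for $1\le i\le k$. $I_{[0,1]}$ is the indicator function of $[0,1]$, and $m_{2k}(\gamma)=\int x^{2k}\,d\gamma$. *)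

theory Defs
  imports
    "HOL-Probability.Probability"
    "HOL-Computational_Algebra.Fundamental_Theorem_Algebra"
    "Jordan_Normal_Form.Char_Poly"
    "Jordan_Normal_Form.DL_Rank"
begin

text \<open>The eigenvalues are the roots of the characteristic polynomial, with multiplicity. For a real
  symmetric matrix of size \<open>n > 0\<close> there are \<open>n\<close> of them, so this is a probability measure.\<close>

definition eigenvalue_distribution :: "real Matrix.mat \<Rightarrow> real measure" where
  "eigenvalue_distribution A = measure_of UNIV (sets borel)
     (\<lambda>B. (\<Sum>l\<in>#proots (char_poly A). indicator B l) / of_nat (dim_row A))"

lemma sets_eigenvalue_distribution [simp]: "sets (eigenvalue_distribution A) = sets borel"
  unfolding eigenvalue_distribution_def by (metis sets.sets_measure_of_eq space_borel)

lemma space_eigenvalue_distribution [simp]: "space (eigenvalue_distribution A) = UNIV"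
  by (metis sets_eigenvalue_distribution sets_eq_imp_space_eq space_borel)

lemma emeasure_eigenvalue_distribution:
  assumes "B \<in> sets borel"
  shows "emeasure (eigenvalue_distribution A) B =
    (\<Sum>l\<in>#proots (char_poly A). indicator B l) / of_nat (dim_row A)"
proof -
  let ?mu = "\<lambda>R. \<lambda>B::real set. (\<Sum>l\<in>#R. indicator B l :: ennreal)"
  have sums: "(\<lambda>i. ?mu R (F i)) sums ?mu R (\<Union>i. F i)"
    if "disjoint_family F" for R and F :: "nat \<Rightarrow> real set"
  proof (induction R)
    case (add l R)
    have "(\<lambda>i. indicator (F i) l :: ennreal) sums indicator (\<Union>i. F i) l"
      using suminf_indicator[OF that, of l] summable_sums[of "\<lambda>i. indicator (F i) l :: ennreal"]
      by simp
    with add show ?case by (simp add: sums_add)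
  qed simp
  show ?thesis
    unfolding eigenvalue_distribution_def
  proof (rule emeasure_measure_of_sigma)
    show "sigma_algebra UNIV (sets (borel :: real measure))"
      by (metis sets.sigma_algebra_axioms space_borel)
    show "positive (sets borel) (\<lambda>B. ?mu (proots (char_poly A)) B / of_nat (dim_row A))"
      by (simp add: positive_def)
    show "countably_additive (sets borel) (\<lambda>B. ?mu (proots (char_poly A)) B / of_nat (dim_row A))"
      unfolding countably_additive_def divide_ennreal_def
      using sums by (simp add: sums_iff)
  qed (use assms in simp)
qed

text \<open>\<open>a m N s i j\<close> is the entry \<open>(i, j)\<close> of the \<open>m \<times> m\<close> block \<open>A\<^sub>s\<close>, in the model with parameters
  \<open>m\<close> and \<open>N\<close>; entries and blocks are indexed from \<open>0\<close>. Only arguments with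
  \<open>\<bar>s\<bar> < N\<close> and \<open>i, j < m\<close> are meaningful.\<close>

definition block_toeplitz ::
  "(nat \<Rightarrow> nat \<Rightarrow> int \<Rightarrow> nat \<Rightarrow> nat \<Rightarrow> 'w \<Rightarrow> real) \<Rightarrow> nat \<Rightarrow> nat \<Rightarrow> 'w \<Rightarrow> real Matrix.mat" where
  "block_toeplitz a m N \<omega> = Matrix.mat (m * N) (m * N)
     (\<lambda>(p, q). a m N (int (p div m) - int (q div m)) (p mod m) (q mod m) \<omega>)"

definition moment_bound ::
  "'w measure \<Rightarrow> (nat \<Rightarrow> nat \<Rightarrow> int \<Rightarrow> nat \<Rightarrow> nat \<Rightarrow> 'w \<Rightarrow> real) \<Rightarrow> nat \<Rightarrow> nat \<Rightarrow> ennreal" where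
  "moment_bound M a k m =
     (SUP (N, s, i, j) \<in> {(N, s, i, j). \<bar>s\<bar> < int N \<and> i < m \<and> j < m}.
        \<integral>\<^sup>+\<omega>. ennreal (\<bar>a m N s i j \<omega>\<bar> ^ k) \<partial>M)"

locale block_toeplitz_model = prob_space M
  for M :: "'w measure" and a :: "nat \<Rightarrow> nat \<Rightarrow> int \<Rightarrow> nat \<Rightarrow> nat \<Rightarrow> 'w \<Rightarrow> real" +
  assumes random_variable_entry:
      "\<And>m N s i j. \<bar>s\<bar> < int N \<Longrightarrow> i < m \<Longrightarrow> j < m \<Longrightarrow> random_variable borel (a m N s i j)"
    and transpose_entry:
      "\<And>m N s i j \<omega>. \<bar>s\<bar> < int N \<Longrightarrow> i < m \<Longrightarrow> j < m \<Longrightarrow> \<omega> \<in> space M \<Longrightarrow>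
         a m N (- s) i j \<omega> = a m N s j i \<omega>"
    and indep_entries:
      "\<And>m N. indep_vars (\<lambda>_. borel) (\<lambda>(s, i, j). a m N s i j)
         ({(s, i, j). 1 \<le> s \<and> s < int N \<and> i < m \<and> j < m} \<union>
          {(s, i, j). s = 0 \<and> 1 \<le> N \<and> i \<le> j \<and> j < m})"
    and mean_entry:
      "\<And>m N s i j. \<bar>s\<bar> < int N \<Longrightarrow> i < m \<Longrightarrow> j < m \<Longrightarrow> expectation (a m N s i j) = 0"
    and second_moment_entry:
      "\<And>m N s i j. \<bar>s\<bar> < int N \<Longrightarrow> i < m \<Longrightarrow> j < m \<Longrightarrow>
         expectation (\<lambda>\<omega>. \<bar>a m N s i j \<omega>\<bar>\<^sup>2) = 1"
    and moment_bound_finite: "\<And>k m. 1 \<le> m \<Longrightarrow> moment_bound M a k m < \<infinity>"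
    and moment_bound_uniform: "\<And>k. (SUP m\<in>{1..}. moment_bound M a k m) < \<infinity>"

definition pair_partitions :: "nat \<Rightarrow> nat set set set" where
  "pair_partitions n = {\<pi>. partition_on {1..n} \<pi> \<and> (\<forall>V\<in>\<pi>. card V = 2)}"

definition block_of :: "nat set set \<Rightarrow> nat \<Rightarrow> nat set" where
  "block_of \<pi> q = (THE V. V \<in> \<pi> \<and> q \<in> V)"

definition partner :: "nat set set \<Rightarrow> nat \<Rightarrow> nat" where
  "partner \<pi> q = (THE r. r \<in> block_of \<pi> q \<and> r \<noteq> q)"

text \<open>The label \<open>\<pi>(q)\<close> when the blocks are numbered \<open>1, 2, \<dots>\<close> in the order of their minima. The
  moment integral below does not depend on the numbering.\<close>

definition block_label :: "nat set set \<Rightarrow> nat \<Rightarrow> nat" where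
  "block_label \<pi> q = card {V \<in> \<pi>. Min V \<le> Min (block_of \<pi> q)}"

definition pair_sign :: "nat set set \<Rightarrow> nat \<Rightarrow> real" where
  "pair_sign \<pi> q = (if q = Min (block_of \<pi> q) then 1 else - 1)"

text \<open>For \<open>V = {a, b}\<close> the equations \<open>t\<^sub>a = t\<^sub>b\<^sub>+\<^sub>1\<close> and \<open>t\<^sub>b = t\<^sub>a\<^sub>+\<^sub>1\<close> are
  \<open>t\<^sub>q - t\<^bsub>partner q + 1\<^esub> = 0\<close> for \<open>q = a\<close> and \<open>q = b\<close>. Column \<open>q - 1\<close> holds the coefficients of the
  equation for \<open>q\<close>, and row \<open>c\<close> belongs to the unknown \<open>t\<^sub>c\<^sub>+\<^sub>1\<close>; so \<open>t\<^bsub>partner q + 1\<^esub>\<close>, read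
  cyclically, has row \<open>partner q mod 2k\<close>. The library rank is the dimension of the column span.\<close>

definition equation_matrix :: "nat \<Rightarrow> nat set set \<Rightarrow> real Matrix.mat" where
  "equation_matrix k \<pi> = Matrix.mat (2 * k) (2 * k)
     (\<lambda>(c, p). of_bool (c = p) - of_bool (c = partner \<pi> (p + 1) mod (2 * k)))"

definition equation_rank :: "nat \<Rightarrow> nat set set \<Rightarrow> nat" where
  "equation_rank k \<pi> = vec_space.rank (2 * k) (equation_matrix k \<pi>)"

definition partition_integral :: "nat \<Rightarrow> nat set set \<Rightarrow> real" where
  "partition_integral k \<pi> =
     (LINT x : (\<Pi>\<^sub>E l\<in>{0..k}. if l = 0 then {0..1} else {-1..1}) | (\<Pi>\<^sub>M l\<in>{0..k}. lborel).
        (\<Prod>j=1..2*k. indicator {0..1}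
           (x 0 + (\<Sum>q=1..j. pair_sign \<pi> q * x (block_label \<pi> q)))))"

definition limit_even_moment :: "nat \<Rightarrow> nat \<Rightarrow> real" where
  "limit_even_moment m k =
     (\<Sum>\<pi>\<in>pair_partitions (2 * k).
        real m powi (int k - 1 - int (equation_rank k \<pi>)) * partition_integral k \<pi>)"

definition symmetric_distribution :: "real measure \<Rightarrow> bool" where
  "symmetric_distribution \<nu> \<longleftrightarrow> real_distribution \<nu> \<and> distr \<nu> borel uminus = \<nu>"

end

theory Submission
  imports Defs "Jordan_Normal_Form.Schur_Decomposition"
begin

text \<open>The proof is the method of moments. The \<open>p\<close>-th moment of the spectral distribution is the
  normalised trace of the \<open>p\<close>-th power of the matrix, and this trace is a sum over closed words
  \<open>w : {..<p} \<rightarrow> {..<m * N}\<close> of products of entries. Write \<open>w q = i q * m + t q\<close> with a block index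
  \<open>i q < N\<close> and a component \<open>t q < m\<close>: the entry at letter \<open>q\<close> depends on the increment
  \<open>i q - i (q + 1)\<close> and on \<open>t q\<close>, \<open>t (q + 1)\<close>. Since the entries are centred and independent, a word
  contributes only if every variable occurs at least twice, so the absolute values of the
  increments coincide in groups.

  Everything rests on counting such words. A circuit of block indices is determined by its starting
  point and by one absolute increment \<open>x\<^sub>b\<close> for each group \<open>b\<close> of letters, and it closes only if a linear
  equation \<open>\<Sum>\<^sub>b E\<^sub>b x\<^sub>b = 0\<close> holds, whose coefficients are sums of signs. So a pattern of groups and signs
  for \<open>c\<close> circuits has at most \<open>N\<close> to the power (\<open>c\<close> + number of groups - rank of the \<open>c\<close> closing
  equations) realisations.
  For one circuit of length \<open>2k\<close> the exponent \<open>k + 1\<close> is reached only if the groups are pairs with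
  opposite signs (\<open>card_matched_unpaired\<close>), that is, by a pair partition \<open>\<pi>\<close>. Then the two letters of
  each pair carry the same variable exactly when \<open>t q = t (partner q + 1)\<close> for all \<open>q\<close>, which is the
  linear system of \<open>\<pi>\<close> and has \<open>m\<close> to the power \<open>2k - f(\<pi>)\<close> solutions in \<open>{..<m}\<close>
  (\<open>card_labellings_equation_rank\<close>), while the block indices are the lattice points in the dilation by
  \<open>N\<close> of the polytope that the moment integral measures (\<open>paired_blocks_tendsto_integral\<close>). Together
  with \<open>expected_trace_main_term\<close> this gives the limit of the expected moments.

  For almost sure convergence the variance is not enough, because it decays only like \<open>1/N\<close>: already
  the second moment is a weighted average of independent squares whose number is of order \<open>N\<close> for
  fixed \<open>m\<close>. The fourth central moment
  counts quadruples of circuits in which every circuit shares a variable with another one; this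
  linkage costs two powers of \<open>N\<close> (\<open>card_linked_quadruples\<close>). The resulting bound \<open>O(1/N\<^sup>2)\<close> is
  summable.

  There are at most \<open>(2k)! / (2\<^sup>k k!)\<close> pair partitions, so the limit moments grow so slowly that the
  characteristic function of a distribution with these moments is the sum of its Taylor series. Hence
  such a distribution is unique, and convergence of the moments implies convergence of the
  characteristic functions and weak convergence. Existence comes from the same estimates: for a
  single outcome the spectral distributions are tight, and a weak limit of a subsequence has the
  required moments.\<close>

section \<open>Spectral distributions and traces\<close>

lemma sum_PiE_insert:
  assumes "x \<notin> S"
  shows "(\<Sum>w\<in>PiE (insert x S) T. g w) = (\<Sum>y\<in>T x. \<Sum>w\<in>PiE S T. g (w(x := y)))"
proof -
  have "(\<Sum>w\<in>PiE (insert x S) T. g w) = (\<Sum>z\<in>T x \<times> PiE S T. g ((\<lambda>(y, w). w(x := y)) z))"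
    unfolding PiE_insert_eq using inj_combinator[OF assms, of T]
    by (subst sum.reindex) (auto simp: o_def)
  also have "\<dots> = (\<Sum>y\<in>T x. \<Sum>w\<in>PiE S T. g (w(x := y)))"
    by (simp add: sum.cartesian_product case_prod_beta)
  finally show ?thesis .
qed

definition mat_trace :: "'a :: comm_monoid_add Matrix.mat \<Rightarrow> 'a" where
  "mat_trace A = (\<Sum>i<dim_row A. A $$ (i, i))"

lemma mat_mult_index:
  assumes "A \<in> carrier_mat n n" "B \<in> carrier_mat n n" "i < n" "j < n"
  shows "(A * B) $$ (i, j) = (\<Sum>l<n. A $$ (i, l) * B $$ (l, j))"
  using assms by (auto simp: scalar_prod_def atLeast0LessThan)

text \<open>The weight \<open>f\<close> of the two end points is arbitrary so that the induction on the exponent can absorb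
  the last factor of the matrix product into it.\<close>

lemma sum_mat_pow_weighted:
  fixes A :: "'a :: comm_semiring_1 Matrix.mat"
  assumes A: "A \<in> carrier_mat n n"
  shows "(\<Sum>i<n. \<Sum>j<n. f i j * (A ^\<^sub>m p) $$ (i, j)) =
    (\<Sum>w\<in>{..<Suc p} \<rightarrow>\<^sub>E {..<n}. f (w 0) (w p) * (\<Prod>q<p. A $$ (w q, w (Suc q))))"
proof (induction p arbitrary: f)
  case 0
  have "(\<Sum>w\<in>{..<Suc 0} \<rightarrow>\<^sub>E {..<n}. f (w 0) (w 0)) = (\<Sum>i<n. f i i)"
    using sum_PiE_insert[of 0 "{}" "\<lambda>w. f (w 0) (w 0)" "\<lambda>_. {..<n}"] by (simp add: lessThan_Suc)
  moreover have "(\<Sum>j<n. f i j * (1\<^sub>m n) $$ (i, j)) = f i i" if "i < n" for i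
    using that by (simp add: if_distrib cong: if_cong)
  ultimately show ?case using A by simp
next
  case (Suc p)
  have Ap: "A ^\<^sub>m p \<in> carrier_mat n n" using A by simp
  have "(\<Sum>i<n. \<Sum>j<n. f i j * (A ^\<^sub>m Suc p) $$ (i, j)) =
      (\<Sum>i<n. \<Sum>j<n. \<Sum>l<n. f i j * ((A ^\<^sub>m p) $$ (i, l) * A $$ (l, j)))"
    by (intro sum.cong refl)
       (simp only: pow_mat.simps mat_mult_index[OF Ap A] lessThan_iff sum_distrib_left)
  also have "\<dots> = (\<Sum>i<n. \<Sum>l<n. (\<Sum>j<n. f i j * A $$ (l, j)) * (A ^\<^sub>m p) $$ (i, l))"
    by (rule sum.cong[OF refl], subst sum.swap, simp only: sum_distrib_right, intro sum.cong refl) (simp only: mult_ac)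
  also have "\<dots> = (\<Sum>w\<in>{..<Suc p} \<rightarrow>\<^sub>E {..<n}. (\<Sum>j<n. f (w 0) j * A $$ (w p, j)) *
        (\<Prod>q<p. A $$ (w q, w (Suc q))))"
    by (rule Suc.IH)
  also have "\<dots> = (\<Sum>j<n. \<Sum>w\<in>{..<Suc p} \<rightarrow>\<^sub>E {..<n}. f (w 0) j * A $$ (w p, j) *
        (\<Prod>q<p. A $$ (w q, w (Suc q))))"
    by (subst sum.swap) (simp add: sum_distrib_right)
  also have "\<dots> = (\<Sum>w\<in>{..<Suc (Suc p)} \<rightarrow>\<^sub>E {..<n}. f (w 0) (w (Suc p)) *
        (\<Prod>q<Suc p. A $$ (w q, w (Suc q))))"
    by (subst lessThan_Suc[of "Suc p"], subst sum_PiE_insert) (auto simp: mult_ac intro!: sum.cong prod.cong)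
  finally show ?case .
qed

lemma mat_trace_pow:
  fixes A :: "'a :: comm_semiring_1 Matrix.mat"
  assumes A: "A \<in> carrier_mat n n" and p: "0 < p"
  shows "mat_trace (A ^\<^sub>m p) =
    (\<Sum>w\<in>{..<p} \<rightarrow>\<^sub>E {..<n}. \<Prod>q<p. A $$ (w q, w (Suc q mod p)))"
proof -
  obtain r where r: "p = Suc r" using p gr0_conv_Suc by blast
  have Ar: "A ^\<^sub>m r \<in> carrier_mat n n" using A by simp
  have dim: "dim_row (A ^\<^sub>m p) = n" using pow_carrier_mat[OF A, of p] by (rule carrier_matD)
  have "mat_trace (A ^\<^sub>m p) = (\<Sum>i<n. (A ^\<^sub>m r * A) $$ (i, i))"
    unfolding mat_trace_def dim by (simp add: r)
  also have "\<dots> = (\<Sum>i<n. \<Sum>l<n. A $$ (l, i) * (A ^\<^sub>m r) $$ (i, l))"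
    by (intro sum.cong refl) (simp only: mat_mult_index[OF Ar A] lessThan_iff mult.commute)
  also have "\<dots> = (\<Sum>w\<in>{..<Suc r} \<rightarrow>\<^sub>E {..<n}. A $$ (w r, w 0) * (\<Prod>q<r. A $$ (w q, w (Suc q))))"
    by (rule sum_mat_pow_weighted[OF A])
  also have "\<dots> = (\<Sum>w\<in>{..<p} \<rightarrow>\<^sub>E {..<n}. \<Prod>q<p. A $$ (w q, w (Suc q mod p)))"
    unfolding r by (intro sum.cong refl) (auto simp: mult.commute intro!: prod.cong)
  finally show ?thesis .
qed

lemma mat_trace_mult_commute:
  fixes A :: "'a :: comm_semiring_1 Matrix.mat"
  assumes "A \<in> carrier_mat n n" "B \<in> carrier_mat n n"
  shows "mat_trace (A * B) = mat_trace (B * A)"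
proof -
  have "mat_trace (A * B) = (\<Sum>i<n. \<Sum>l<n. A $$ (i, l) * B $$ (l, i))"
    using assms by (simp add: mat_trace_def mat_mult_index[OF assms] del: index_mult_mat(1))
  also have "\<dots> = (\<Sum>l<n. \<Sum>i<n. B $$ (l, i) * A $$ (i, l))"
    by (subst sum.swap) (simp add: mult.commute)
  also have "\<dots> = mat_trace (B * A)"
    using assms by (simp add: mat_trace_def mat_mult_index[OF assms(2,1)] del: index_mult_mat(1))
  finally show ?thesis .
qed

lemma upper_triangular_pow:
  fixes B :: "'a :: comm_semiring_1 Matrix.mat"
  assumes B: "B \<in> carrier_mat n n" "upper_triangular B" and i: "i < n" and j: "j \<le> i"
  shows "(B ^\<^sub>m k) $$ (i, j) = (if i = j then (B $$ (i, i)) ^ k else 0)"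
  using i j
proof (induction k arbitrary: i j)
  case (Suc k)
  have Bk: "B ^\<^sub>m k \<in> carrier_mat n n" using B by simp
  have z: "B $$ (l, j) = 0" if "j < l" "l < n" for l j using that B by auto
  have "(B ^\<^sub>m Suc k) $$ (i, j) = (\<Sum>l<n. (B ^\<^sub>m k) $$ (i, l) * B $$ (l, j))"
    using Suc.prems by (simp only: pow_mat.simps, intro mat_mult_index[OF Bk B(1)]) auto
  also have "\<dots> = (\<Sum>l<n. if l = i then (if i = j then (B $$ (i, i)) ^ Suc k else 0) else 0)"
  proof (rule sum.cong[OF refl])
    fix l assume "l \<in> {..<n}"
    then show "(B ^\<^sub>m k) $$ (i, l) * B $$ (l, j) =
        (if l = i then (if i = j then (B $$ (i, i)) ^ Suc k else 0) else 0)"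
      using Suc.prems Suc.IH[of i l] z[of j l]
      by (cases "l < i"; cases "l = i"; cases "i = j") (auto simp: mult.commute)
  qed
  also have "\<dots> = (if i = j then (B $$ (i, i)) ^ Suc k else 0)" using Suc.prems by simp
  finally show ?case .
qed (use B in auto)

text \<open>Schur's theorem makes the matrix similar to an upper triangular one whose diagonal is the list of
  eigenvalues; traces of powers are invariant under similarity, and powers of a triangular matrix
  have the powers on the diagonal.\<close>

lemma mat_trace_pow_eigenvalues:
  fixes A :: "real Matrix.mat"
  assumes A: "A \<in> carrier_mat n n" and cp: "char_poly A = (\<Prod>e\<leftarrow>es. [:- e, 1:])"
  shows "mat_trace (A ^\<^sub>m k) = (\<Sum>e\<leftarrow>es. e ^ k)"
proof -
  obtain B P Q where dec: "schur_decomposition A es = (B, P, Q)" by (cases "schur_decomposition A es")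
  from schur_decomposition[OF A cp dec]
  have sim: "similar_mat_wit A B P Q" and ut: "upper_triangular B" and diag: "diag_mat B = es" by auto
  have simk: "similar_mat_wit (A ^\<^sub>m k) (B ^\<^sub>m k) P Q" using sim by (rule similar_mat_wit_pow)
  have Ak: "A ^\<^sub>m k \<in> carrier_mat n n" using A by simp
  note D = similar_mat_witD2[OF Ak simk]
  have B: "B \<in> carrier_mat n n" using similar_mat_witD2[OF A sim] by auto
  have "mat_trace (A ^\<^sub>m k) = mat_trace (P * (B ^\<^sub>m k * Q))"
    using D by (simp add: assoc_mult_mat[of _ n n _ n _ n])
  also have "\<dots> = mat_trace (B ^\<^sub>m k * Q * P)"
    using D by (intro mat_trace_mult_commute[of _ n]) auto
  also have "\<dots> = mat_trace (B ^\<^sub>m k)"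
    using D right_mult_one_mat[OF D(5)] by (simp add: assoc_mult_mat[of _ n n _ n _ n])
  also have "\<dots> = (\<Sum>i<n. (B $$ (i, i)) ^ k)"
    using B D(5) upper_triangular_pow[OF B ut] by (simp add: mat_trace_def)
  also have "\<dots> = (\<Sum>e\<leftarrow>es. e ^ k)"
    unfolding diag[symmetric] diag_mat_def using B by (simp add: interv_sum_list_conv_sum_set_nat atLeast0LessThan comp_def)
  finally show ?thesis .
qed

text \<open>For an eigenvector \<open>x\<close> over the complex numbers the quadratic form \<open>Q = \<Sum>\<^sub>i\<^sub>j x\<^sub>i\<^sup>* A\<^sub>i\<^sub>j x\<^sub>j\<close> equals the
  eigenvalue times the positive number \<open>\<Sum>\<^sub>i |x\<^sub>i|\<^sup>2\<close>, and symmetry makes \<open>Q\<close> its own conjugate.\<close>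

lemma eigenvalue_symmetric_real:
  fixes A :: "real Matrix.mat"
  assumes A: "A \<in> carrier_mat n n" and sym: "\<And>i j. i < n \<Longrightarrow> j < n \<Longrightarrow> A $$ (i, j) = A $$ (j, i)"
    and ev: "eigenvalue (map_mat complex_of_real A) z"
  shows "z \<in> \<real>"
proof -
  let ?C = "map_mat complex_of_real A"
  obtain v where v: "v \<in> carrier_vec n" "v \<noteq> 0\<^sub>v n" "?C *\<^sub>v v = z \<cdot>\<^sub>v v"
    using ev A unfolding eigenvalue_def eigenvector_def by auto
  define x where "x i = vec_index v i" for i
  have eq: "(\<Sum>j<n. complex_of_real (A $$ (i, j)) * x j) = z * x i" if i: "i < n" for i
  proof -
    have "vec_index (?C *\<^sub>v v) i = (\<Sum>j<n. complex_of_real (A $$ (i, j)) * x j)"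
      using A v(1) i by (auto simp: scalar_prod_def x_def atLeast0LessThan)
    moreover have "vec_index (z \<cdot>\<^sub>v v) i = z * x i" using v(1) i by (simp add: x_def)
    ultimately show ?thesis using v(3) by simp
  qed
  define S where "S = (\<Sum>i<n. (cmod (x i))\<^sup>2)"
  define Q where "Q = (\<Sum>i<n. \<Sum>j<n. cnj (x i) * complex_of_real (A $$ (i, j)) * x j)"
  have "Q = (\<Sum>i<n. cnj (x i) * (z * x i))"
    unfolding Q_def by (intro sum.cong refl) (simp add: eq[symmetric] sum_distrib_left mult.assoc)
  also have "\<dots> = z * complex_of_real S"
    unfolding S_def by (simp add: sum_distrib_left complex_norm_square mult_ac del: of_real_power)
  finally have Q: "Q = z * complex_of_real S" .
  have "cnj Q = (\<Sum>i<n. \<Sum>j<n. cnj (x j) * complex_of_real (A $$ (i, j)) * x i)"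
    unfolding Q_def by (simp add: mult_ac)
  also have "\<dots> = Q" unfolding Q_def by (subst sum.swap) (simp add: sym)
  finally have "cnj z * complex_of_real S = z * complex_of_real S" unfolding Q by simp
  moreover have "S \<noteq> 0"
  proof
    assume "S = 0"
    then have "x i = 0" if "i < n" for i
      using that unfolding S_def by (subst (asm) sum_nonneg_eq_0_iff) auto
    then have "v = 0\<^sub>v n" using v(1) by (intro eq_vecI) (auto simp: x_def)
    with v(2) show False by simp
  qed
  ultimately show ?thesis by (simp add: Reals_cnj_iff)
qed

lemma symmetric_char_poly_splits:
  fixes A :: "real Matrix.mat"
  assumes A: "A \<in> carrier_mat n n" and sym: "\<And>i j. i < n \<Longrightarrow> j < n \<Longrightarrow> A $$ (i, j) = A $$ (j, i)"
  obtains es where "char_poly A = (\<Prod>e\<leftarrow>es. [:- e, 1:])" "length es = n"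
proof -
  let ?C = "map_mat complex_of_real A"
  have C: "?C \<in> carrier_mat n n" using A by simp
  obtain as where as: "char_poly ?C = (\<Prod>a\<leftarrow>as. [:- a, 1:])" "length as = n"
    using char_poly_factorized[OF C] by blast
  have real: "a \<in> \<real>" if "a \<in> set as" for a
  proof (rule eigenvalue_symmetric_real[OF A sym])
    have "poly (char_poly ?C) a = 0" using that unfolding as(1)
      by (force simp: poly_prod_list prod_list_zero_iff)
    then show "eigenvalue ?C a" using eigenvalue_root_char_poly[OF C] by simp
  qed
  interpret h: map_poly_inj_comm_ring_hom complex_of_real by unfold_locales auto
  have "map_poly complex_of_real (char_poly A) = char_poly ?C"
    by (rule of_real_hom.char_poly_hom[OF A, symmetric])
  also have "\<dots> = (\<Prod>a\<leftarrow>as. map_poly complex_of_real [:- Re a, 1:])"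
    unfolding as(1) using real
    by (intro arg_cong[where f = prod_list] map_cong refl) (auto simp: of_real_Re)
  also have "\<dots> = map_poly complex_of_real (\<Prod>a\<leftarrow>map Re as. [:- a, 1:])"
    by (simp only: h.hom_prod_list map_map o_def)
  finally have "char_poly A = (\<Prod>a\<leftarrow>map Re as. [:- a, 1:])" by (rule h.injectivity)
  then show thesis using as(2) by (intro that[of "map Re as"]) auto
qed

text \<open>A uniformly chosen position in the list of eigenvalues has the spectral distribution as its law.
  This reduces all integrals to finite averages.\<close>

lemma eigenvalue_distribution_eq_distr:
  fixes A :: "real Matrix.mat"
  assumes A: "A \<in> carrier_mat n n" and n: "0 < n"
    and cp: "char_poly A = (\<Prod>e\<leftarrow>es. [:- e, 1:])" "length es = n"
  shows "eigenvalue_distribution A = distr (measure_pmf (pmf_of_set {..<n})) borel ((!) es)"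
proof (rule measure_eqI)
  fix B assume "B \<in> sets (eigenvalue_distribution A)"
  then have B: "B \<in> sets borel" by simp
  have lin: "proots [:- e, 1:] = {#e#}" for e :: real 
    using proots_linear_factor[of "-e"] by simp
  have "(\<Prod>e\<leftarrow>es. [:- e, 1:]) \<noteq> 0 \<and> proots (\<Prod>e\<leftarrow>es. [:- e, 1:]) = mset es"
    by (induction es) (auto simp: proots_mult lin simp del: mult_pCons_left)
  then have "proots (char_poly A) = mset es" unfolding cp(1) by blast
  then have "emeasure (eigenvalue_distribution A) B = (\<Sum>l\<in>#mset es. indicator B l) / of_nat n"
    using A B by (simp add: emeasure_eigenvalue_distribution)
  also have "(\<Sum>l\<in>#mset es. indicator B l :: ennreal) = (\<Sum>i<n. indicator B (es ! i))"
    using cp(2) by (simp add: sum_mset_sum_list sum_list_sum_nth atLeast0LessThan flip: mset_map)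
  also have "\<dots> = of_nat (card ({..<n} \<inter> (!) es -` B))"
    by (simp add: indicator_def sum.If_cases vimage_def Int_def)
  finally have "emeasure (eigenvalue_distribution A) B =
      of_nat (card ({..<n} \<inter> (!) es -` B)) / of_nat n" .
  also have "\<dots> = ennreal (real (card ({..<n} \<inter> (!) es -` B)) / real n)"
    using n by (simp add: divide_ennreal ennreal_of_nat_eq_real_of_nat)
  finally show "emeasure (eigenvalue_distribution A) B =
      emeasure (distr (measure_pmf (pmf_of_set {..<n})) borel ((!) es)) B"
    using B n by (simp add: emeasure_distr emeasure_pmf_of_set lessThan_empty_iff)
qed simp

lemma eigenvalue_distribution_moments:
  fixes A :: "real Matrix.mat"
  assumes A: "A \<in> carrier_mat n n" and n: "0 < n"
    and sym: "\<And>i j. i < n \<Longrightarrow> j < n \<Longrightarrow> A $$ (i, j) = A $$ (j, i)"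
  shows "real_distribution (eigenvalue_distribution A)"
    and "integrable (eigenvalue_distribution A) (\<lambda>x. x ^ k)"
    and "integral\<^sup>L (eigenvalue_distribution A) (\<lambda>x. x ^ k) = mat_trace (A ^\<^sub>m k) / n"
proof -
  obtain es where es: "char_poly A = (\<Prod>e\<leftarrow>es. [:- e, 1:])" "length es = n"
    by (rule symmetric_char_poly_splits[OF A sym])
  note eq = eigenvalue_distribution_eq_distr[OF A n es]
  show "real_distribution (eigenvalue_distribution A)"
    unfolding eq by (rule prob_space.real_distribution_distr) (auto simp: measure_pmf.prob_space_axioms)
  show "integrable (eigenvalue_distribution A) (\<lambda>x. x ^ k)"
    unfolding eq using n
    by (subst integrable_distr_eq) (auto intro!: integrable_measure_pmf_finite simp: lessThan_empty_iff)
  have "integral\<^sup>L (eigenvalue_distribution A) (\<lambda>x. x ^ k) = (\<Sum>i<n. (es ! i) ^ k) / n"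
    unfolding eq using n
    by (subst integral_distr) (auto simp: integral_pmf_of_set lessThan_empty_iff)
  also have "(\<Sum>i<n. (es ! i) ^ k) = mat_trace (A ^\<^sub>m k)"
    using mat_trace_pow_eigenvalues[OF A es(1), of k] es(2)
    by (simp add: sum_list_sum_nth atLeast0LessThan)
  finally show "integral\<^sup>L (eigenvalue_distribution A) (\<lambda>x. x ^ k) = mat_trace (A ^\<^sub>m k) / n" .
qed

section \<open>The method of moments\<close>

definition has_moments :: "real measure \<Rightarrow> (nat \<Rightarrow> real) \<Rightarrow> bool" where
  "has_moments \<nu> mo \<longleftrightarrow> real_distribution \<nu> \<and> (\<forall>k. has_bochner_integral \<nu> (\<lambda>x. x ^ k) (mo k))"

text \<open>The remainder of order \<open>2k\<close> in the Taylor expansion of the characteristic function at \<open>t\<close> is at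
  most twice this term.\<close>

definition small_moments :: "(nat \<Rightarrow> real) \<Rightarrow> bool" where
  "small_moments mo \<longleftrightarrow> (\<forall>t::real. (\<lambda>k. \<bar>t\<bar> ^ (2 * k) / fact (2 * k) * mo (2 * k)) \<longlonglongrightarrow> 0)"

lemma char_approx_even:
  assumes "has_moments \<nu> mo"
  shows "cmod (char \<nu> t - (\<Sum>k\<le>2 * n. (\<i> * t) ^ k / fact k * mo k))
    \<le> 2 * (\<bar>t\<bar> ^ (2 * n) / fact (2 * n) * mo (2 * n))"
proof -
  interpret real_distribution \<nu> using assms by (simp add: has_moments_def)
  have I: "integrable \<nu> (\<lambda>x. x ^ k)" "expectation (\<lambda>x. x ^ k) = mo k" for k
    using assms by (auto simp: has_moments_def has_bochner_integral_iff)
  have "\<bar>x::real\<bar> ^ (2 * n) = x ^ (2 * n)" for x by (simp add: power_mult)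
  then show ?thesis using char_approx1[of "2 * n" t] I by simp
qed

text \<open>A Taylor polynomial of large enough degree approximates the limit, and its remainder is controlled
  by a single even moment. That moment converges too, so the same degree also serves all but finitely
  many members of the sequence.\<close>

lemma char_tendsto_of_moments:
  assumes mu: "\<And>n. has_moments (\<mu> n) (mn n)" and gam: "has_moments \<gamma> mo"
    and conv: "\<And>k. (\<lambda>n. mn n k) \<longlonglongrightarrow> mo k" and small: "small_moments mo"
  shows "(\<lambda>n. char (\<mu> n) t) \<longlonglongrightarrow> char \<gamma> t"
proof (rule LIMSEQ_I)
  fix e :: real assume e: "0 < e"
  define c where "c K = \<bar>t\<bar> ^ (2 * K) / fact (2 * K)" for K
  have "(\<lambda>K. c K * mo (2 * K)) \<longlonglongrightarrow> 0" using small by (auto simp: small_moments_def c_def)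
  \<comment> \<open>Two remainders below \<open>2 * (e / 8)\<close> and a difference of Taylor polynomials below \<open>e / 4\<close> add up to less than \<open>e\<close>.\<close>
  from order_tendstoD(2)[OF this, of "e / 8"] e obtain K where K: "c K * mo (2 * K) < e / 8"
    by (auto dest: eventually_happens)
  define S where "S m = (\<Sum>k\<le>2 * K. (\<i> * t) ^ k / fact k * complex_of_real (m k))" for m
  have "(\<lambda>n. c K * mn n (2 * K)) \<longlonglongrightarrow> c K * mo (2 * K)" by (intro tendsto_intros conv)
  then have 1: "\<forall>\<^sub>F n in sequentially. c K * mn n (2 * K) < e / 8" using K by (rule order_tendstoD(2))
  have "(\<lambda>n. S (mn n)) \<longlonglongrightarrow> S mo" unfolding S_def by (intro tendsto_intros conv)
  then have 2: "\<forall>\<^sub>F n in sequentially. dist (S (mn n)) (S mo) < e / 4"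
    using e by (intro tendstoD) auto
  have "\<forall>\<^sub>F n in sequentially. norm (char (\<mu> n) t - char \<gamma> t) < e"
    using 1 2
  proof eventually_elim
    case (elim n)
    have a: "cmod (char (\<mu> n) t - S (mn n)) \<le> 2 * (c K * mn n (2 * K))"
      using char_approx_even[OF mu[of n], of t K] by (simp add: S_def c_def)
    have b: "cmod (char \<gamma> t - S mo) \<le> 2 * (c K * mo (2 * K))"
      using char_approx_even[OF gam, of t K] by (simp add: S_def c_def)
    have "char (\<mu> n) t - char \<gamma> t = (char (\<mu> n) t - S (mn n)) + (S (mn n) - S mo) - (char \<gamma> t - S mo)"
      by simp
    also have "norm \<dots> \<le> cmod (char (\<mu> n) t - S (mn n)) + cmod (S (mn n) - S mo) + cmod (char \<gamma> t - S mo)"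
      by (intro order_trans[OF norm_triangle_ineq4] add_right_mono norm_triangle_ineq)
    also have "\<dots> < e" using a b elim K e unfolding dist_norm by linarith
    finally show ?case .
  qed
  then show "\<exists>no. \<forall>n\<ge>no. norm (char (\<mu> n) t - char \<gamma> t) < e"
    by (simp add: eventually_sequentially)
qed

lemma has_moments_unique:
  assumes "has_moments \<nu> mo" "has_moments \<gamma> mo" "small_moments mo"
  shows "\<nu> = \<gamma>"
proof (rule Levy_uniqueness)
  show "real_distribution \<nu>" "real_distribution \<gamma>" using assms by (auto simp: has_moments_def)
  have "(\<lambda>n. char \<nu> t) \<longlonglongrightarrow> char \<gamma> t" for t
    by (rule char_tendsto_of_moments[of "\<lambda>_. \<nu>" "\<lambda>_. mo"]) (use assms in auto)
  then show "char \<nu> = char \<gamma>" by (intro ext) (simp add: LIMSEQ_const_iff)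
qed

lemma weak_conv_of_moments:
  assumes mu: "\<And>n. has_moments (\<mu> n) (mn n)" and gam: "has_moments \<gamma> mo"
    and conv: "\<And>k. (\<lambda>n. mn n k) \<longlonglongrightarrow> mo k" and small: "small_moments mo"
  shows "weak_conv_m \<mu> \<gamma>"
  by (rule levy_continuity)
     (use assms char_tendsto_of_moments[OF assms] in \<open>auto simp: has_moments_def\<close>)

text \<open>Chebyshev's inequality with a common bound for the second moments.\<close>

lemma tight_of_moments:
  assumes mu: "\<And>n. has_moments (\<mu> n) (mn n)" and conv: "(\<lambda>n. mn n 2) \<longlonglongrightarrow> L"
  shows "tight \<mu>"
  unfolding tight_def
proof (intro conjI allI impI)
  show "real_distribution (\<mu> n)" for n using mu by (simp add: has_moments_def)
  fix e :: real assume e: "0 < e"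
  obtain B where "0 < B" "\<forall>n. norm (mn n 2) \<le> B"
    using convergent_imp_Bseq[OF convergentI[OF conv]] by (rule BseqE)
  then have B: "\<bar>mn n 2\<bar> \<le> B" "0 < B" for n by auto
  \<comment> \<open>This choice makes Chebyshev's bound \<open>B / c\<^sup>2\<close> equal to \<open>e / 2\<close>.\<close>
  define c where "c = sqrt (2 * B / e)"
  have c: "0 < c" "c\<^sup>2 = 2 * B / e" using B(2) e by (auto simp: c_def)
  show "\<exists>a b. a < b \<and> (\<forall>n. 1 - e < measure (\<mu> n) {a<..b})"
  proof (rule exI[of _ "- c"], rule exI[of _ c], intro conjI allI)
    fix n
    interpret real_distribution "\<mu> n" using mu by (simp add: has_moments_def)
    have I: "integrable (\<mu> n) (\<lambda>x. x ^ 2)" "expectation (\<lambda>x. x ^ 2) = mn n 2"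
      using mu[of n] by (auto simp: has_moments_def has_bochner_integral_iff)
    have "prob {x \<in> space (\<mu> n). c\<^sup>2 \<le> x\<^sup>2} \<le> expectation (\<lambda>x. x\<^sup>2) / c\<^sup>2"
      by (rule integral_Markov_inequality_measure[OF I(1), where A = "{}"]) (use c B(2) e in auto)
    also have "\<dots> \<le> B / c\<^sup>2" using B(1)[of n] I(2) by (intro divide_right_mono) auto
    also have "B / c\<^sup>2 = e / 2" using B(2) by (simp add: c(2))
    also have "\<dots> < e" using e by simp
    finally have 1: "prob {x. c\<^sup>2 \<le> x\<^sup>2} < e" by simp
    have "1 - prob {- c<..c} = prob (space (\<mu> n) - {- c<..c})" by (subst prob_compl) auto
    also have "\<dots> \<le> prob {x. c\<^sup>2 \<le> x\<^sup>2}"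
    proof (rule finite_measure_mono)
      show "{x. c\<^sup>2 \<le> x\<^sup>2} \<in> events" by simp
      show "space (\<mu> n) - {- c<..c} \<subseteq> {x. c\<^sup>2 \<le> x\<^sup>2}"
        using c(1) by (auto simp: abs_le_square_iff[symmetric])
    qed
    finally show "1 - e < prob {- c<..c}" using 1 by simp
  qed (use c in auto)
qed

text \<open>Powers are unbounded, so weak convergence says nothing about their integrals. Truncating the
  argument makes them bounded and continuous.\<close>

definition clamp_real :: "real \<Rightarrow> real \<Rightarrow> real" where "clamp_real R x = max (- R) (min R x)"

lemma clamp_real_bounds:
  assumes "0 \<le> R"
  shows "\<bar>clamp_real R x\<bar> \<le> R" "\<bar>clamp_real R x\<bar> \<le> \<bar>x\<bar>"
    and "\<bar>x\<bar> \<le> R \<Longrightarrow> clamp_real R x = x"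
    and "\<bar>x ^ k - clamp_real R x ^ k\<bar> \<le> \<bar>x\<bar> ^ k"
proof -
  show "\<bar>clamp_real R x\<bar> \<le> R" and A: "\<bar>clamp_real R x\<bar> \<le> \<bar>x\<bar>"
    and "\<bar>x\<bar> \<le> R \<Longrightarrow> clamp_real R x = x" using assms by (auto simp: clamp_real_def)
  show "\<bar>x ^ k - clamp_real R x ^ k\<bar> \<le> \<bar>x\<bar> ^ k"
  proof (cases "0 \<le> x")
    case True
    then have "0 \<le> clamp_real R x" "clamp_real R x \<le> x" using assms by (auto simp: clamp_real_def)
    then show ?thesis using power_mono[of "clamp_real R x" x k] zero_le_power[of "clamp_real R x" k] True
      by (auto simp: abs_if)
  next
    case False
    define u v where "u = - x" and "v = - clamp_real R x"
    have "0 \<le> v" "v \<le> u" using assms False by (auto simp: clamp_real_def u_def v_def)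
    then have "\<bar>u ^ k - v ^ k\<bar> \<le> u ^ k" using power_mono[of v u k] zero_le_power[of v k] by auto
    moreover have "\<bar>x ^ k - clamp_real R x ^ k\<bar> = \<bar>u ^ k - v ^ k\<bar>"
      unfolding u_def v_def by (cases "even k") auto
    moreover have "\<bar>x\<bar> ^ k = u ^ k" using False by (simp add: u_def)
    ultimately show ?thesis by simp
  qed
qed

lemma abs_power_le_even_power: "\<bar>x::real\<bar> ^ k \<le> 1 + x ^ (2 * k)"
proof -
  have "0 \<le> (\<bar>x\<bar> ^ k)\<^sup>2 + 1 - 2 * \<bar>x\<bar> ^ k"
    using zero_le_power2[of "\<bar>x\<bar> ^ k - 1"] by (simp add: power2_diff)
  moreover have "0 \<le> \<bar>x\<bar> ^ k" by simp
  ultimately have "\<bar>x\<bar> ^ k \<le> 1 + (\<bar>x\<bar> ^ k)\<^sup>2" by linarith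
  also have "(\<bar>x\<bar> ^ k)\<^sup>2 = (x ^ k)\<^sup>2" by (simp add: power_abs[symmetric])
  also have "\<dots> = x ^ (2 * k)" by (simp add: power_mult[symmetric] mult.commute)
  finally show ?thesis .
qed

text \<open>The error of truncation vanishes on \<open>[-R, R]\<close>; outside, \<open>x\<^sup>2 / R\<^sup>2 \<ge> 1\<close> turns it into an even
  moment with a small factor. This is the uniform integrability used for passing to the limit.\<close>

lemma clamp_real_error:
  assumes "0 < R"
  shows "\<bar>x ^ k - clamp_real R x ^ k\<bar> \<le> (x ^ 2 + x ^ (2 * k + 2)) / R\<^sup>2"
proof (cases "\<bar>x\<bar> \<le> R")
  case True
  have "0 \<le> (x ^ 2 + x ^ (2 * k + 2)) / R\<^sup>2"
    by (intro divide_nonneg_nonneg add_nonneg_nonneg zero_le_even_power) auto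
  with True show ?thesis using clamp_real_bounds(3)[of R x] assms by simp
next
  case False
  have "\<bar>x\<bar> ^ k \<le> 1 + x ^ (2 * k)" by (rule abs_power_le_even_power)
  also have "\<dots> \<le> (1 + x ^ (2 * k)) * (x\<^sup>2 / R\<^sup>2)"
  proof -
    have "R\<^sup>2 \<le> x\<^sup>2" using False assms by (auto simp: abs_le_square_iff[symmetric])
    then have "1 \<le> x\<^sup>2 / R\<^sup>2" using assms by simp
    moreover have "0 \<le> 1 + x ^ (2 * k)" by (simp add: power_mult)
    ultimately show ?thesis using mult_left_mono[of 1 "x\<^sup>2 / R\<^sup>2" "1 + x ^ (2 * k)"] by simp
  qed
  also have "\<dots> = (x ^ 2 + x ^ (2 * k + 2)) / R\<^sup>2" by (simp add: field_simps power_add power2_eq_square)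
  finally show ?thesis using clamp_real_bounds(4)[of R x k] assms by linarith
qed

lemma continuous_clamp_real [continuous_intros]: "isCont (\<lambda>x. clamp_real R x ^ k) x"
  unfolding clamp_real_def by (intro continuous_intros)

lemma clamp_real_measurable [measurable]: "clamp_real R \<in> borel_measurable borel"
  unfolding clamp_real_def by measurable

lemma clamp_real_tendsto: "(\<lambda>R. clamp_real (real R) x ^ k) \<longlonglongrightarrow> x ^ k"
proof (rule tendsto_eventually)
  obtain R0 where "\<bar>x\<bar> \<le> real R0" using real_arch_simple by blast
  then show "\<forall>\<^sub>F R in sequentially. clamp_real (real R) x ^ k = x ^ k"
    unfolding eventually_sequentially by (intro exI[of _ R0]) (auto simp: clamp_real_bounds(3))
qed

text \<open>Fatou's lemma bounds the even moments of the limit, which makes all powers integrable. The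
  truncated moments converge as \<open>n\<close> tends to infinity, with an error \<open>O(1/R\<^sup>2)\<close> that does not depend on
  \<open>n\<close>; then the truncation level \<open>R\<close> tends to infinity.\<close>

lemma weak_limit_has_moments:
  assumes mu: "\<And>n. has_moments (\<mu> n) (mn n)" and conv: "\<And>k. (\<lambda>n. mn n k) \<longlonglongrightarrow> mo k"
    and gam: "real_distribution \<gamma>" and weak: "weak_conv_m \<mu> \<gamma>"
  shows "has_moments \<gamma> mo"
proof -
  have rd: "real_distribution (\<mu> n)" for n using mu by (simp add: has_moments_def)
  have I: "integrable (\<mu> n) (\<lambda>x. x ^ k)" "integral\<^sup>L (\<mu> n) (\<lambda>x. x ^ k) = mn n k" for n k
    using mu[of n] by (auto simp: has_moments_def has_bochner_integral_iff)
  interpret g: real_distribution \<gamma> by (rule gam)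
  have bd: "norm (clamp_real (real R) x ^ k) \<le> real R ^ k" for R k x
    using clamp_real_bounds(1)[of "real R" x] by (simp add: power_abs power_mono)
  have cl: "(\<lambda>n. integral\<^sup>L (\<mu> n) (\<lambda>x. clamp_real (real R) x ^ k)) \<longlonglongrightarrow>
      integral\<^sup>L \<gamma> (\<lambda>x. clamp_real (real R) x ^ k)" for R k
    by (rule weak_conv_imp_integral_bdd_continuous_conv[OF rd gam weak continuous_clamp_real bd])
  have icl: "integrable \<nu> (\<lambda>x. clamp_real (real R) x ^ k)" if "real_distribution \<nu>" for \<nu> R k
  proof -
    interpret real_distribution \<nu> by fact
    show ?thesis using bd by (intro integrable_const_bound[of _ "real R ^ k"]) auto
  qed
  have even: "integrable \<gamma> (\<lambda>x. x ^ (2 * k))" for k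
  proof (rule integrableI_bounded)
    have nn: "0 \<le> x ^ (2 * k)" for x :: real by (simp add: power_mult)
    have le: "integral\<^sup>L \<gamma> (\<lambda>x. clamp_real (real R) x ^ (2 * k)) \<le> mo (2 * k)" for R
    proof (rule LIMSEQ_le[OF cl conv], intro exI allI impI)
      fix n
      have "clamp_real (real R) x ^ (2 * k) \<le> x ^ (2 * k)" for x
        using clamp_real_bounds(2)[of "real R" x]
        by (simp add: power_mult abs_le_square_iff power_mono)
      then show "integral\<^sup>L (\<mu> n) (\<lambda>x. clamp_real (real R) x ^ (2 * k)) \<le> mn n (2 * k)"
        unfolding I(2)[symmetric] by (intro integral_mono icl rd I(1)) auto
    qed
    have "(\<integral>\<^sup>+x. ennreal (norm (x ^ (2 * k))) \<partial>\<gamma>) =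
        (\<integral>\<^sup>+x. liminf (\<lambda>R. ennreal (clamp_real (real R) x ^ (2 * k))) \<partial>\<gamma>)"
    proof (rule nn_integral_cong)
      fix x :: real
      have "(\<lambda>R. ennreal (clamp_real (real R) x ^ (2 * k))) \<longlonglongrightarrow> ennreal (x ^ (2 * k))"
        by (intro tendsto_ennrealI clamp_real_tendsto)
      then show "ennreal (norm (x ^ (2 * k))) = liminf (\<lambda>R. ennreal (clamp_real (real R) x ^ (2 * k)))"
        using nn[of x] by (subst lim_imp_Liminf) auto
    qed
    also have "\<dots> \<le> liminf (\<lambda>R. \<integral>\<^sup>+x. ennreal (clamp_real (real R) x ^ (2 * k)) \<partial>\<gamma>)"
      by (rule nn_integral_liminf) simp
    also have "\<dots> \<le> liminf (\<lambda>R::nat. ennreal (mo (2 * k)))"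
      using le nn by (intro Liminf_mono always_eventually allI, subst nn_integral_eq_integral)
        (auto intro!: icl gam ennreal_leI)
    also have "\<dots> < \<infinity>" by (simp add: Liminf_const)
    finally show "(\<integral>\<^sup>+x. ennreal (norm (x ^ (2 * k))) \<partial>\<gamma>) < \<infinity>" .
  qed simp
  have int: "integrable \<gamma> (\<lambda>x. x ^ k)" for k
  proof (rule Bochner_Integration.integrable_bound)
    show "integrable \<gamma> (\<lambda>x. 1 + x ^ (2 * k))" using even by auto
    have "norm (x ^ k) \<le> norm (1 + x ^ (2 * k))" for x :: real
    proof -
      have "\<bar>x\<bar> ^ k \<le> 1 + x ^ (2 * k)" by (rule abs_power_le_even_power)
      moreover have "0 \<le> x ^ (2 * k)" by (intro zero_le_even_power) simp
      ultimately show ?thesis by (simp add: power_abs)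
    qed
    then show "AE x in \<gamma>. norm (x ^ k) \<le> norm (1 + x ^ (2 * k))" by simp
  qed simp
  have "integral\<^sup>L \<gamma> (\<lambda>x. x ^ k) = mo k" for k
  proof -
    let ?g = "\<lambda>R. integral\<^sup>L \<gamma> (\<lambda>x. clamp_real (real R) x ^ k)"
    have 1: "?g \<longlonglongrightarrow> integral\<^sup>L \<gamma> (\<lambda>x. x ^ k)"
    proof (rule integral_dominated_convergence[where w = "\<lambda>x. \<bar>x ^ k\<bar>"])
      show "integrable \<gamma> (\<lambda>x. \<bar>x ^ k\<bar>)" using int by (rule integrable_abs)
      show "AE x in \<gamma>. (\<lambda>R. clamp_real (real R) x ^ k) \<longlonglongrightarrow> x ^ k"
        using clamp_real_tendsto by simp
      show "AE x in \<gamma>. norm (clamp_real (real R) x ^ k) \<le> \<bar>x ^ k\<bar>" for R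
        using clamp_real_bounds(2)[of "real R"] by (intro always_eventually allI) (simp add: power_abs power_mono)
    qed auto
    have est: "\<bar>?g R - mo k\<bar> \<le> (mo 2 + mo (2 * k + 2)) / (real R)\<^sup>2" if R: "0 < R" for R
    proof (rule LIMSEQ_le)
      show "(\<lambda>n. \<bar>integral\<^sup>L (\<mu> n) (\<lambda>x. clamp_real (real R) x ^ k) - mn n k\<bar>) \<longlonglongrightarrow> \<bar>?g R - mo k\<bar>"
        by (intro tendsto_intros cl conv)
      show "(\<lambda>n. (mn n 2 + mn n (2 * k + 2)) / (real R)\<^sup>2) \<longlonglongrightarrow> (mo 2 + mo (2 * k + 2)) / (real R)\<^sup>2"
        using R by (intro tendsto_intros conv) auto
      show "\<exists>N. \<forall>n\<ge>N. \<bar>integral\<^sup>L (\<mu> n) (\<lambda>x. clamp_real (real R) x ^ k) - mn n k\<bar> \<le>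
          (mn n 2 + mn n (2 * k + 2)) / (real R)\<^sup>2"
      proof (intro exI allI impI)
        fix n
        have "\<bar>integral\<^sup>L (\<mu> n) (\<lambda>x. clamp_real (real R) x ^ k) - mn n k\<bar> =
            \<bar>integral\<^sup>L (\<mu> n) (\<lambda>x. x ^ k - clamp_real (real R) x ^ k)\<bar>"
          by (subst Bochner_Integration.integral_diff[OF I(1) icl[OF rd]]) (simp add: I(2))
        also have "\<dots> \<le> integral\<^sup>L (\<mu> n) (\<lambda>x. \<bar>x ^ k - clamp_real (real R) x ^ k\<bar>)"
          by (rule integral_abs_bound)
        also have "\<dots> \<le> integral\<^sup>L (\<mu> n) (\<lambda>x. (x ^ 2 + x ^ (2 * k + 2)) / (real R)\<^sup>2)"
        proof (rule integral_mono)
          show "integrable (\<mu> n) (\<lambda>x. \<bar>x ^ k - clamp_real (real R) x ^ k\<bar>)"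
            by (intro integrable_abs Bochner_Integration.integrable_diff I icl rd)
          show "integrable (\<mu> n) (\<lambda>x. (x ^ 2 + x ^ (2 * k + 2)) / (real R)\<^sup>2)"
            by (intro integrable_divide Bochner_Integration.integrable_add I)
          show "\<bar>x ^ k - clamp_real (real R) x ^ k\<bar> \<le> (x ^ 2 + x ^ (2 * k + 2)) / (real R)\<^sup>2" for x
            by (rule clamp_real_error) (use R in simp)
        qed
        also have "\<dots> = (mn n 2 + mn n (2 * k + 2)) / (real R)\<^sup>2"
          by (simp only: integral_divide_zero Bochner_Integration.integral_add[OF I(1) I(1)] I(2))
        finally show "\<bar>integral\<^sup>L (\<mu> n) (\<lambda>x. clamp_real (real R) x ^ k) - mn n k\<bar> \<le>
          (mn n 2 + mn n (2 * k + 2)) / (real R)\<^sup>2" .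
      qed
    qed
    have "(\<lambda>R. (mo 2 + mo (2 * k + 2)) / (real R)\<^sup>2) \<longlonglongrightarrow> 0" by real_asymp
    then have "(\<lambda>R. ?g R - mo k) \<longlonglongrightarrow> 0"
      by (rule Lim_null_comparison[rotated])
         (use est in \<open>auto simp: eventually_sequentially intro!: exI[of _ 1]\<close>)
    then have "?g \<longlonglongrightarrow> mo k" by (simp add: LIM_zero_iff)
    with 1 show ?thesis by (rule LIMSEQ_unique)
  qed
  with int show ?thesis using gam by (auto simp: has_moments_def has_bochner_integral_iff)
qed

lemma limit_with_moments_exists:
  assumes mu: "\<And>n. has_moments (\<mu> n) (mn n)" and conv: "\<And>k. (\<lambda>n. mn n k) \<longlonglongrightarrow> mo k"
  obtains \<gamma> where "has_moments \<gamma> mo"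
proof -
  have "tight \<mu>" using mu conv by (rule tight_of_moments)
  from tight_imp_convergent_subsubsequence[OF this strict_mono_id]
  obtain r \<gamma> where r: "strict_mono (r :: nat \<Rightarrow> nat)" "real_distribution \<gamma>" "weak_conv_m (\<mu> \<circ> id \<circ> r) \<gamma>"
    by blast
  have "has_moments \<gamma> mo"
  proof (rule weak_limit_has_moments[of "\<lambda>n. \<mu> (r n)" "\<lambda>n. mn (r n)"])
    show "(\<lambda>n. mn (r n) k) \<longlonglongrightarrow> mo k" for k
      using LIMSEQ_subseq_LIMSEQ[OF conv r(1), of k] by (simp add: o_def)
  qed (use mu r in \<open>auto simp: o_def\<close>)
  then show thesis by (rule that)
qed

text \<open>The full moment sequence of a symmetric distribution with the prescribed even moments \<open>L\<close>. The
  moment of order zero is \<open>1\<close> because the total mass is, whatever \<open>L 0\<close> may be.\<close>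

definition even_moment_sequence :: "(nat \<Rightarrow> real) \<Rightarrow> nat \<Rightarrow> real" where
  "even_moment_sequence L k = (if odd k then 0 else if k = 0 then 1 else L (k div 2))"

lemma symmetric_has_moments:
  assumes sym: "symmetric_distribution \<nu>"
    and ev: "\<And>k. 1 \<le> k \<Longrightarrow> has_bochner_integral \<nu> (\<lambda>x. x ^ (2 * k)) (L k)"
  shows "has_moments \<nu> (even_moment_sequence L)"
proof -
  interpret real_distribution \<nu> using sym by (simp add: symmetric_distribution_def)
  have ds: "distr \<nu> borel uminus = \<nu>" using sym by (simp add: symmetric_distribution_def)
  have even: "integrable \<nu> (\<lambda>x. x ^ (2 * k))" for k
    using ev[of k] by (cases "k = 0") (auto simp: has_bochner_integral_iff)
  have int: "integrable \<nu> (\<lambda>x. x ^ k)" for k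
  proof (rule Bochner_Integration.integrable_bound)
    show "integrable \<nu> (\<lambda>x. 1 + x ^ (2 * k))" using even by auto
    have "norm (x ^ k) \<le> norm (1 + x ^ (2 * k))" for x :: real
    proof -
      have "\<bar>x\<bar> ^ k \<le> 1 + x ^ (2 * k)" by (rule abs_power_le_even_power)
      moreover have "0 \<le> x ^ (2 * k)" by (intro zero_le_even_power) simp
      ultimately show ?thesis by (simp add: power_abs)
    qed
    then show "AE x in \<nu>. norm (x ^ k) \<le> norm (1 + x ^ (2 * k))" by simp
  qed simp
  have "expectation (\<lambda>x. x ^ k) = even_moment_sequence L k" for k
  proof (cases "odd k")
    case True
    have "expectation (\<lambda>x. x ^ k) = integral\<^sup>L (distr \<nu> borel uminus) (\<lambda>x. x ^ k)" by (simp only: ds)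
    also have "\<dots> = expectation (\<lambda>x. (- x) ^ k)" by (subst integral_distr) auto
    also have "\<dots> = - expectation (\<lambda>x. x ^ k)" using True by simp
    finally show ?thesis using True by (simp add: even_moment_sequence_def)
  next
    case False
    then obtain j where "k = 2 * j" by (auto elim: evenE)
    then show ?thesis using ev[of j] prob_space
      by (cases "j = 0") (auto simp: even_moment_sequence_def has_bochner_integral_iff)
  qed
  with int show ?thesis using sym
    by (auto simp: has_moments_def has_bochner_integral_iff symmetric_distribution_def)
qed

text \<open>The reflected distribution has the same moments, as the odd ones vanish, so uniqueness applies.\<close>

lemma has_moments_symmetric:
  assumes g: "has_moments \<gamma> (even_moment_sequence L)" and small: "small_moments (even_moment_sequence L)"
  shows "symmetric_distribution \<gamma>"
proof -
  interpret real_distribution \<gamma> using g by (simp add: has_moments_def)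
  have I: "integrable \<gamma> (\<lambda>x. x ^ k)" "expectation (\<lambda>x. x ^ k) = even_moment_sequence L k" for k
    using g by (auto simp: has_moments_def has_bochner_integral_iff)
  have neg: "(\<lambda>x::real. (- x) ^ k) = (\<lambda>x. (- 1) ^ k * x ^ k)" for k
    by (intro ext) (rule power_minus)
  have "has_moments (distr \<gamma> borel uminus) (even_moment_sequence L)"
    unfolding has_moments_def has_bochner_integral_iff
  proof (intro conjI allI)
    show "real_distribution (distr \<gamma> borel uminus)" by (rule real_distribution_distr) simp
    fix k
    show "integrable (distr \<gamma> borel uminus) (\<lambda>x. x ^ k)"
      by (subst integrable_distr_eq) (auto simp only: neg intro!: integrable_mult_right I, simp_all)
    show "integral\<^sup>L (distr \<gamma> borel uminus) (\<lambda>x. x ^ k) = even_moment_sequence L k"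
    proof -
      have "integral\<^sup>L (distr \<gamma> borel uminus) (\<lambda>x. x ^ k) = expectation (\<lambda>x. (- 1) ^ k * x ^ k)"
        by (subst integral_distr) (simp_all add: neg)
      also have "\<dots> = (- 1) ^ k * even_moment_sequence L k" by (simp only: integral_mult_right_zero I)
      also have "\<dots> = even_moment_sequence L k" by (simp add: even_moment_sequence_def)
      finally show ?thesis .
    qed
  qed
  then have "distr \<gamma> borel uminus = \<gamma>" using g small by (rule has_moments_unique)
  then show ?thesis using g by (simp add: symmetric_distribution_def has_moments_def)
qed

section \<open>Products of independent centred variables\<close>

text \<open>Everything that the counting arguments use about the random entries: independence, mean zero, and
  bounds for the moments that are common to all members of the family.\<close>

locale centered_family = prob_space M for M :: "'w measure" +
  fixes \<xi> :: "'v \<Rightarrow> 'w \<Rightarrow> real" and V :: "'v set" and C :: "nat \<Rightarrow> real"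
  assumes indep: "indep_vars (\<lambda>_. borel) \<xi> V"
    and centered: "\<And>v. v \<in> V \<Longrightarrow> expectation (\<xi> v) = 0"
    and powers_integrable: "\<And>v r. v \<in> V \<Longrightarrow> integrable M (\<lambda>\<omega>. \<xi> v \<omega> ^ r)"
    and powers_bounded: "\<And>v r. v \<in> V \<Longrightarrow> \<bar>expectation (\<lambda>\<omega>. \<xi> v \<omega> ^ r)\<bar> \<le> C r"
begin

definition product_mean :: "('l \<Rightarrow> 'v) \<Rightarrow> 'l set \<Rightarrow> real" where
  "product_mean \<kappa> L = expectation (\<lambda>\<omega>. \<Prod>l\<in>L. \<xi> (\<kappa> l) \<omega>)"

lemma prod_fibres:
  assumes "finite L"
  shows "(\<Prod>l\<in>L. \<xi> (\<kappa> l) \<omega>) = (\<Prod>v\<in>\<kappa> ` L. \<xi> v \<omega> ^ card {l \<in> L. \<kappa> l = v})"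
  by (subst prod.image_gen[OF assms, of _ \<kappa>]) (auto intro!: prod.cong)

text \<open>Collecting equal factors, the product becomes one of powers of distinct independent variables.\<close>

lemma product_mean_fibres:
  assumes L: "finite L" "\<kappa> ` L \<subseteq> V"
  shows "integrable M (\<lambda>\<omega>. \<Prod>l\<in>L. \<xi> (\<kappa> l) \<omega>)"
    and "product_mean \<kappa> L = (\<Prod>v\<in>\<kappa> ` L. expectation (\<lambda>\<omega>. \<xi> v \<omega> ^ card {l \<in> L. \<kappa> l = v}))"
proof -
  have ind: "indep_vars (\<lambda>_. borel) (\<lambda>v \<omega>. \<xi> v \<omega> ^ card {l \<in> L. \<kappa> l = v}) (\<kappa> ` L)"
    using indep_vars_compose2[OF indep_vars_subset[OF indep L(2)], where Y = "\<lambda>v x. x ^ card {l \<in> L. \<kappa> l = v}"]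
    by simp
  have int: "integrable M (\<lambda>\<omega>. \<xi> v \<omega> ^ card {l \<in> L. \<kappa> l = v})" if "v \<in> \<kappa> ` L" for v
    using that L by (intro powers_integrable) auto
  have fin: "finite (\<kappa> ` L)" using L by simp
  show "integrable M (\<lambda>\<omega>. \<Prod>l\<in>L. \<xi> (\<kappa> l) \<omega>)"
    unfolding prod_fibres[OF L(1)] by (rule indep_vars_integrable[OF fin ind int])
  show "product_mean \<kappa> L = (\<Prod>v\<in>\<kappa> ` L. expectation (\<lambda>\<omega>. \<xi> v \<omega> ^ card {l \<in> L. \<kappa> l = v}))"
    unfolding product_mean_def prod_fibres[OF L(1)] by (rule indep_vars_lebesgue_integral[OF fin ind int])
qed

text \<open>A variable that occurs exactly once contributes its mean, which is zero, as a factor.\<close>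

lemma product_mean_singleton_fibre:
  assumes L: "finite L" "\<kappa> ` L \<subseteq> V" and l: "l \<in> L" "\<And>l'. l' \<in> L \<Longrightarrow> \<kappa> l' = \<kappa> l \<Longrightarrow> l' = l"
  shows "product_mean \<kappa> L = 0"
proof -
  have "{l' \<in> L. \<kappa> l' = \<kappa> l} = {l}" using l by auto
  moreover have "\<kappa> l \<in> V" using l L by auto
  ultimately have "expectation (\<lambda>\<omega>. \<xi> (\<kappa> l) \<omega> ^ card {l' \<in> L. \<kappa> l' = \<kappa> l}) = 0"
    using centered by simp
  then show ?thesis unfolding product_mean_fibres(2)[OF L] using L l by (intro prod_zero) auto
qed

lemma product_mean_disjoint:
  assumes L: "finite L" "\<kappa> ` L \<subseteq> V" "finite L'" "\<kappa> ` L' \<subseteq> V" and dis: "\<kappa> ` L \<inter> \<kappa> ` L' = {}"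
  shows "product_mean \<kappa> (L \<union> L') = product_mean \<kappa> L * product_mean \<kappa> L'"
proof -
  have 1: "{l \<in> L \<union> L'. \<kappa> l = v} = {l \<in> L. \<kappa> l = v}" if "v \<in> \<kappa> ` L" for v using that dis by auto
  have 2: "{l \<in> L \<union> L'. \<kappa> l = v} = {l \<in> L'. \<kappa> l = v}" if "v \<in> \<kappa> ` L'" for v using that dis by auto
  have "\<kappa> ` (L \<union> L') \<subseteq> V" "finite (L \<union> L')" using L by auto
  note 3 = product_mean_fibres(2)[OF this(2,1)]
  show ?thesis
    unfolding 3 product_mean_fibres(2)[OF L(1,2)] product_mean_fibres(2)[OF L(3,4)] image_Un
    by (subst prod.union_disjoint) (use L dis 1 2 in \<open>auto simp: Int_def\<close>)
qed

text \<open>A crude bound that depends on the number of factors only; what matters is that it is the same for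
  all words of a given length.\<close>

definition product_bound :: "nat \<Rightarrow> real" where
  "product_bound n = (1 + (\<Sum>r\<le>n. \<bar>C r\<bar>)) ^ n"

lemma product_bound_ge_1: "1 \<le> product_bound n"
  unfolding product_bound_def by (intro one_le_power) (simp add: sum_nonneg)

lemma product_mean_bound:
  assumes L: "finite L" "\<kappa> ` L \<subseteq> V" "card L \<le> n"
  shows "\<bar>product_mean \<kappa> L\<bar> \<le> product_bound n"
proof -
  let ?B = "1 + (\<Sum>r\<le>n. \<bar>C r\<bar>)"
  have B: "1 \<le> ?B" by (simp add: sum_nonneg)
  have "\<bar>product_mean \<kappa> L\<bar> = (\<Prod>v\<in>\<kappa> ` L. \<bar>expectation (\<lambda>\<omega>. \<xi> v \<omega> ^ card {l \<in> L. \<kappa> l = v})\<bar>)"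
    unfolding product_mean_fibres(2)[OF L(1,2)] by (simp add: abs_prod)
  also have "\<dots> \<le> (\<Prod>v\<in>\<kappa> ` L. ?B)"
  proof (rule prod_mono, intro conjI)
    fix v assume v: "v \<in> \<kappa> ` L"
    let ?r = "card {l \<in> L. \<kappa> l = v}"
    have r: "?r \<le> n" using card_mono[OF L(1), of "{l \<in> L. \<kappa> l = v}"] L(3) by auto
    have "\<bar>expectation (\<lambda>\<omega>. \<xi> v \<omega> ^ ?r)\<bar> \<le> C ?r" using v L by (intro powers_bounded) auto
    also have "\<dots> \<le> \<bar>C ?r\<bar>" by simp
    also have "\<dots> \<le> (\<Sum>r\<le>n. \<bar>C r\<bar>)" using r by (intro member_le_sum) auto
    finally show "\<bar>expectation (\<lambda>\<omega>. \<xi> v \<omega> ^ ?r)\<bar> \<le> ?B" by simp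
  qed simp
  also have "\<dots> = ?B ^ card (\<kappa> ` L)" by simp
  also have "\<dots> \<le> ?B ^ n" using B L card_image_le[OF L(1), of \<kappa>] by (intro power_increasing) auto
  finally show ?thesis by (simp add: product_bound_def)
qed

text \<open>The mean that arises when a power of a centred sum over words is multiplied out, with one factor for
  each word.\<close>

definition central_product_mean :: "('j \<times> 'q \<Rightarrow> 'v) \<Rightarrow> 'j set \<Rightarrow> 'q set \<Rightarrow> real" where
  "central_product_mean \<kappa> J Q = expectation (\<lambda>\<omega>. \<Prod>j\<in>J.
     (\<Prod>q\<in>Q. \<xi> (\<kappa> (j, q)) \<omega>) - product_mean \<kappa> ({j} \<times> Q))"

lemma central_product_mean_expand:
  assumes fin: "finite J" "finite Q" and V: "\<kappa> ` (J \<times> Q) \<subseteq> V"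
  shows "integrable M (\<lambda>\<omega>. \<Prod>j\<in>J. (\<Prod>q\<in>Q. \<xi> (\<kappa> (j, q)) \<omega>) - product_mean \<kappa> ({j} \<times> Q))" (is ?int)
    and "central_product_mean \<kappa> J Q =
      (\<Sum>S\<in>Pow J. product_mean \<kappa> (S \<times> Q) * (\<Prod>j\<in>J - S. - product_mean \<kappa> ({j} \<times> Q)))" (is ?eq)
proof -
  have exp: "(\<Prod>j\<in>J. (\<Prod>q\<in>Q. \<xi> (\<kappa> (j, q)) \<omega>) - product_mean \<kappa> ({j} \<times> Q)) =
      (\<Sum>S\<in>Pow J. (\<Prod>l\<in>S \<times> Q. \<xi> (\<kappa> l) \<omega>) * (\<Prod>j\<in>J - S. - product_mean \<kappa> ({j} \<times> Q)))" for \<omega>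
    using prod_add[OF fin(1), of "\<lambda>j. \<Prod>q\<in>Q. \<xi> (\<kappa> (j, q)) \<omega>" "\<lambda>j. - product_mean \<kappa> ({j} \<times> Q)"]
    by (simp add: prod.cartesian_product case_prod_beta)
  have int: "integrable M (\<lambda>\<omega>. (\<Prod>l\<in>S \<times> Q. \<xi> (\<kappa> l) \<omega>) * c)" if "S \<in> Pow J" for S c
    using that fin V finite_subset[of S J]
    by (intro integrable_mult_left product_mean_fibres(1)) auto
  show ?int unfolding exp using int by (rule Bochner_Integration.integrable_sum)
  show ?eq unfolding central_product_mean_def exp
    by (subst Bochner_Integration.integral_sum[OF int]) (auto simp: product_mean_def)
qed

lemma central_product_mean_bound:
  assumes fin: "finite J" "finite Q" and V: "\<kappa> ` (J \<times> Q) \<subseteq> V"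
  shows "\<bar>central_product_mean \<kappa> J Q\<bar> \<le> 2 ^ card J * product_bound (card J * card Q) ^ Suc (card J)"
proof -
  let ?K = "product_bound (card J * card Q)"
  have bd: "\<bar>product_mean \<kappa> (S \<times> Q)\<bar> \<le> ?K" if "S \<subseteq> J" for S
    using that fin V finite_subset[of S J]
    by (intro product_mean_bound) (auto simp: card_cartesian_product card_mono)
  have "\<bar>central_product_mean \<kappa> J Q\<bar> \<le>
      (\<Sum>S\<in>Pow J. \<bar>product_mean \<kappa> (S \<times> Q) * (\<Prod>j\<in>J - S. - product_mean \<kappa> ({j} \<times> Q))\<bar>)"
    unfolding central_product_mean_expand(2)[OF assms] by (rule sum_abs)
  also have "\<dots> \<le> (\<Sum>S\<in>Pow J. ?K * ?K ^ card J)"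
  proof (rule sum_mono)
    fix S assume S: "S \<in> Pow J"
    have "(\<Prod>j\<in>J - S. \<bar>product_mean \<kappa> ({j} \<times> Q)\<bar>) \<le> (\<Prod>j\<in>J - S. ?K)"
      by (intro prod_mono) (auto intro: bd)
    also have "\<dots> = ?K ^ card (J - S)" by simp
    also have "\<dots> \<le> ?K ^ card J"
      using product_bound_ge_1 fin by (intro power_increasing card_mono) auto
    finally show "\<bar>product_mean \<kappa> (S \<times> Q) * (\<Prod>j\<in>J - S. - product_mean \<kappa> ({j} \<times> Q))\<bar> \<le> ?K * ?K ^ card J"
      unfolding abs_mult abs_prod abs_minus_cancel using S bd[of S] product_bound_ge_1[of "card J * card Q"]
      by (intro mult_mono) (auto intro!: prod_nonneg)
  qed
  also have "\<dots> = 2 ^ card J * ?K ^ Suc (card J)" using fin by (simp add: card_Pow)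
  finally show ?thesis .
qed

text \<open>After expanding the centred factors each term is a product of means over sets of whole circuits,
  and the variable that occurs only once is alone in whichever of them contains it.\<close>

lemma central_product_mean_singleton_fibre:
  assumes fin: "finite J" "finite Q" and V: "\<kappa> ` (J \<times> Q) \<subseteq> V"
    and l: "l \<in> J \<times> Q" "\<And>l'. l' \<in> J \<times> Q \<Longrightarrow> \<kappa> l' = \<kappa> l \<Longrightarrow> l' = l"
  shows "central_product_mean \<kappa> J Q = 0"
  unfolding central_product_mean_expand(2)[OF fin V]
proof (rule sum.neutral, intro ballI)
  fix S assume S: "S \<in> Pow J"
  obtain j q where jq: "l = (j, q)" "j \<in> J" "q \<in> Q" using l by auto
  have z: "product_mean \<kappa> (S' \<times> Q) = 0" if "j \<in> S'" "S' \<subseteq> J" for S'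
    using that fin V finite_subset[of S' J] l jq
    by (intro product_mean_singleton_fibre[of _ _ l]) auto
  show "product_mean \<kappa> (S \<times> Q) * (\<Prod>j\<in>J - S. - product_mean \<kappa> ({j} \<times> Q)) = 0"
  proof (cases "j \<in> S")
    case True
    then show ?thesis using z S by simp
  next
    case False
    then have "(\<Prod>j\<in>J - S. - product_mean \<kappa> ({j} \<times> Q)) = 0"
      using z[of "{j}"] jq fin by (intro prod_zero) auto
    then show ?thesis by simp
  qed
qed

text \<open>A circuit without common variables is independent of the others, and its centred factor has mean
  zero. In the expansion the terms with and without this circuit cancel in pairs.\<close>

lemma central_product_mean_isolated:
  assumes fin: "finite J" "finite Q" and V: "\<kappa> ` (J \<times> Q) \<subseteq> V"
    and j: "j \<in> J" "\<kappa> ` ({j} \<times> Q) \<inter> \<kappa> ` ((J - {j}) \<times> Q) = {}"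
  shows "central_product_mean \<kappa> J Q = 0"
proof -
  define J' where "J' = J - {j}"
  have J: "J = insert j J'" "j \<notin> J'" "finite J'" using j fin by (auto simp: J'_def)
  let ?c = "\<lambda>j. product_mean \<kappa> ({j} \<times> Q)"
  let ?T = "\<lambda>S. product_mean \<kappa> (S \<times> Q) * (\<Prod>j\<in>J - S. - ?c j)"
  have "?T S + ?T (insert j S) = 0" if S: "S \<subseteq> J'" for S
  proof -
    have finS: "finite S" using S J finite_subset by blast
    have "insert j S \<times> Q = {j} \<times> Q \<union> S \<times> Q" by auto
    moreover have "product_mean \<kappa> ({j} \<times> Q \<union> S \<times> Q) = ?c j * product_mean \<kappa> (S \<times> Q)"
    proof (rule product_mean_disjoint)
      show "\<kappa> ` ({j} \<times> Q) \<subseteq> V" "\<kappa> ` (S \<times> Q) \<subseteq> V" using V j(1) S by (auto simp: J'_def)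
      show "\<kappa> ` ({j} \<times> Q) \<inter> \<kappa> ` (S \<times> Q) = {}" using j(2) S by (fastforce simp: J'_def)
    qed (use fin finS in auto)
    ultimately have "product_mean \<kappa> (insert j S \<times> Q) = ?c j * product_mean \<kappa> (S \<times> Q)" by simp
    moreover have "J - S = insert j (J' - S)" "J - insert j S = J' - S" using S J(2) by (auto simp: J(1))
    moreover have "(\<Prod>i\<in>insert j (J' - S). - ?c i) = - ?c j * (\<Prod>i\<in>J' - S. - ?c i)"
      using J(2,3) by (subst prod.insert) auto
    ultimately show ?thesis by simp
  qed
  then have "(\<Sum>S\<in>Pow J'. ?T S) + (\<Sum>S\<in>Pow J'. ?T (insert j S)) = 0"
    by (subst sum.distrib[symmetric]) (intro sum.neutral, auto)
  moreover have "(\<Sum>S\<in>Pow J. ?T S) = (\<Sum>S\<in>Pow J'. ?T S) + (\<Sum>S\<in>insert j ` Pow J'. ?T S)"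
    by (subst (1) J(1), unfold Pow_insert, intro sum.union_disjoint) (use J(2,3) in auto)
  moreover have "(\<Sum>S\<in>insert j ` Pow J'. ?T S) = (\<Sum>S\<in>Pow J'. ?T (insert j S))"
    using J(2) by (subst sum.reindex) (auto intro!: inj_onI simp: insert_ident)
  ultimately show ?thesis unfolding central_product_mean_expand(2)[OF fin V] by simp
qed

end

section \<open>Counting integer words by the pattern of their increments\<close>

text \<open>Letters are pairs of a circuit and a position; positions are read modulo the length \<open>p\<close>.\<close>

definition increment :: "nat \<Rightarrow> ('j \<times> nat \<Rightarrow> nat) \<Rightarrow> 'j \<times> nat \<Rightarrow> int" where
  "increment p i l = int (i l) - int (i (fst l, Suc (snd l) mod p))"

lemma sum_cyclic_shift:
  fixes f :: "nat \<Rightarrow> 'a :: comm_monoid_add"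
  assumes "0 < p"
  shows "(\<Sum>q<p. f (Suc q mod p)) = (\<Sum>q<p. f q)"
proof -
  obtain r where r: "p = Suc r" using assms gr0_conv_Suc by blast
  have "(\<Sum>q<Suc r. f (Suc q mod Suc r)) = (\<Sum>q<r. f (Suc q)) + f 0" by simp
  also have "\<dots> = (\<Sum>q<Suc r. f q)" by (subst sum.lessThan_Suc_shift) (simp add: add.commute)
  finally show ?thesis by (simp add: r)
qed

lemma sum_increment_circuit:
  assumes "0 < p"
  shows "(\<Sum>q<p. increment p i (j, q)) = 0"
  unfolding increment_def using sum_cyclic_shift[OF assms, of "\<lambda>q. int (i (j, q))"]
  by (simp add: sum_subtractf)

lemma abs_increment_less:
  assumes "0 < p" "i \<in> J \<times> {..<p} \<rightarrow>\<^sub>E {..<N}" "l \<in> J \<times> {..<p}"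
  shows "\<bar>increment p i l\<bar> < int N"
proof -
  have "(fst l, Suc (snd l) mod p) \<in> J \<times> {..<p}" using assms by auto
  then have "i l < N" "i (fst l, Suc (snd l) mod p) < N" using assms(3) PiE_mem[OF assms(2)] by blast+
  then show ?thesis unfolding increment_def by linarith
qed

text \<open>The starting points together with the absolute increments at the representatives \<open>r l\<close> determine
  all increments, because the signs are part of the pattern, and hence the whole family of circuits.\<close>

lemma card_pattern_le:
  fixes r :: "'j \<times> nat \<Rightarrow> 'j \<times> nat"
  assumes J: "finite J" and p: "0 < p" and r: "r \<in> J \<times> {..<p} \<rightarrow> J \<times> {..<p}"
    and S: "S \<subseteq> (J \<times> {..<p} \<rightarrow>\<^sub>E {..<N})"
    and sig: "\<And>i l. i \<in> S \<Longrightarrow> l \<in> J \<times> {..<p} \<Longrightarrow> increment p i l = \<sigma> l * \<bar>increment p i (r l)\<bar>"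
    and X: "finite X" "\<And>i. i \<in> S \<Longrightarrow> (\<lambda>b\<in>r ` (J \<times> {..<p}). nat \<bar>increment p i b\<bar>) \<in> X"
  shows "card S \<le> N ^ card J * card X"
proof -
  let ?L = "J \<times> {..<p}"
  let ?f = "\<lambda>i. (\<lambda>j\<in>J. i (j, 0), \<lambda>b\<in>r ` ?L. nat \<bar>increment p i b\<bar>)"
  have inj: "inj_on ?f S"
  proof (rule inj_onI)
    fix i i' assume i: "i \<in> S" "i' \<in> S" and eq: "?f i = ?f i'"
    have start: "i (j, 0) = i' (j, 0)" if "j \<in> J" for j
      using fun_cong[of _ _ j, OF arg_cong[of _ _ fst, OF eq]] that by simp
    have abs: "\<bar>increment p i b\<bar> = \<bar>increment p i' b\<bar>" if "b \<in> r ` ?L" for b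
      using fun_cong[of _ _ b, OF arg_cong[of _ _ snd, OF eq]] that by simp
    have inc: "increment p i l = increment p i' l" if "l \<in> ?L" for l
      using that abs[of "r l"] sig[OF i(1) that] sig[OF i(2) that] by simp
    have pt: "i (j, q) = i' (j, q)" if "j \<in> J" "q < p" for j q
      using that(2)
    proof (induction q)
      case (Suc q)
      have "increment p i (j, q) = increment p i' (j, q)" using inc that(1) Suc.prems by simp
      then show ?case using Suc by (simp add: increment_def)
    qed (use start that in simp)
    show "i = i'"
    proof (rule PiE_ext)
      show "i \<in> ?L \<rightarrow>\<^sub>E {..<N}" "i' \<in> ?L \<rightarrow>\<^sub>E {..<N}" using i S by auto
    qed (use pt in auto)
  qed
  have "?f ` S \<subseteq> (J \<rightarrow>\<^sub>E {..<N}) \<times> X"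
    using S X(2) p by (fastforce simp: PiE_iff)
  then have "card (?f ` S) \<le> card ((J \<rightarrow>\<^sub>E {..<N}) \<times> X)"
    using J X(1) by (intro card_mono finite_cartesian_product finite_PiE) auto
  also have "\<dots> = N ^ card J * card X" using J by (simp add: card_cartesian_product card_PiE)
  finally show ?thesis using card_image[OF inj] by simp
qed

text \<open>The remaining coordinates determine the one with nonzero coefficient.\<close>

lemma card_linear_equation_le:
  fixes u :: "'b \<Rightarrow> int"
  assumes B: "finite B" "b \<in> B" "u b \<noteq> 0"
  shows "card {x \<in> B \<rightarrow>\<^sub>E {..<N}. (\<Sum>c\<in>B. u c * int (x c)) = 0} \<le> N ^ (card B - 1)"
proof -
  let ?X = "{x \<in> B \<rightarrow>\<^sub>E {..<N}. (\<Sum>c\<in>B. u c * int (x c)) = 0}"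
  let ?f = "\<lambda>x. restrict x (B - {b})"
  have "inj_on ?f ?X"
  proof (rule inj_onI)
    fix x y assume x: "x \<in> ?X" and y: "y \<in> ?X" and eq: "?f x = ?f y"
    have same: "x c = y c" if "c \<in> B - {b}" for c using fun_cong[OF eq, of c] that by simp
    have "(\<Sum>c\<in>B - {b}. u c * int (x c)) = (\<Sum>c\<in>B - {b}. u c * int (y c))"
      by (intro sum.cong) (auto simp: same)
    moreover have "(\<Sum>c\<in>B. u c * int (z c)) = u b * int (z b) + (\<Sum>c\<in>B - {b}. u c * int (z c))" for z
      using B by (simp add: sum.remove)
    moreover have "(\<Sum>c\<in>B. u c * int (x c)) = 0" "(\<Sum>c\<in>B. u c * int (y c)) = 0" using x y by auto
    ultimately have "u b * int (x b) = u b * int (y b)" by (metis add_right_cancel)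
    then have "x b = y b" using B by simp
    with same have "x c = y c" if "c \<in> B" for c using that by (cases "c = b") auto
    then show "x = y" using x y by (intro PiE_ext[of x B _ y]) auto
  qed
  then have "card ?X = card (?f ` ?X)" by (simp add: card_image)
  also have "\<dots> \<le> card (B - {b} \<rightarrow>\<^sub>E {..<N})"
    using B by (intro card_mono finite_PiE image_subsetI, simp, simp, subst restrict_PiE_iff) (auto dest: PiE_mem)
  also have "\<dots> = N ^ (card B - 1)" using B by (simp add: card_PiE)
  finally show ?thesis .
qed

text \<open>A nonzero \<open>2 \<times> 2\<close> minor lets the remaining coordinates determine two of them, by Cramer's rule.\<close>

lemma card_two_linear_equations_le:
  fixes u v :: "'b \<Rightarrow> int"
  assumes B: "finite B" "b \<in> B" "b' \<in> B" and minor: "u b * v b' \<noteq> u b' * v b"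
  shows "card {x \<in> B \<rightarrow>\<^sub>E {..<N}. (\<Sum>c\<in>B. u c * int (x c)) = 0 \<and> (\<Sum>c\<in>B. v c * int (x c)) = 0}
    \<le> N ^ (card B - 2)"
proof -
  let ?X = "{x \<in> B \<rightarrow>\<^sub>E {..<N}. (\<Sum>c\<in>B. u c * int (x c)) = 0 \<and> (\<Sum>c\<in>B. v c * int (x c)) = 0}"
  let ?f = "\<lambda>x. restrict x (B - {b, b'})"
  have ne: "b \<noteq> b'" using minor by auto
  have "inj_on ?f ?X"
  proof (rule inj_onI)
    fix x y assume x: "x \<in> ?X" and y: "y \<in> ?X" and eq: "?f x = ?f y"
    have same: "x c = y c" if "c \<in> B - {b, b'}" for c using fun_cong[OF eq, of c] that by simp
    have split: "(\<Sum>c\<in>B. w c * int (z c)) =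
        w b * int (z b) + w b' * int (z b') + (\<Sum>c\<in>B - {b, b'}. w c * int (z c))" for w :: "'b \<Rightarrow> int" and z
    proof -
      have "B - {b, b'} = B - {b} - {b'}" by auto
      then show ?thesis using B ne by (simp add: sum.remove[of B b] sum.remove[of "B - {b}" b'])
    qed
    have rest: "(\<Sum>c\<in>B - {b, b'}. w c * int (x c)) = (\<Sum>c\<in>B - {b, b'}. w c * int (y c))" for w :: "'b \<Rightarrow> int"
      by (intro sum.cong) (auto simp: same)
    define s t where "s = int (x b) - int (y b)" and "t = int (x b') - int (y b')"
    have 1: "u b * s + u b' * t = 0" and 2: "v b * s + v b' * t = 0"
      using x y split[of u x] split[of u y] split[of v x] split[of v y] rest[of u] rest[of v]
      by (simp_all add: s_def t_def right_diff_distrib)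
    have "(u b * v b' - u b' * v b) * s = v b' * (u b * s + u b' * t) - u b' * (v b * s + v b' * t)"
      "(u b * v b' - u b' * v b) * t = u b * (v b * s + v b' * t) - v b * (u b * s + u b' * t)"
      by (simp_all add: algebra_simps)
    then have "s = 0" "t = 0" using minor unfolding 1 2 by auto
    then have "x b = y b" "x b' = y b'" by (auto simp: s_def t_def)
    with same have "x c = y c" if "c \<in> B" for c using that by (cases "c = b"; cases "c = b'") auto
    then show "x = y" using x y by (intro PiE_ext[of x B _ y]) auto
  qed
  then have "card ?X = card (?f ` ?X)" by (simp add: card_image)
  also have "\<dots> \<le> card (B - {b, b'} \<rightarrow>\<^sub>E {..<N})"
    using B by (intro card_mono finite_PiE image_subsetI, simp, simp, subst restrict_PiE_iff) (auto dest: PiE_mem)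
  also have "\<dots> = N ^ (card B - 2)" using B ne by (simp add: card_PiE card_Diff_subset numeral_2_eq_2)
  finally show ?thesis .
qed

text \<open>The coefficient of the absolute increment of group \<open>b\<close> in the equation which says that circuit \<open>j\<close>
  closes up.\<close>

definition closing_coeff :: "nat \<Rightarrow> ('j \<times> nat \<Rightarrow> 'j \<times> nat) \<Rightarrow> ('j \<times> nat \<Rightarrow> int) \<Rightarrow> 'j \<Rightarrow> 'j \<times> nat \<Rightarrow> int" where
  "closing_coeff p r \<sigma> j b = (\<Sum>q\<in>{q. q < p \<and> r (j, q) = b}. \<sigma> (j, q))"

lemma closing_equation:
  assumes p: "0 < p" and J: "finite J" "j \<in> J"
    and sig: "\<And>l. l \<in> J \<times> {..<p} \<Longrightarrow> increment p i l = \<sigma> l * \<bar>increment p i (r l)\<bar>"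
  shows "(\<Sum>b\<in>r ` (J \<times> {..<p}). closing_coeff p r \<sigma> j b *
    int ((\<lambda>b\<in>r ` (J \<times> {..<p}). nat \<bar>increment p i b\<bar>) b)) = 0"
proof -
  let ?B = "r ` (J \<times> {..<p})"
  have "0 = (\<Sum>q<p. increment p i (j, q))" using sum_increment_circuit[OF p] by simp
  also have "\<dots> = (\<Sum>q<p. \<sigma> (j, q) * \<bar>increment p i (r (j, q))\<bar>)"
    using J by (intro sum.cong refl sig) auto
  also have "\<dots> = (\<Sum>b\<in>?B. \<Sum>q\<in>{q\<in>{..<p}. r (j, q) = b}. \<sigma> (j, q) * \<bar>increment p i (r (j, q))\<bar>)"
    using J by (intro sum.group[symmetric]) auto
  also have "\<dots> = (\<Sum>b\<in>?B. closing_coeff p r \<sigma> j b * int ((\<lambda>b\<in>?B. nat \<bar>increment p i b\<bar>) b))"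
  proof (rule sum.cong[OF refl])
    fix b assume b: "b \<in> ?B"
    have "(\<Sum>q\<in>{q\<in>{..<p}. r (j, q) = b}. \<sigma> (j, q) * \<bar>increment p i (r (j, q))\<bar>) =
        (\<Sum>q\<in>{q. q < p \<and> r (j, q) = b}. \<sigma> (j, q) * \<bar>increment p i b\<bar>)"
      by (rule sum.cong) auto
    also have "\<dots> = closing_coeff p r \<sigma> j b * \<bar>increment p i b\<bar>"
      unfolding closing_coeff_def by (rule sum_distrib_right[symmetric])
    finally show "(\<Sum>q\<in>{q\<in>{..<p}. r (j, q) = b}. \<sigma> (j, q) * \<bar>increment p i (r (j, q))\<bar>) =
        closing_coeff p r \<sigma> j b * int ((\<lambda>b\<in>?B. nat \<bar>increment p i b\<bar>) b)"
      using b by simp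
  qed
  finally show ?thesis by simp
qed

lemma closing_coeff_eq_0:
  assumes "\<And>q. q < p \<Longrightarrow> r (j, q) \<noteq> b"
  shows "closing_coeff p r \<sigma> j b = 0"
proof -
  have eq: "{q. q < p \<and> r (j, q) = b} = {}" using assms by blast
  show ?thesis unfolding closing_coeff_def eq by simp
qed

lemma closing_coeff_single:
  assumes "q < p" "r (j, q) = b" "\<And>q'. q' < p \<Longrightarrow> r (j, q') = b \<Longrightarrow> q' = q"
  shows "closing_coeff p r \<sigma> j b = \<sigma> (j, q)"
proof -
  have eq: "{q. q < p \<and> r (j, q) = b} = {q}" using assms by blast
  show ?thesis unfolding closing_coeff_def eq by simp
qed

definition fibre :: "('l \<Rightarrow> 'l) \<Rightarrow> 'l set \<Rightarrow> 'l \<Rightarrow> 'l set" where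
  "fibre r L b = {l \<in> L. r l = b}"

lemma sum_card_fibre:
  assumes "finite L"
  shows "(\<Sum>b\<in>r ` L. card (fibre r L b)) = card L"
  using sum.image_gen[OF assms, of "\<lambda>_. 1::nat" r] by (simp add: fibre_def)

lemma card_fibre_ge_2:
  assumes L: "finite L" "b \<in> r ` L" and m: "\<And>l. l \<in> L \<Longrightarrow> \<exists>l'\<in>L. l' \<noteq> l \<and> r l' = r l"
  shows "2 \<le> card (fibre r L b)"
proof -
  obtain l where l: "l \<in> L" "r l = b" using L by auto
  then obtain l' where l': "l' \<in> L" "l' \<noteq> l" "r l' = b" using m by force
  have "{l, l'} \<subseteq> fibre r L b" using l l' by (auto simp: fibre_def)
  then have "card {l, l'} \<le> card (fibre r L b)" using L by (intro card_mono) (auto simp: fibre_def)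
  then show ?thesis using l' by simp
qed

text \<open>Each group has at least two letters, so every letter beyond the second one in a group makes the
  groups fewer than half of the letters.\<close>

lemma card_blocks_excess:
  assumes L: "finite L" and m: "\<And>l. l \<in> L \<Longrightarrow> \<exists>l'\<in>L. l' \<noteq> l \<and> r l' = r l"
    and D: "D \<subseteq> r ` L"
  shows "2 * card (r ` L) + (\<Sum>b\<in>D. card (fibre r L b) - 2) \<le> card L"
proof -
  have "2 * card (r ` L) + (\<Sum>b\<in>D. card (fibre r L b) - 2) \<le>
      2 * card (r ` L) + (\<Sum>b\<in>r ` L. card (fibre r L b) - 2)"
    using L D by (intro add_left_mono sum_mono2) auto
  also have "\<dots> = (\<Sum>b\<in>r ` L. 2 + (card (fibre r L b) - 2))" by (subst sum.distrib) (simp add: mult.commute)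
  also have "\<dots> = (\<Sum>b\<in>r ` L. card (fibre r L b))"
  proof (rule sum.cong[OF refl])
    fix b assume "b \<in> r ` L"
    from card_fibre_ge_2[OF L this m] show "2 + (card (fibre r L b) - 2) = card (fibre r L b)" by simp
  qed
  also have "\<dots> = card L" by (rule sum_card_fibre[OF L])
  finally show ?thesis .
qed

text \<open>The combinatorial core of the fourth moment bound. With \<open>4p\<close> letters in groups of at least two there
  are at most \<open>2p\<close> groups. The total loss, from groups that are larger than pairs and from the rank of
  the closing equations, has to be at least two. If the rows of the equations are pairwise
  proportional (rank at most one), then the groups cannot all be pairs, and since \<open>4p\<close> is even at
  least one group is lost; if all rows vanish (rank zero), two are lost.\<close>

lemma four_circuits_blocks:
  fixes r :: "'j \<times> nat \<Rightarrow> 'j \<times> nat" and \<sigma> :: "'j \<times> nat \<Rightarrow> int"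
  assumes J: "finite J" "card J = 4"
    and sig: "\<And>l. l \<in> J \<times> {..<p} \<Longrightarrow> \<sigma> l \<noteq> 0"
    and m: "\<And>l. l \<in> J \<times> {..<p} \<Longrightarrow> \<exists>l'\<in>J \<times> {..<p}. l' \<noteq> l \<and> r l' = r l"
    and x: "\<And>j. j \<in> J \<Longrightarrow> \<exists>q<p. \<exists>j'\<in>J - {j}. \<exists>q'<p. r (j', q') = r (j, q)"
  defines "B \<equiv> r ` (J \<times> {..<p})" and "E \<equiv> closing_coeff p r \<sigma>"
  shows "card B \<le> 2 * p"
    and "(\<And>j j' b b'. j \<in> J \<Longrightarrow> j' \<in> J \<Longrightarrow> b \<in> B \<Longrightarrow> b' \<in> B \<Longrightarrow> E j b * E j' b' = E j b' * E j' b) \<Longrightarrow>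
      card B \<le> 2 * p - 1"
    and "(\<And>j b. j \<in> J \<Longrightarrow> b \<in> B \<Longrightarrow> E j b = 0) \<Longrightarrow> card B \<le> 2 * p - 2"
proof -
  let ?L = "J \<times> {..<p}"
  have L: "finite ?L" "card ?L = 4 * p" using J by (auto simp: card_cartesian_product)
  note excess = card_blocks_excess[of ?L r, OF L(1) m, unfolded L(2), folded B_def]
  show "card B \<le> 2 * p" using excess[of "{}"] by simp
  show "card B \<le> 2 * p - 1"
    if minors: "\<And>j j' b b'. j \<in> J \<Longrightarrow> j' \<in> J \<Longrightarrow> b \<in> B \<Longrightarrow> b' \<in> B \<Longrightarrow> E j b * E j' b' = E j b' * E j' b"
  proof -
    have "\<exists>b\<in>B. 3 \<le> card (fibre r ?L b)"
    proof (rule ccontr)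
      assume "\<not> (\<exists>b\<in>B. 3 \<le> card (fibre r ?L b))"
      then have two: "card (fibre r ?L b) = 2" if "b \<in> B" for b
        using that card_fibre_ge_2[OF L(1) _ m, of b] by (force simp: B_def)
      have pair: "fibre r ?L (r l) = {l, l'}" if "l \<in> ?L" "l' \<in> ?L" "l \<noteq> l'" "r l' = r l" for l l'
      proof -
        have "{l, l'} \<subseteq> fibre r ?L (r l)" using that by (auto simp: fibre_def)
        moreover have "finite (fibre r ?L (r l))" using L by (simp add: fibre_def)
        moreover have "card (fibre r ?L (r l)) \<le> card {l, l'}" using two[of "r l"] that by (simp add: B_def)
        ultimately show ?thesis by (metis card_seteq)
      qed
      have cross: "\<exists>b\<in>B. \<exists>j'\<in>J. j' \<noteq> j \<and> E j b \<noteq> 0 \<and> (\<forall>j''\<in>J. j'' \<noteq> j \<longrightarrow> j'' \<noteq> j' \<longrightarrow> E j'' b = 0)"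
        if j: "j \<in> J" for j
      proof -
        obtain q j' q' where q: "q < p" "j' \<in> J" "j' \<noteq> j" "q' < p" "r (j', q') = r (j, q)"
          using x[OF j] by auto
        have F: "fibre r ?L (r (j, q)) = {(j, q), (j', q')}" using q j by (intro pair) auto
        have "E j (r (j, q)) = \<sigma> (j, q)" unfolding E_def
        proof (rule closing_coeff_single)
          fix q'' assume "q'' < p" "r (j, q'') = r (j, q)"
          then have "(j, q'') \<in> fibre r ?L (r (j, q))" using j by (simp add: fibre_def)
          then show "q'' = q" unfolding F using q by auto
        qed (use q in auto)
        moreover have "E j'' (r (j, q)) = 0" if "j'' \<in> J" "j'' \<noteq> j" "j'' \<noteq> j'" for j'' unfolding E_def
        proof (rule closing_coeff_eq_0)
          fix q'' assume "q'' < p"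
          have "(j'', q'') \<notin> fibre r ?L (r (j, q))" unfolding F using that by auto
          then show "r (j'', q'') \<noteq> r (j, q)" using that \<open>q'' < p\<close> by (simp add: fibre_def)
        qed
        ultimately show ?thesis using q j sig[of "(j, q)"] by (intro bexI[of _ "r (j, q)"] bexI[of _ j']) (auto simp: B_def)
      qed
      obtain j1 where j1: "j1 \<in> J" using J by fastforce
      obtain b j2 where b: "b \<in> B" "j2 \<in> J" "E j1 b \<noteq> 0" "\<forall>j\<in>J. j \<noteq> j1 \<longrightarrow> j \<noteq> j2 \<longrightarrow> E j b = 0"
        using cross[OF j1] by blast
      have "\<not> J \<subseteq> {j1, j2}" using card_mono[of "{j1, j2}" J] J card_insert_le_m1[of 2 "{j2}" j1] by auto
      then obtain j3 where j3: "j3 \<in> J" "j3 \<noteq> j1" "j3 \<noteq> j2" by blast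
      obtain b3 where b3: "b3 \<in> B" "E j3 b3 \<noteq> 0" using cross[OF j3(1)] by blast
      \<comment> \<open>The pair that \<open>j1\<close> shares with \<open>j2\<close> does not meet \<open>j3\<close>, but \<open>j3\<close> has a crossing pair of its own: a nonzero minor.\<close>
      have "E j1 b * E j3 b3 = E j1 b3 * E j3 b" using minors j1 j3 b b3 by blast
      moreover have "E j3 b = 0" using b j3 by blast
      ultimately show False using b b3 by simp
    qed
    then obtain b where b: "b \<in> B" "3 \<le> card (fibre r ?L b)" by blast
    then show ?thesis using excess[of "{b}"] by simp
  qed
  show "card B \<le> 2 * p - 2" if zero: "\<And>j b. j \<in> J \<Longrightarrow> b \<in> B \<Longrightarrow> E j b = 0"
  proof -
    \<comment> \<open>A circuit that meets a group only once has the coefficient plus or minus one there.\<close>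
    have double: "\<exists>q''<p. q'' \<noteq> q \<and> r (j, q'') = r (j, q)" if "j \<in> J" "q < p" for j q
    proof (rule ccontr)
      assume "\<not> ?thesis"
      then have "E j (r (j, q)) = \<sigma> (j, q)" unfolding E_def
        using that by (intro closing_coeff_single) auto
      then show False using zero[of j "r (j, q)"] sig[of "(j, q)"] that by (auto simp: B_def)
    qed
    have cross: "\<exists>b j' q1 q2 q3 q4. b \<in> B \<and> j' \<in> J \<and> j' \<noteq> j \<and> q1 \<noteq> q2 \<and> q3 \<noteq> q4 \<and>
        {(j, q1), (j, q2), (j', q3), (j', q4)} \<subseteq> fibre r ?L b" if j: "j \<in> J" for j
    proof -
      obtain q j' q' where q: "q < p" "j' \<in> J" "j' \<noteq> j" "q' < p" "r (j', q') = r (j, q)"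
        using x[OF j] by auto
      obtain q2 where q2: "q2 < p" "q2 \<noteq> q" "r (j, q2) = r (j, q)" using double[OF j q(1)] by blast
      obtain q4 where q4: "q4 < p" "q4 \<noteq> q'" "r (j', q4) = r (j', q')" using double[OF q(2,4)] by blast
      show ?thesis
        by (rule exI[of _ "r (j, q)"], rule exI[of _ j'], rule exI[of _ q], rule exI[of _ q2], rule exI[of _ q'],
            rule exI[of _ q4]) (use q q2 q4 j in \<open>auto simp: fibre_def B_def\<close>)
    qed
    have finF: "finite (fibre r ?L b)" for b using L by (simp add: fibre_def)
    obtain j1 where j1: "j1 \<in> J" using J by fastforce
    obtain b j2 q1 q2 q3 q4 where b: "b \<in> B" "j2 \<in> J" "j2 \<noteq> j1" "q1 \<noteq> q2" "q3 \<noteq> q4"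
      "{(j1, q1), (j1, q2), (j2, q3), (j2, q4)} \<subseteq> fibre r ?L b"
      using cross[OF j1] by (elim exE conjE) (rule that)
    have "\<not> J \<subseteq> {j1, j2}" using card_mono[of "{j1, j2}" J] J card_insert_le_m1[of 2 "{j2}" j1] by auto
    then obtain j3 where j3: "j3 \<in> J" "j3 \<noteq> j1" "j3 \<noteq> j2" by blast
    obtain b' j4 q1' q2' q3' q4' where b': "b' \<in> B" "j4 \<in> J" "j4 \<noteq> j3" "q1' \<noteq> q2'" "q3' \<noteq> q4'"
      "{(j3, q1'), (j3, q2'), (j4, q3'), (j4, q4')} \<subseteq> fibre r ?L b'"
      using cross[OF j3(1)] by (elim exE conjE) (rule that)
    have c4: "4 \<le> card (fibre r ?L b)"
      using card_mono[OF finF b(6)] b by simp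
    show ?thesis
    proof (cases "b = b'")
      case True
      have "{(j1, q1), (j1, q2), (j2, q3), (j2, q4), (j3, q1'), (j3, q2')} \<subseteq> fibre r ?L b"
        using b b' True by auto
      from card_mono[OF finF this] have "6 \<le> card (fibre r ?L b)" using b b' j3 by simp
      then show ?thesis using excess[of "{b}"] b by simp
    next
      case False
      have "4 \<le> card (fibre r ?L b')" using card_mono[OF finF b'(6)] b' by simp
      then show ?thesis using c4 excess[of "{b, b'}"] b b' False by simp
    qed
  qed
qed

text \<open>Four starting points give the exponent four; the three cases for the rank of the closing equations
  leave at most \<open>2p - 2\<close> free absolute increments.\<close>

lemma card_four_circuits_pattern:
  fixes r :: "'j \<times> nat \<Rightarrow> 'j \<times> nat" and \<sigma> :: "'j \<times> nat \<Rightarrow> int"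
  assumes J: "finite J" "card J = 4" and p: "0 < p" and N: "0 < N"
    and r: "r \<in> J \<times> {..<p} \<rightarrow> J \<times> {..<p}"
    and sig: "\<And>l. l \<in> J \<times> {..<p} \<Longrightarrow> \<sigma> l \<noteq> 0"
    and m: "\<And>l. l \<in> J \<times> {..<p} \<Longrightarrow> \<exists>l'\<in>J \<times> {..<p}. l' \<noteq> l \<and> r l' = r l"
    and x: "\<And>j. j \<in> J \<Longrightarrow> \<exists>q<p. \<exists>j'\<in>J - {j}. \<exists>q'<p. r (j', q') = r (j, q)"
  shows "card {i \<in> J \<times> {..<p} \<rightarrow>\<^sub>E {..<N}. \<forall>l\<in>J \<times> {..<p}. increment p i l = \<sigma> l * \<bar>increment p i (r l)\<bar>}
    \<le> N ^ (2 * p + 2)" (is "card ?S \<le> _")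
proof -
  let ?L = "J \<times> {..<p}"
  define B where "B = r ` ?L"
  define E where "E = closing_coeff p r \<sigma>"
  have blocks1: "card B \<le> 2 * p"
    unfolding B_def by (rule four_circuits_blocks(1)[where \<sigma> = \<sigma>, OF J]) (fact sig m x)+
  have blocks2: "card B \<le> 2 * p - 1"
    if "\<And>j j' b b'. j \<in> J \<Longrightarrow> j' \<in> J \<Longrightarrow> b \<in> B \<Longrightarrow> b' \<in> B \<Longrightarrow> E j b * E j' b' = E j b' * E j' b"
    unfolding B_def
    by (rule four_circuits_blocks(2)[where \<sigma> = \<sigma>, OF J]) (fact sig m x that[unfolded B_def E_def])+
  have blocks3: "card B \<le> 2 * p - 2" if "\<And>j b. j \<in> J \<Longrightarrow> b \<in> B \<Longrightarrow> E j b = 0"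
    unfolding B_def
    by (rule four_circuits_blocks(3)[where \<sigma> = \<sigma>, OF J]) (fact sig m x that[unfolded B_def E_def])+
  have finB: "finite B" using J by (simp add: B_def)
  define S where "S = ?S"
  have S1: "i \<in> ?L \<rightarrow>\<^sub>E {..<N}" if "i \<in> S" for i using that unfolding S_def by blast
  have S2: "increment p i l = \<sigma> l * \<bar>increment p i (r l)\<bar>" if "i \<in> S" "l \<in> ?L" for i l
    using that unfolding S_def by blast
  let ?x = "\<lambda>i. (\<lambda>b\<in>B. nat \<bar>increment p i b\<bar>)"
  have eqn: "(\<Sum>b\<in>B. E j b * int (?x i b)) = 0" if "i \<in> S" "j \<in> J" for i j
    unfolding B_def E_def by (rule closing_equation[OF p J(1) that(2) S2[OF that(1)]])
  have box: "?x i \<in> B \<rightarrow>\<^sub>E {..<N}" if i: "i \<in> S" for i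
  proof (rule restrict_PiE_iff[THEN iffD2], intro ballI)
    fix b assume "b \<in> B"
    then have "b \<in> ?L" using r by (auto simp: B_def)
    from abs_increment_less[OF p S1[OF i] this] show "nat \<bar>increment p i b\<bar> \<in> {..<N}"
      by (simp add: nat_less_iff)
  qed
  have main: "card S \<le> N ^ (2 * p + 2)"
    if X: "X \<subseteq> B \<rightarrow>\<^sub>E {..<N}" "\<And>i. i \<in> S \<Longrightarrow> ?x i \<in> X" "card X \<le> N ^ c" "c \<le> 2 * p - 2" for X c
  proof -
    have "finite X" using X(1) finB by (rule finite_subset[OF _ finite_PiE]) auto
    then have "card S \<le> N ^ card J * card X"
      using X(2) S1 unfolding B_def by (intro card_pattern_le[OF J(1) p r _ S2]) blast+
    also have "\<dots> \<le> N ^ 4 * N ^ (2 * p - 2)"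
    proof -
      have "card X \<le> N ^ (2 * p - 2)"
        using X(3) power_increasing[OF X(4), of N] N by linarith
      then show ?thesis by (simp add: J(2))
    qed
    also have "\<dots> = N ^ (2 * p + 2)" using p by (simp flip: power_add)
    finally show ?thesis .
  qed
  have "card S \<le> N ^ (2 * p + 2)"
  proof (cases "\<exists>j\<in>J. \<exists>j'\<in>J. \<exists>b\<in>B. \<exists>b'\<in>B. E j b * E j' b' \<noteq> E j b' * E j' b")
    case True
    then obtain j j' b b' where *: "j \<in> J" "j' \<in> J" "b \<in> B" "b' \<in> B" "E j b * E j' b' \<noteq> E j b' * E j' b"
      by blast
    show ?thesis
    proof (rule main)
      show "card {x \<in> B \<rightarrow>\<^sub>E {..<N}. (\<Sum>c\<in>B. E j c * int (x c)) = 0 \<and> (\<Sum>c\<in>B. E j' c * int (x c)) = 0}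
          \<le> N ^ (card B - 2)"
        by (rule card_two_linear_equations_le[where b = b and b' = b']) (use finB * in auto)
      show "?x i \<in> {x \<in> B \<rightarrow>\<^sub>E {..<N}. (\<Sum>c\<in>B. E j c * int (x c)) = 0 \<and> (\<Sum>c\<in>B. E j' c * int (x c)) = 0}"
        if "i \<in> S" for i
        using box[OF that] eqn[OF that *(1)] eqn[OF that *(2)] by blast
      show "card B - 2 \<le> 2 * p - 2" using blocks1 by simp
    qed blast
  next
    case False
    then have minors: "\<And>j j' b b'. j \<in> J \<Longrightarrow> j' \<in> J \<Longrightarrow> b \<in> B \<Longrightarrow> b' \<in> B \<Longrightarrow> E j b * E j' b' = E j b' * E j' b"
      by blast
    show ?thesis
    proof (cases "\<exists>j\<in>J. \<exists>b\<in>B. E j b \<noteq> 0")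
      case True
      then obtain j b where *: "j \<in> J" "b \<in> B" "E j b \<noteq> 0" by blast
      show ?thesis
      proof (rule main)
        show "card {x \<in> B \<rightarrow>\<^sub>E {..<N}. (\<Sum>c\<in>B. E j c * int (x c)) = 0} \<le> N ^ (card B - 1)"
          by (rule card_linear_equation_le[where b = b]) (use finB * in auto)
        show "?x i \<in> {x \<in> B \<rightarrow>\<^sub>E {..<N}. (\<Sum>c\<in>B. E j c * int (x c)) = 0}" if "i \<in> S" for i
          using box[OF that] eqn[OF that *(1)] by blast
        show "card B - 1 \<le> 2 * p - 2" using blocks2[OF minors] by simp
      qed blast
    next
      case False
      then have "card B \<le> 2 * p - 2" by (intro blocks3) blast
      then show ?thesis
        by (rule main[rotated -1, of _ "B \<rightarrow>\<^sub>E {..<N}"]) (use box finB in \<open>simp_all add: card_PiE\<close>)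
    qed
  qed
  then show ?thesis by (simp only: S_def)
qed

text \<open>A representative for each class of letters with equal absolute increments. Whatever \<open>i\<close> and \<open>N\<close>
  are, it is one of the finitely many maps of the set of letters into itself.\<close>

definition representative :: "nat \<Rightarrow> ('j \<times> nat) set \<Rightarrow> ('j \<times> nat \<Rightarrow> nat) \<Rightarrow> 'j \<times> nat \<Rightarrow> 'j \<times> nat" where
  "representative p L i = (\<lambda>l\<in>L. SOME l'. l' \<in> L \<and> \<bar>increment p i l'\<bar> = \<bar>increment p i l\<bar>)"

lemma representative:
  assumes "l \<in> L"
  shows "representative p L i l \<in> L" "\<bar>increment p i (representative p L i l)\<bar> = \<bar>increment p i l\<bar>"
proof -
  have "\<exists>l'. l' \<in> L \<and> \<bar>increment p i l'\<bar> = \<bar>increment p i l\<bar>" using assms by blast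
  from someI_ex[OF this] assms
  show "representative p L i l \<in> L" "\<bar>increment p i (representative p L i l)\<bar> = \<bar>increment p i l\<bar>"
    by (simp_all add: representative_def)
qed

lemma representative_eq_iff:
  assumes "l \<in> L" "l' \<in> L"
  shows "representative p L i l = representative p L i l' \<longleftrightarrow> \<bar>increment p i l\<bar> = \<bar>increment p i l'\<bar>"
proof
  assume "representative p L i l = representative p L i l'"
  then show "\<bar>increment p i l\<bar> = \<bar>increment p i l'\<bar>"
    using representative(2)[OF assms(1), of p i] representative(2)[OF assms(2), of p i] by simp
qed (use assms in \<open>simp add: representative_def\<close>)

text \<open>The number of patterns depends on the number of letters only, so a bound for each pattern gives a
  bound of the same order.\<close>

lemma card_le_by_patterns:
  fixes sg :: "int \<Rightarrow> int"
  assumes L: "finite L" and T: "finite T" and sg: "finite \<Sigma>" "range sg \<subseteq> \<Sigma>"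
    and c: "\<And>r \<sigma>. card {i \<in> T. representative p L i = r \<and> (\<lambda>l\<in>L. sg (increment p i l)) = \<sigma>} \<le> c"
  shows "card T \<le> card L ^ card L * card \<Sigma> ^ card L * c"
proof -
  let ?A = "\<lambda>(r, \<sigma>). {i \<in> T. representative p L i = r \<and> (\<lambda>l\<in>L. sg (increment p i l)) = \<sigma>}"
  let ?I = "(L \<rightarrow>\<^sub>E L) \<times> (L \<rightarrow>\<^sub>E \<Sigma>)"
  have fin: "finite ?I" using L sg by (intro finite_cartesian_product finite_PiE) auto
  have "T \<subseteq> (\<Union>x\<in>?I. ?A x)"
  proof
    fix i assume "i \<in> T"
    moreover have "representative p L i \<in> L \<rightarrow>\<^sub>E L"
      using representative(1)[of _ L p i] by (auto simp: PiE_iff representative_def)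
    moreover have "(\<lambda>l\<in>L. sg (increment p i l)) \<in> L \<rightarrow>\<^sub>E \<Sigma>" using sg by auto
    ultimately show "i \<in> (\<Union>x\<in>?I. ?A x)" by blast
  qed
  then have "card T \<le> card (\<Union>x\<in>?I. ?A x)" using T fin by (intro card_mono finite_UN_I) auto
  also have "\<dots> \<le> (\<Sum>x\<in>?I. card (?A x))" by (rule card_UN_le[OF fin])
  also have "\<dots> \<le> (\<Sum>x\<in>?I. c)" using c by (intro sum_mono) auto
  also have "\<dots> = card L ^ card L * card \<Sigma> ^ card L * c"
    using L by (simp add: card_cartesian_product card_PiE)
  finally show ?thesis .
qed

text \<open>Quadruples of circuits in which all absolute increments are matched and each circuit shares an
  absolute increment with another one. Without the second condition the exponent could be as large as
  \<open>2p + 4\<close>, namely for four unrelated paired circuits.\<close>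

lemma card_linked_quadruples:
  assumes J: "finite J" "card J = 4" and p: "0 < p" and N: "0 < N"
  shows "card {i \<in> J \<times> {..<p} \<rightarrow>\<^sub>E {..<N}.
      (\<forall>l\<in>J \<times> {..<p}. \<exists>l'\<in>J \<times> {..<p}. l' \<noteq> l \<and> \<bar>increment p i l'\<bar> = \<bar>increment p i l\<bar>) \<and>
      (\<forall>j\<in>J. \<exists>q<p. \<exists>j'\<in>J - {j}. \<exists>q'<p. \<bar>increment p i (j', q')\<bar> = \<bar>increment p i (j, q)\<bar>)}
    \<le> (4 * p) ^ (4 * p) * 2 ^ (4 * p) * N ^ (2 * p + 2)" (is "card ?T \<le> _")
proof -
  let ?L = "J \<times> {..<p}"
  define T where "T = ?T"
  define sg :: "int \<Rightarrow> int" where "sg x = (if 0 \<le> x then 1 else - 1)" for x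
  have L: "finite ?L" "card ?L = 4 * p" using J by (auto simp: card_cartesian_product)
  have "T \<subseteq> ?L \<rightarrow>\<^sub>E {..<N}" unfolding T_def by blast
  then have finT: "finite T" by (rule finite_subset[OF _ finite_PiE]) (use L in auto)
  have T1: "i \<in> ?L \<rightarrow>\<^sub>E {..<N}"
    and T2: "\<And>l. l \<in> ?L \<Longrightarrow> \<exists>l'\<in>?L. l' \<noteq> l \<and> \<bar>increment p i l'\<bar> = \<bar>increment p i l\<bar>"
    and T3: "\<And>j. j \<in> J \<Longrightarrow> \<exists>q<p. \<exists>j'\<in>J - {j}. \<exists>q'<p. \<bar>increment p i (j', q')\<bar> = \<bar>increment p i (j, q)\<bar>"
    if "i \<in> T" for i using that unfolding T_def by blast+
  have "card T \<le> card ?L ^ card ?L * card {1, - 1 :: int} ^ card ?L * N ^ (2 * p + 2)"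
  proof (rule card_le_by_patterns[OF L(1) finT])
    show "range sg \<subseteq> {1, - 1}" by (auto simp: sg_def)
    fix r :: "'a \<times> nat \<Rightarrow> 'a \<times> nat" and \<sigma> :: "'a \<times> nat \<Rightarrow> int"
    define S where "S = {i \<in> T. representative p ?L i = r \<and> (\<lambda>l\<in>?L. sg (increment p i l)) = \<sigma>}"
    have "card S \<le> N ^ (2 * p + 2)"
    proof (cases "S = {}")
      case False
      then obtain i0 where "i0 \<in> S" by blast
      then have i0: "i0 \<in> T" "r = representative p ?L i0" "\<sigma> = (\<lambda>l\<in>?L. sg (increment p i0 l))"
        unfolding S_def by auto
      have req: "r l = r l' \<longleftrightarrow> \<bar>increment p i0 l\<bar> = \<bar>increment p i0 l'\<bar>" if "l \<in> ?L" "l' \<in> ?L" for l l'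
        unfolding i0(2) by (rule representative_eq_iff[OF that])
      have sub: "S \<subseteq> {i \<in> ?L \<rightarrow>\<^sub>E {..<N}. \<forall>l\<in>?L. increment p i l = \<sigma> l * \<bar>increment p i (r l)\<bar>}"
      proof (intro subsetI CollectI conjI ballI)
        fix i assume i: "i \<in> S"
        then show "i \<in> ?L \<rightarrow>\<^sub>E {..<N}" using T1 unfolding S_def by blast
        fix l assume l: "l \<in> ?L"
        have "\<sigma> l = sg (increment p i l)" "r l = representative p ?L i l" using i l unfolding S_def by auto
        then show "increment p i l = \<sigma> l * \<bar>increment p i (r l)\<bar>"
          using representative(2)[OF l, of p i] by (simp add: sg_def)
      qed
      have fin: "finite {i \<in> ?L \<rightarrow>\<^sub>E {..<N}. \<forall>l\<in>?L. increment p i l = \<sigma> l * \<bar>increment p i (r l)\<bar>}"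
        by (rule finite_subset[OF _ finite_PiE[OF L(1), of "\<lambda>_. {..<N}"]]) auto
      have "card S \<le> card {i \<in> ?L \<rightarrow>\<^sub>E {..<N}. \<forall>l\<in>?L. increment p i l = \<sigma> l * \<bar>increment p i (r l)\<bar>}"
        by (rule card_mono[OF fin sub])
      also have "\<dots> \<le> N ^ (2 * p + 2)"
      proof (rule card_four_circuits_pattern[OF J p N])
        show "r \<in> ?L \<rightarrow> ?L" unfolding i0(2) by (intro Pi_I representative(1))
        show "\<sigma> l \<noteq> 0" if "l \<in> ?L" for l unfolding i0(3) using that by (simp add: sg_def)
        show "\<exists>l'\<in>?L. l' \<noteq> l \<and> r l' = r l" if l: "l \<in> ?L" for l
        proof -
          obtain l' where "l' \<in> ?L" "l' \<noteq> l" "\<bar>increment p i0 l'\<bar> = \<bar>increment p i0 l\<bar>"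
            using T2[OF i0(1) l] by (elim bexE conjE) (rule that)
          then show ?thesis using req[OF _ l, of l'] by (intro bexI[of _ l']) simp_all
        qed
        show "\<exists>q<p. \<exists>j'\<in>J - {j}. \<exists>q'<p. r (j', q') = r (j, q)" if j: "j \<in> J" for j
        proof -
          obtain q j' q' where q: "q < p" "j' \<in> J - {j}" "q' < p" "\<bar>increment p i0 (j', q')\<bar> = \<bar>increment p i0 (j, q)\<bar>"
            using T3[OF i0(1) j] by (elim exE bexE conjE) (rule that)
          then have "r (j', q') = r (j, q)" using req[of "(j', q')" "(j, q)"] q(1-3) j by simp
          with q show ?thesis by blast
        qed
      qed
      finally show ?thesis .
    qed simp
    then show "card {i \<in> T. representative p ?L i = r \<and> (\<lambda>l\<in>?L. sg (increment p i l)) = \<sigma>} \<le> N ^ (2 * p + 2)"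
      unfolding S_def .
  qed simp
  moreover have "card {1, - 1 :: int} = 2" by simp
  ultimately show ?thesis unfolding L(2) T_def by (simp only:)
qed

definition matched_circuit :: "nat \<Rightarrow> ('j \<times> nat) set \<Rightarrow> ('j \<times> nat \<Rightarrow> nat) \<Rightarrow> bool" where
  "matched_circuit p L i \<longleftrightarrow> (\<forall>l\<in>L. \<exists>l'\<in>L. l' \<noteq> l \<and> \<bar>increment p i l'\<bar> = \<bar>increment p i l\<bar>)"

text \<open>The groups are pairs with opposite, nonzero increments. A vanishing increment would leave open which
  entry of the symmetric block \<open>A\<^sub>0\<close> and its transpose a letter refers to; circuits with vanishing
  increments are few, so they are counted among the exceptions.\<close>

definition paired_circuit :: "nat \<Rightarrow> ('j \<times> nat) set \<Rightarrow> ('j \<times> nat \<Rightarrow> nat) \<Rightarrow> bool" where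
  "paired_circuit p L i \<longleftrightarrow> (\<forall>l\<in>L. increment p i l \<noteq> 0 \<and>
     (\<exists>l'\<in>L. l' \<noteq> l \<and> increment p i l' = - increment p i l \<and>
        (\<forall>l''\<in>L. \<bar>increment p i l''\<bar> = \<bar>increment p i l\<bar> \<longrightarrow> l'' = l \<or> l'' = l')))"

text \<open>Of the exponent \<open>1 + p/2\<close> of a pattern of pairs at least one half is lost: by a group of three or
  more letters, by an increment that is forced to vanish, or by a nontrivial closing equation. The
  closing equation is trivial only if the signs in each pair are opposite.\<close>

lemma card_matched_unpaired_pattern:
  assumes p: "0 < p" and N: "0 < N"
    and S: "S \<subseteq> {i \<in> {j} \<times> {..<p} \<rightarrow>\<^sub>E {..<N}. matched_circuit p ({j} \<times> {..<p}) i \<and> \<not> paired_circuit p ({j} \<times> {..<p}) i}"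
    and rep: "\<And>i. i \<in> S \<Longrightarrow> representative p ({j} \<times> {..<p}) i = r"
    and sig: "\<And>i l. i \<in> S \<Longrightarrow> l \<in> {j} \<times> {..<p} \<Longrightarrow> \<sigma> l = sgn (increment p i l)"
  shows "card S \<le> N ^ ((p + 1) div 2)"
proof (cases "S = {}")
  case False
  let ?L = "{j} \<times> {..<p}"
  obtain i0 where i0: "i0 \<in> S" using False by blast
  have L: "finite ?L" "card ?L = p" by (auto simp: card_cartesian_product)
  have S1: "i \<in> ?L \<rightarrow>\<^sub>E {..<N}" if "i \<in> S" for i using that S by blast
  have S2: "increment p i l = \<sigma> l * \<bar>increment p i (r l)\<bar>" if "i \<in> S" "l \<in> ?L" for i l
    using representative(2)[OF that(2), of p i] rep[OF that(1)] sig[OF that] by (simp add: mult_sgn_abs)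
  have r: "r \<in> ?L \<rightarrow> ?L" unfolding rep[OF i0, symmetric] by (intro Pi_I representative(1))
  have req: "r l = r l' \<longleftrightarrow> \<bar>increment p i0 l\<bar> = \<bar>increment p i0 l'\<bar>" if "l \<in> ?L" "l' \<in> ?L" for l l'
    using representative_eq_iff[OF that, of p i0] rep[OF i0] by simp
  have m: "\<exists>l'\<in>?L. l' \<noteq> l \<and> r l' = r l" if l: "l \<in> ?L" for l
  proof -
    have "matched_circuit p ?L i0" using i0 S by blast
    then obtain l' where "l' \<in> ?L" "l' \<noteq> l" "\<bar>increment p i0 l'\<bar> = \<bar>increment p i0 l\<bar>"
      using l unfolding matched_circuit_def by blast
    then show ?thesis using req[OF _ l, of l'] by blast
  qed
  define B where "B = r ` ?L"
  have finB: "finite B" by (simp add: B_def)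
  have B: "B \<subseteq> ?L" unfolding B_def using r by (rule funcset_image)
  let ?x = "\<lambda>i. (\<lambda>b\<in>B. nat \<bar>increment p i b\<bar>)"
  have box: "?x i \<in> B \<rightarrow>\<^sub>E {..<N}" if i: "i \<in> S" for i
  proof (rule restrict_PiE_iff[THEN iffD2], intro ballI)
    fix b assume "b \<in> B"
    then have "b \<in> ?L" using B by blast
    from abs_increment_less[OF p S1[OF i] this] show "nat \<bar>increment p i b\<bar> \<in> {..<N}"
      by (simp add: nat_less_iff)
  qed
  have main: "card S \<le> N ^ ((p + 1) div 2)"
    if X: "X \<subseteq> B \<rightarrow>\<^sub>E {..<N}" "\<And>i. i \<in> S \<Longrightarrow> ?x i \<in> X" "card X \<le> N ^ c" "Suc c \<le> (p + 1) div 2" for X c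
  proof -
    have "finite X" using X(1) finB by (rule finite_subset[OF _ finite_PiE]) auto
    then have "card S \<le> N ^ card {j} * card X"
      using X(2) S1 unfolding B_def by (intro card_pattern_le[OF _ p r _ S2]) (blast | simp)+
    also have "\<dots> \<le> N * N ^ c" using X(3) by simp
    also have "\<dots> \<le> N ^ ((p + 1) div 2)" using power_increasing[OF X(4), of N] N by simp
    finally show ?thesis .
  qed
  have ge2: "2 \<le> card (fibre r ?L b)" if "b \<in> B" for b
    by (rule card_fibre_ge_2[OF L(1) _ m]) (use that in \<open>simp_all only: B_def\<close>)
  have excess: "2 * card B + (\<Sum>b\<in>D. card (fibre r ?L b) - 2) \<le> p" if "D \<subseteq> B" for D
    using card_blocks_excess[OF L(1) m, of D] that unfolding B_def L(2) by blast
  have linear: ?thesis if u: "b \<in> B" "u b \<noteq> 0" "\<And>i. i \<in> S \<Longrightarrow> (\<Sum>c\<in>B. u c * int (?x i c)) = 0" for u b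
  proof (rule main)
    show "card {x \<in> B \<rightarrow>\<^sub>E {..<N}. (\<Sum>c\<in>B. u c * int (x c)) = 0} \<le> N ^ (card B - 1)"
      by (rule card_linear_equation_le[where b = b]) (use finB u in auto)
    show "?x i \<in> {x \<in> B \<rightarrow>\<^sub>E {..<N}. (\<Sum>c\<in>B. u c * int (x c)) = 0}" if "i \<in> S" for i
      using box[OF that] u(3)[OF that] by blast
    have "card B \<noteq> 0" using u(1) finB by auto
    then show "Suc (card B - 1) \<le> (p + 1) div 2" using excess[of "{}"] by simp
  qed blast
  show ?thesis
  proof (cases "\<exists>b\<in>B. 3 \<le> card (fibre r ?L b)")
    case True
    then obtain b where "b \<in> B" "3 \<le> card (fibre r ?L b)" by blast
    then have "Suc (card B) \<le> (p + 1) div 2" using excess[of "{b}"] by simp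
    then show ?thesis
      by (rule main[rotated -1, of _ "B \<rightarrow>\<^sub>E {..<N}"]) (use box finB in \<open>simp_all add: card_PiE\<close>)
  next
    case no3: False
    have two: "card (fibre r ?L b) = 2" if "b \<in> B" for b using ge2[OF that] no3 that by force
    show ?thesis
    proof (cases "\<exists>l\<in>?L. \<sigma> l = 0")
      case True
      then obtain l where l: "l \<in> ?L" "\<sigma> l = 0" by blast
      have rl: "r l \<in> B" using l by (auto simp: B_def)
      show ?thesis
      \<comment> \<open>The linear equation is that the coordinate at \<open>r l\<close> vanishes.\<close>
      proof (rule linear[OF rl, of "\<lambda>b. if b = r l then 1 else 0"])
        fix i assume i: "i \<in> S"
        have "increment p i l = 0" using S2[OF i l(1)] l(2) by simp
        then have "increment p i (r l) = 0"
          using representative(2)[OF l(1), of p i] rep[OF i] by simp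
        then show "(\<Sum>c\<in>B. (if c = r l then 1 else 0) * int (?x i c)) = 0"
          using rl finB by (simp add: if_distrib[of "\<lambda>x. x * _"] cong: if_cong)
      qed simp
    next
      case nz: False
      have "\<exists>b\<in>B. closing_coeff p r \<sigma> j b \<noteq> 0"
      proof (rule ccontr)
        assume "\<not> (\<exists>b\<in>B. closing_coeff p r \<sigma> j b \<noteq> 0)"
        then have zero: "closing_coeff p r \<sigma> j b = 0" if "b \<in> B" for b using that by blast
        have "paired_circuit p ?L i0"
          unfolding paired_circuit_def
        proof (intro ballI conjI)
          fix l assume l: "l \<in> ?L"
          show "increment p i0 l \<noteq> 0" using nz l sig[OF i0 l] by (auto simp: sgn_0_0)
          obtain l' where l': "l' \<in> ?L" "l' \<noteq> l" "r l' = r l" using m[OF l] by blast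
          have sub: "{l, l'} \<subseteq> fibre r ?L (r l)" using l l' by (auto simp: fibre_def)
          have finF: "finite (fibre r ?L (r l))" using L by (simp add: fibre_def)
          have "card (fibre r ?L (r l)) \<le> card {l, l'}" using two[of "r l"] l l' by (simp add: B_def)
          from card_seteq[OF finF sub this] have F: "fibre r ?L (r l) = {l, l'}" by simp
          obtain q q' where q: "l = (j, q)" "l' = (j, q')" "q < p" "q' < p" using l l' by blast
          have "{q''. q'' < p \<and> r (j, q'') = r l} = {q, q'}"
          proof (intro equalityI subsetI)
            fix q'' assume "q'' \<in> {q''. q'' < p \<and> r (j, q'') = r l}"
            then have "(j, q'') \<in> fibre r ?L (r l)" by (simp add: fibre_def)
            then have "(j, q'') \<in> {l, l'}" unfolding F .
            then show "q'' \<in> {q, q'}" by (auto simp: q)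
          next
            fix q'' assume "q'' \<in> {q, q'}"
            then show "q'' \<in> {q''. q'' < p \<and> r (j, q'') = r l}" using q l' by auto
          qed
          then have "closing_coeff p r \<sigma> j (r l) = \<sigma> l + \<sigma> l'"
            unfolding closing_coeff_def using q l'(2) by simp
          moreover have "r l \<in> B" using l by (simp add: B_def)
          ultimately have "\<sigma> l' = - \<sigma> l" using zero by fastforce
          then have "increment p i0 l' = - increment p i0 l"
            using S2[OF i0 l] S2[OF i0 l'(1)] l'(3) by simp
          moreover have "l'' = l \<or> l'' = l'" if "l'' \<in> ?L" "\<bar>increment p i0 l''\<bar> = \<bar>increment p i0 l\<bar>" for l''
          proof -
            have "r l'' = r l" using req[OF that(1) l] that(2) by blast
            then have "l'' \<in> fibre r ?L (r l)" using that(1) unfolding fibre_def by blast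
            then show ?thesis unfolding F by blast
          qed
          ultimately show "\<exists>l'\<in>?L. l' \<noteq> l \<and> increment p i0 l' = - increment p i0 l \<and>
              (\<forall>l''\<in>?L. \<bar>increment p i0 l''\<bar> = \<bar>increment p i0 l\<bar> \<longrightarrow> l'' = l \<or> l'' = l')"
            using l' by blast
        qed
        then show False using i0 S by blast
      qed
      then obtain b where b: "b \<in> B" "closing_coeff p r \<sigma> j b \<noteq> 0" by blast
      show ?thesis
      proof (rule linear[where u = "closing_coeff p r \<sigma> j", OF b])
        show "(\<Sum>c\<in>B. closing_coeff p r \<sigma> j c * int (?x i c)) = 0" if "i \<in> S" for i
          unfolding B_def by (rule closing_equation[OF p _ _ S2[OF that]]) auto
      qed
    qed
  qed
qed simp

lemma card_matched_unpaired:
  assumes p: "0 < p" and N: "0 < N"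
  shows "card {i \<in> {j} \<times> {..<p} \<rightarrow>\<^sub>E {..<N}. matched_circuit p ({j} \<times> {..<p}) i \<and> \<not> paired_circuit p ({j} \<times> {..<p}) i}
    \<le> p ^ p * 3 ^ p * N ^ ((p + 1) div 2)" (is "card ?T \<le> _")
proof -
  let ?L = "{j} \<times> {..<p}"
  define T where "T = ?T"
  have L: "finite ?L" "card ?L = p" by (auto simp: card_cartesian_product)
  have "T \<subseteq> ?L \<rightarrow>\<^sub>E {..<N}" unfolding T_def by blast
  then have finT: "finite T" by (rule finite_subset[OF _ finite_PiE]) (use L in auto)
  have "card T \<le> card ?L ^ card ?L * card {1, - 1, 0 :: int} ^ card ?L * N ^ ((p + 1) div 2)"
  proof (rule card_le_by_patterns[OF L(1) finT])
    show "range sgn \<subseteq> {1, - 1, 0 :: int}" by (auto simp: sgn_if)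
    fix r :: "'a \<times> nat \<Rightarrow> 'a \<times> nat" and \<sigma> :: "'a \<times> nat \<Rightarrow> int"
    show "card {i \<in> T. representative p ?L i = r \<and> (\<lambda>l\<in>?L. sgn (increment p i l)) = \<sigma>} \<le> N ^ ((p + 1) div 2)"
    proof (rule card_matched_unpaired_pattern[OF p N])
      fix i l
      assume i: "i \<in> {i \<in> T. representative p ?L i = r \<and> (\<lambda>l\<in>?L. sgn (increment p i l)) = \<sigma>}"
      then show "representative p ?L i = r" by blast
      assume l: "l \<in> ?L"
      have "(\<lambda>l\<in>?L. sgn (increment p i l)) = \<sigma>" using i by blast
      from fun_cong[OF this, of l] l show "\<sigma> l = sgn (increment p i l)" by simp
    qed (unfold T_def, blast)
  qed simp
  moreover have "card {1, - 1, 0 :: int} = 3" by simp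
  ultimately show ?thesis unfolding L(2) T_def by (simp only:)
qed

section \<open>Trace words of the block Toeplitz matrix and the fourth central moment\<close>

text \<open>The index of the independent variable that fills the position: by symmetry the entry \<open>(i, j)\<close> of
  \<open>A\<^sub>s\<close> is the entry \<open>(j, i)\<close> of \<open>A\<^sub>-\<^sub>s\<close>.\<close>

definition entry_key :: "int \<times> nat \<times> nat \<Rightarrow> int \<times> nat \<times> nat" where
  "entry_key = (\<lambda>(s, i, j). if 0 < s \<or> (s = 0 \<and> i \<le> j) then (s, i, j) else (- s, j, i))"

text \<open>Letter \<open>q\<close> of a word stands for the matrix entry in row \<open>w q\<close> and column \<open>w (q + 1)\<close>.\<close>

definition word_key :: "nat \<Rightarrow> nat \<Rightarrow> (nat \<Rightarrow> nat) \<Rightarrow> nat \<Rightarrow> int \<times> nat \<times> nat" where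
  "word_key m p w q = entry_key
     (int (w q div m) - int (w (Suc q mod p) div m), w q mod m, w (Suc q mod p) mod m)"

definition independent_keys :: "nat \<Rightarrow> nat \<Rightarrow> (int \<times> nat \<times> nat) set" where
  "independent_keys m N = {(s, i, j). 1 \<le> s \<and> s < int N \<and> i < m \<and> j < m} \<union>
     {(s, i, j). s = 0 \<and> 1 \<le> N \<and> i \<le> j \<and> j < m}"

lemma fst_entry_key: "fst (entry_key (s, i, j)) = \<bar>s\<bar>"
  by (auto simp: entry_key_def)

lemma entry_key_in_independent_keys:
  "\<bar>s\<bar> < int N \<Longrightarrow> i < m \<Longrightarrow> j < m \<Longrightarrow> entry_key (s, i, j) \<in> independent_keys m N"
  by (auto simp: entry_key_def independent_keys_def)

definition word_block :: "nat \<Rightarrow> nat \<Rightarrow> 'j set \<Rightarrow> ('j \<Rightarrow> nat \<Rightarrow> nat) \<Rightarrow> 'j \<times> nat \<Rightarrow> nat" where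
  "word_block m p J W = (\<lambda>l\<in>J \<times> {..<p}. W (fst l) (snd l) div m)"

definition word_component :: "nat \<Rightarrow> nat \<Rightarrow> 'j set \<Rightarrow> ('j \<Rightarrow> nat \<Rightarrow> nat) \<Rightarrow> 'j \<times> nat \<Rightarrow> nat" where
  "word_component m p J W = (\<lambda>l\<in>J \<times> {..<p}. W (fst l) (snd l) mod m)"

lemma fst_word_key:
  assumes "j \<in> J" "q < p"
  shows "fst (word_key m p (W j) q) = \<bar>increment p (word_block m p J W) (j, q)\<bar>"
proof -
  have "Suc q mod p < p" using assms by simp
  then show ?thesis using assms by (simp add: word_key_def fst_entry_key increment_def word_block_def)
qed

lemma word_key_in_independent_keys:
  assumes w: "w \<in> {..<p} \<rightarrow>\<^sub>E {..<m * N}" and q: "q < p"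
  shows "word_key m p w q \<in> independent_keys m N"
proof -
  have "Suc q mod p < p" using q by simp
  then have "w q < m * N" "w (Suc q mod p) < m * N" using PiE_mem[OF w] q by auto
  then have "w q div m < N" "w (Suc q mod p) div m < N" "0 < m"
    by (auto simp: less_mult_imp_div_less mult.commute intro: gr0I)
  then show ?thesis unfolding word_key_def by (intro entry_key_in_independent_keys) auto
qed

lemma word_block_component_PiE:
  assumes W: "W \<in> J \<rightarrow>\<^sub>E ({..<p} \<rightarrow>\<^sub>E {..<m * N})" and m: "0 < m"
  shows "word_block m p J W \<in> J \<times> {..<p} \<rightarrow>\<^sub>E {..<N}" "word_component m p J W \<in> J \<times> {..<p} \<rightarrow>\<^sub>E {..<m}"
proof -
  have less: "W j q < m * N" if "j \<in> J" "q < p" for j q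
    using PiE_mem[OF PiE_mem[OF W that(1)], of q] that by simp
  show "word_block m p J W \<in> J \<times> {..<p} \<rightarrow>\<^sub>E {..<N}"
    unfolding word_block_def using less
    by (intro restrict_PiE_iff[THEN iffD2] ballI) (auto simp: less_mult_imp_div_less mult.commute)
  show "word_component m p J W \<in> J \<times> {..<p} \<rightarrow>\<^sub>E {..<m}"
    unfolding word_component_def using m by (intro restrict_PiE_iff[THEN iffD2] ballI) auto
qed

lemma word_block_component_inj:
  "inj_on (\<lambda>W. (word_block m p J W, word_component m p J W)) (J \<rightarrow>\<^sub>E ({..<p} \<rightarrow>\<^sub>E {..<m * N}))"
proof (rule inj_onI)
  fix W W' assume W: "W \<in> J \<rightarrow>\<^sub>E ({..<p} \<rightarrow>\<^sub>E {..<m * N})" and W': "W' \<in> J \<rightarrow>\<^sub>E ({..<p} \<rightarrow>\<^sub>E {..<m * N})"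
    and eq: "(word_block m p J W, word_component m p J W) = (word_block m p J W', word_component m p J W')"
  have eqs: "word_block m p J W = word_block m p J W'" "word_component m p J W = word_component m p J W'"
    using eq by auto
  have same: "W j q = W' j q" if "j \<in> J" "q < p" for j q
  proof -
    have "W j q div m = W' j q div m"
      using fun_cong[OF eqs(1), of "(j, q)"] that by (simp add: word_block_def)
    moreover have "W j q mod m = W' j q mod m"
      using fun_cong[OF eqs(2), of "(j, q)"] that
      by (simp add: word_component_def)
    ultimately show ?thesis by (metis div_mult_mod_eq)
  qed
  show "W = W'"
  proof (rule PiE_ext[OF W W'])
    fix j assume j: "j \<in> J"
    show "W j = W' j"
      by (rule PiE_ext[OF PiE_mem[OF W j] PiE_mem[OF W' j]]) (use same[OF j] in simp)
  qed
qed

text \<open>The components are free, which costs a power of \<open>m\<close> only.\<close>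

lemma card_words_le:
  assumes J: "finite J" and m: "0 < m"
  shows "card {W \<in> J \<rightarrow>\<^sub>E ({..<p} \<rightarrow>\<^sub>E {..<m * N}). Q (word_block m p J W)} \<le>
    m ^ (card J * p) * card {i \<in> J \<times> {..<p} \<rightarrow>\<^sub>E {..<N}. Q i}" (is "card ?A \<le> _ * card ?B")
proof -
  let ?f = "\<lambda>W. (word_block m p J W, word_component m p J W)"
  have "inj_on ?f ?A" by (rule inj_on_subset[OF word_block_component_inj]) blast
  then have "card ?A = card (?f ` ?A)" by (simp add: card_image)
  also have "\<dots> \<le> card (?B \<times> (J \<times> {..<p} \<rightarrow>\<^sub>E {..<m}))"
  proof (rule card_mono)
    have "finite ?B"
      by (rule finite_subset[OF _ finite_PiE[of "J \<times> {..<p}" "\<lambda>_. {..<N}"]]) (use J in auto)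
    then show "finite (?B \<times> (J \<times> {..<p} \<rightarrow>\<^sub>E {..<m}))" using J by (intro finite_cartesian_product finite_PiE) auto
    show "?f ` ?A \<subseteq> ?B \<times> (J \<times> {..<p} \<rightarrow>\<^sub>E {..<m})"
    proof (rule image_subsetI)
      fix W assume "W \<in> ?A"
      then have W: "W \<in> J \<rightarrow>\<^sub>E ({..<p} \<rightarrow>\<^sub>E {..<m * N})" "Q (word_block m p J W)" by auto
      show "?f W \<in> ?B \<times> (J \<times> {..<p} \<rightarrow>\<^sub>E {..<m})"
        using word_block_component_PiE[OF W(1) m] W(2) by simp
    qed
  qed
  also have "\<dots> = m ^ (card J * p) * card ?B"
    using J by (simp add: card_cartesian_product card_PiE)
  finally show ?thesis .
qed

context block_toeplitz_model
begin

definition entry :: "nat \<Rightarrow> nat \<Rightarrow> int \<times> nat \<times> nat \<Rightarrow> 'w \<Rightarrow> real" where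
  "entry m N = (\<lambda>(s, i, j). a m N s i j)"

definition entry_moment :: "nat \<Rightarrow> nat \<Rightarrow> real" where
  "entry_moment m r = enn2real (moment_bound M a r m)"

lemma entry_moments:
  assumes m: "1 \<le> m" and v: "\<bar>s\<bar> < int N" "i < m" "j < m"
  shows "integrable M (\<lambda>\<omega>. a m N s i j \<omega> ^ r)" "\<bar>expectation (\<lambda>\<omega>. a m N s i j \<omega> ^ r)\<bar> \<le> entry_moment m r"
proof -
  have [measurable]: "random_variable borel (a m N s i j)" by (rule random_variable_entry[OF v])
  have "(\<integral>\<^sup>+\<omega>. ennreal (\<bar>a m N s i j \<omega>\<bar> ^ r) \<partial>M) \<le> moment_bound M a r m"
    unfolding moment_bound_def by (rule SUP_upper2[of "(N, s, i, j)"]) (use v in auto)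
  also have fin: "moment_bound M a r m < \<infinity>" by (rule moment_bound_finite[OF m])
  finally have less: "(\<integral>\<^sup>+\<omega>. ennreal (norm (a m N s i j \<omega> ^ r)) \<partial>M) < \<infinity>" by (simp add: power_abs)
  show int: "integrable M (\<lambda>\<omega>. a m N s i j \<omega> ^ r)" by (rule integrableI_bounded[OF _ less]) simp
  have "\<bar>expectation (\<lambda>\<omega>. a m N s i j \<omega> ^ r)\<bar> \<le> expectation (\<lambda>\<omega>. \<bar>a m N s i j \<omega> ^ r\<bar>)"
    by (rule integral_abs_bound)
  also have "\<dots> = enn2real (\<integral>\<^sup>+\<omega>. ennreal \<bar>a m N s i j \<omega> ^ r\<bar> \<partial>M)"
    by (rule integral_eq_nn_integral) auto
  also have "\<dots> \<le> entry_moment m r"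
    unfolding entry_moment_def
  proof (rule enn2real_mono[OF _ fin[unfolded infinity_ennreal_def]])
    show "(\<integral>\<^sup>+\<omega>. ennreal \<bar>a m N s i j \<omega> ^ r\<bar> \<partial>M) \<le> moment_bound M a r m"
      unfolding moment_bound_def power_abs by (rule SUP_upper2[of "(N, s, i, j)"]) (use v in auto)
  qed
  finally show "\<bar>expectation (\<lambda>\<omega>. a m N s i j \<omega> ^ r)\<bar> \<le> entry_moment m r" .
qed

lemma centered_family_entry:
  assumes m: "1 \<le> m"
  shows "centered_family M (entry m N) (independent_keys m N) (entry_moment m)"
proof
  show "indep_vars (\<lambda>_. borel) (entry m N) (independent_keys m N)"
    using indep_entries[of m N] unfolding entry_def independent_keys_def .
  fix v assume v: "v \<in> independent_keys m N"
  obtain s i j where sij: "v = (s, i, j)" by (cases v)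
  have b: "\<bar>s\<bar> < int N" "i < m" "j < m" using v by (auto simp: sij independent_keys_def)
  show "expectation (entry m N v) = 0" using mean_entry[OF b] by (simp add: entry_def sij)
  show "integrable M (\<lambda>\<omega>. entry m N v \<omega> ^ r)" "\<bar>expectation (\<lambda>\<omega>. entry m N v \<omega> ^ r)\<bar> \<le> entry_moment m r" for r
    using entry_moments[OF m b] by (simp_all add: entry_def sij)
qed

lemma entry_variance:
  assumes "v \<in> independent_keys m N"
  shows "expectation (\<lambda>\<omega>. entry m N v \<omega> ^ 2) = 1"
proof -
  obtain s i j where sij: "v = (s, i, j)" by (cases v)
  have b: "\<bar>s\<bar> < int N" "i < m" "j < m" using assms by (auto simp: sij independent_keys_def)
  show ?thesis using second_moment_entry[OF b] by (simp add: entry_def sij)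
qed

lemma entry_entry_key:
  assumes "\<bar>s\<bar> < int N" "i < m" "j < m" "\<omega> \<in> space M"
  shows "entry m N (entry_key (s, i, j)) \<omega> = a m N s i j \<omega>"
  using transpose_entry[of s N j m i \<omega>] transpose_entry[of s N i m j \<omega>] assms
  by (auto simp: entry_def entry_key_def)

definition toeplitz_trace :: "nat \<Rightarrow> nat \<Rightarrow> nat \<Rightarrow> 'w \<Rightarrow> real" where
  "toeplitz_trace m N p \<omega> = mat_trace (block_toeplitz a m N \<omega> ^\<^sub>m p)"

text \<open>The sample point has to lie in the space, since symmetry of the entries is required only there.\<close>

lemma toeplitz_trace_eq:
  assumes p: "0 < p" and \<omega>: "\<omega> \<in> space M"
  shows "toeplitz_trace m N p \<omega> =
    (\<Sum>w\<in>{..<p} \<rightarrow>\<^sub>E {..<m * N}. \<Prod>q<p. entry m N (word_key m p w q) \<omega>)"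
proof -
  have T: "block_toeplitz a m N \<omega> \<in> carrier_mat (m * N) (m * N)" by (simp add: block_toeplitz_def)
  show ?thesis
    unfolding toeplitz_trace_def mat_trace_pow[OF T p]
  proof (intro sum.cong prod.cong refl)
    fix w q assume w: "w \<in> {..<p} \<rightarrow>\<^sub>E {..<m * N}" and "q \<in> {..<p}"
    then have q: "q < p" "Suc q mod p < p" by auto
    have wl: "w q < m * N" "w (Suc q mod p) < m * N" using PiE_mem[OF w] q by auto
    then have b: "w q div m < N" "w (Suc q mod p) div m < N" "0 < m"
      by (auto simp: less_mult_imp_div_less mult.commute intro: gr0I)
    show "block_toeplitz a m N \<omega> $$ (w q, w (Suc q mod p)) = entry m N (word_key m p w q) \<omega>"
      unfolding word_key_def using wl b \<omega> by (subst entry_entry_key) (auto simp: block_toeplitz_def)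
  qed
qed

definition word_mean :: "nat \<Rightarrow> nat \<Rightarrow> nat \<Rightarrow> (nat \<Rightarrow> nat) \<Rightarrow> real" where
  "word_mean m N p w = expectation (\<lambda>\<omega>. \<Prod>q<p. entry m N (word_key m p w q) \<omega>)"

lemma word_product_integrable:
  assumes "1 \<le> m" "w \<in> {..<p} \<rightarrow>\<^sub>E {..<m * N}"
  shows "integrable M (\<lambda>\<omega>. \<Prod>q<p. entry m N (word_key m p w q) \<omega>)"
proof -
  interpret centered_family M "entry m N" "independent_keys m N" "entry_moment m"
    by (rule centered_family_entry[OF assms(1)])
  show ?thesis
    by (rule product_mean_fibres(1)) (use word_key_in_independent_keys[OF assms(2)] in auto)
qed

lemma expectation_toeplitz_trace:
  assumes m: "1 \<le> m" and p: "0 < p"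
  shows "integrable M (toeplitz_trace m N p)"
    "expectation (toeplitz_trace m N p) = (\<Sum>w\<in>{..<p} \<rightarrow>\<^sub>E {..<m * N}. word_mean m N p w)"
proof -
  let ?\<Omega> = "{..<p} \<rightarrow>\<^sub>E {..<m * N}"
  have "integrable M (\<lambda>\<omega>. \<Sum>w\<in>?\<Omega>. \<Prod>q<p. entry m N (word_key m p w q) \<omega>)"
    by (rule Bochner_Integration.integrable_sum) (rule word_product_integrable[OF m])
  moreover have "integrable M (toeplitz_trace m N p) \<longleftrightarrow>
      integrable M (\<lambda>\<omega>. \<Sum>w\<in>?\<Omega>. \<Prod>q<p. entry m N (word_key m p w q) \<omega>)"
    by (rule Bochner_Integration.integrable_cong[OF refl]) (rule toeplitz_trace_eq[OF p])
  ultimately show "integrable M (toeplitz_trace m N p)" by simp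
  have "expectation (toeplitz_trace m N p) =
      expectation (\<lambda>\<omega>. \<Sum>w\<in>?\<Omega>. \<Prod>q<p. entry m N (word_key m p w q) \<omega>)"
    by (rule Bochner_Integration.integral_cong[OF refl]) (rule toeplitz_trace_eq[OF p])
  also have "\<dots> = (\<Sum>w\<in>?\<Omega>. word_mean m N p w)"
    unfolding word_mean_def by (rule Bochner_Integration.integral_sum) (rule word_product_integrable[OF m])
  finally show "expectation (toeplitz_trace m N p) = (\<Sum>w\<in>?\<Omega>. word_mean m N p w)" .
qed

text \<open>The fourth power of the centred trace is a sum over quadruples of words. A quadruple contributes
  only if no variable occurs once and no word is isolated; equal variables force equal absolute
  increments, so \<open>card_linked_quadruples\<close> applies.\<close>

lemma fourth_central_moment_bound:
  assumes m: "1 \<le> m" and p: "0 < p"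
  shows "\<exists>K. \<forall>N\<ge>1. integrable M (\<lambda>\<omega>. (toeplitz_trace m N p \<omega> - expectation (toeplitz_trace m N p)) ^ 4) \<and>
    expectation (\<lambda>\<omega>. (toeplitz_trace m N p \<omega> - expectation (toeplitz_trace m N p)) ^ 4) \<le> K * real N ^ (2 * p + 2)"
proof -
  let ?J = "{..<4::nat}"
  define K' where "K' = 2 ^ 4 * centered_family.product_bound (entry_moment m) (4 * p) ^ 5"
  define K where "K = K' * real (m ^ (4 * p) * ((4 * p) ^ (4 * p) * 2 ^ (4 * p)))"
  have "integrable M (\<lambda>\<omega>. (toeplitz_trace m N p \<omega> - expectation (toeplitz_trace m N p)) ^ 4) \<and>
    expectation (\<lambda>\<omega>. (toeplitz_trace m N p \<omega> - expectation (toeplitz_trace m N p)) ^ 4) \<le> K * real N ^ (2 * p + 2)"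
    if N: "1 \<le> N" for N
  proof -
    interpret cf: centered_family M "entry m N" "independent_keys m N" "entry_moment m"
      by (rule centered_family_entry[OF m])
    let ?\<Omega> = "{..<p} \<rightarrow>\<^sub>E {..<m * N}"
    \<comment> \<open>The variable at letter \<open>(j, q)\<close> of a quadruple \<open>W\<close> of words.\<close>
    let ?\<kappa> = "\<lambda>W (j, q). word_key m p (W j) q"
    let ?P = "?J \<rightarrow>\<^sub>E ?\<Omega>"
    have V: "?\<kappa> W ` (?J \<times> {..<p}) \<subseteq> independent_keys m N" if W: "W \<in> ?P" for W
      using word_key_in_independent_keys[OF PiE_mem[OF W]] by auto
    have single: "cf.product_mean (?\<kappa> W) ({j} \<times> {..<p}) = word_mean m N p (W j)" for W j
    proof -
      have "(\<Prod>l\<in>{j} \<times> {..<p}. entry m N (?\<kappa> W l) \<omega>) = (\<Prod>q<p. entry m N (word_key m p (W j) q) \<omega>)" for \<omega>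
      proof -
        have "{j} \<times> {..<p} = Pair j ` {..<p}" by auto
        then show ?thesis by (simp add: prod.reindex inj_on_def)
      qed
      then show ?thesis unfolding cf.product_mean_def word_mean_def by simp
    qed
    let ?Y = "\<lambda>w \<omega>. (\<Prod>q<p. entry m N (word_key m p w q) \<omega>) - word_mean m N p w"
    have expand: "(toeplitz_trace m N p \<omega> - expectation (toeplitz_trace m N p)) ^ 4 =
        (\<Sum>W\<in>?P. \<Prod>j\<in>?J. ?Y (W j) \<omega>)" if "\<omega> \<in> space M" for \<omega>
    proof -
      have "(toeplitz_trace m N p \<omega> - expectation (toeplitz_trace m N p)) ^ 4 = (\<Prod>j\<in>?J. \<Sum>w\<in>?\<Omega>. ?Y w \<omega>)"
        unfolding toeplitz_trace_eq[OF p that] expectation_toeplitz_trace(2)[OF m p] by (simp add: sum_subtractf)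
      also have "\<dots> = (\<Sum>W\<in>?P. \<Prod>j\<in>?J. ?Y (W j) \<omega>)"
        by (rule prod_sum_PiE) (auto intro: finite_PiE)
      finally show ?thesis .
    qed
    have int: "integrable M (\<lambda>\<omega>. \<Prod>j\<in>?J. ?Y (W j) \<omega>)"
      and val: "expectation (\<lambda>\<omega>. \<Prod>j\<in>?J. ?Y (W j) \<omega>) = cf.central_product_mean (?\<kappa> W) ?J {..<p}"
      if W: "W \<in> ?P" for W
      using cf.central_product_mean_expand(1)[OF _ _ V[OF W]]
      unfolding cf.central_product_mean_def single by simp_all
    have iff: "integrable M (\<lambda>\<omega>. (toeplitz_trace m N p \<omega> - expectation (toeplitz_trace m N p)) ^ 4) \<longleftrightarrow>
        integrable M (\<lambda>\<omega>. \<Sum>W\<in>?P. \<Prod>j\<in>?J. ?Y (W j) \<omega>)"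
      by (rule Bochner_Integration.integrable_cong[OF refl]) (rule expand)
    have "integrable M (\<lambda>\<omega>. \<Sum>W\<in>?P. \<Prod>j\<in>?J. ?Y (W j) \<omega>)"
      by (rule Bochner_Integration.integrable_sum) (rule int)
    moreover have "expectation (\<lambda>\<omega>. (toeplitz_trace m N p \<omega> - expectation (toeplitz_trace m N p)) ^ 4) =
        expectation (\<lambda>\<omega>. \<Sum>W\<in>?P. \<Prod>j\<in>?J. ?Y (W j) \<omega>)"
      by (rule Bochner_Integration.integral_cong[OF refl]) (rule expand)
    moreover have "\<dots> = (\<Sum>W\<in>?P. cf.central_product_mean (?\<kappa> W) ?J {..<p})"
      by (subst Bochner_Integration.integral_sum[OF int]) (auto intro: sum.cong val)
    moreover have "(\<Sum>W\<in>?P. cf.central_product_mean (?\<kappa> W) ?J {..<p}) \<le> K * real N ^ (2 * p + 2)"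
    proof -
      define Q where "Q i \<longleftrightarrow> (\<forall>l\<in>?J \<times> {..<p}. \<exists>l'\<in>?J \<times> {..<p}. l' \<noteq> l \<and> \<bar>increment p i l'\<bar> = \<bar>increment p i l\<bar>) \<and>
        (\<forall>j\<in>?J. \<exists>q<p. \<exists>j'\<in>?J - {j}. \<exists>q'<p. \<bar>increment p i (j', q')\<bar> = \<bar>increment p i (j, q)\<bar>)" for i
      let ?G = "{W \<in> ?P. Q (word_block m p ?J W)}"
      have zero: "cf.central_product_mean (?\<kappa> W) ?J {..<p} = 0" if W: "W \<in> ?P" and nQ: "\<not> Q (word_block m p ?J W)" for W
      proof (rule ccontr)
        assume nz: "cf.central_product_mean (?\<kappa> W) ?J {..<p} \<noteq> 0"
        have keyabs: "\<bar>increment p (word_block m p ?J W) l\<bar> = fst (?\<kappa> W l)" if "l \<in> ?J \<times> {..<p}" for l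
          using fst_word_key[of "fst l" ?J "snd l" p m W] that by (auto simp: case_prod_beta)
        have 1: "\<exists>l'\<in>?J \<times> {..<p}. l' \<noteq> l \<and> ?\<kappa> W l' = ?\<kappa> W l" if l: "l \<in> ?J \<times> {..<p}" for l
        proof (rule ccontr)
          assume "\<not> ?thesis"
          then have "cf.central_product_mean (?\<kappa> W) ?J {..<p} = 0"
            by (intro cf.central_product_mean_singleton_fibre[OF _ _ V[OF W] l]) auto
          with nz show False by contradiction
        qed
        have 2: "\<exists>q<p. \<exists>j'\<in>?J - {j}. \<exists>q'<p. ?\<kappa> W (j', q') = ?\<kappa> W (j, q)" if j: "j \<in> ?J" for j
        proof (rule ccontr)
          assume no: "\<not> ?thesis"
          have "?\<kappa> W ` ({j} \<times> {..<p}) \<inter> ?\<kappa> W ` ((?J - {j}) \<times> {..<p}) = {}"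
          proof (rule ccontr)
            assume "?\<kappa> W ` ({j} \<times> {..<p}) \<inter> ?\<kappa> W ` ((?J - {j}) \<times> {..<p}) \<noteq> {}"
            then obtain v where "v \<in> ?\<kappa> W ` ({j} \<times> {..<p})" "v \<in> ?\<kappa> W ` ((?J - {j}) \<times> {..<p})" by blast
            then obtain l l' where l: "l \<in> {j} \<times> {..<p}" "v = ?\<kappa> W l"
              and l': "l' \<in> (?J - {j}) \<times> {..<p}" "v = ?\<kappa> W l'" by (elim imageE) (rule that)
            obtain q where q: "l = (j, q)" "q < p" using l(1) by auto
            obtain j' q' where q': "l' = (j', q')" "j' \<in> ?J - {j}" "q' < p" using l'(1) by auto
            have "?\<kappa> W (j', q') = ?\<kappa> W (j, q)" using l(2) l'(2) unfolding q(1) q'(1) by simp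
            with q(2) q'(2,3) have "\<exists>q<p. \<exists>j'\<in>?J - {j}. \<exists>q'<p. ?\<kappa> W (j', q') = ?\<kappa> W (j, q)"
              by (intro exI[of _ q] conjI bexI[of _ j'] exI[of _ q'])
            with no show False by contradiction
          qed
          then have "cf.central_product_mean (?\<kappa> W) ?J {..<p} = 0"
            by (intro cf.central_product_mean_isolated[OF _ _ V[OF W] j]) auto
          with nz show False by contradiction
        qed
        have "Q (word_block m p ?J W)"
          unfolding Q_def
        proof (intro conjI ballI)
          fix l assume l: "l \<in> ?J \<times> {..<p}"
          obtain l' where l': "l' \<in> ?J \<times> {..<p}" "l' \<noteq> l" "?\<kappa> W l' = ?\<kappa> W l" using 1[OF l] by (elim bexE conjE) (rule that)
          show "\<exists>l'\<in>?J \<times> {..<p}. l' \<noteq> l \<and> \<bar>increment p (word_block m p ?J W) l'\<bar> = \<bar>increment p (word_block m p ?J W) l\<bar>"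
            using l' keyabs[OF l] keyabs[OF l'(1)] by (intro bexI[of _ l']) simp_all
        next
          fix j assume j: "j \<in> ?J"
          obtain q j' q' where q: "q < p" "j' \<in> ?J - {j}" "q' < p" "?\<kappa> W (j', q') = ?\<kappa> W (j, q)"
            using 2[OF j] by (elim exE bexE conjE) (rule that)
          have "\<bar>increment p (word_block m p ?J W) (j', q')\<bar> = \<bar>increment p (word_block m p ?J W) (j, q)\<bar>"
            using keyabs[of "(j, q)"] keyabs[of "(j', q')"] q j by simp
          with q show "\<exists>q<p. \<exists>j'\<in>?J - {j}. \<exists>q'<p.
              \<bar>increment p (word_block m p ?J W) (j', q')\<bar> = \<bar>increment p (word_block m p ?J W) (j, q)\<bar>"
            by (intro exI[of _ q] conjI bexI[of _ j'] exI[of _ q'])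
        qed
        with nQ show False by contradiction
      qed
      have finP: "finite ?P" by (intro finite_PiE) auto
      have "(\<Sum>W\<in>?P. cf.central_product_mean (?\<kappa> W) ?J {..<p}) =
          (\<Sum>W\<in>?G. cf.central_product_mean (?\<kappa> W) ?J {..<p})"
        by (rule sum.mono_neutral_right[OF finP]) (use zero in auto)
      also have "\<dots> \<le> (\<Sum>W\<in>?G. K')"
      proof (rule sum_mono)
        fix W assume "W \<in> ?G"
        then have W: "W \<in> ?P" by blast
        have "\<bar>cf.central_product_mean (?\<kappa> W) ?J {..<p}\<bar> \<le> K'"
          using cf.central_product_mean_bound[OF _ _ V[OF W]] unfolding K'_def
          by (simp add: numeral_eq_Suc)
        then show "cf.central_product_mean (?\<kappa> W) ?J {..<p} \<le> K'" by simp
      qed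
      also have "\<dots> = K' * real (card ?G)" by simp
      also have "\<dots> \<le> K' * real (m ^ (4 * p) * ((4 * p) ^ (4 * p) * 2 ^ (4 * p) * N ^ (2 * p + 2)))"
      proof (intro mult_left_mono of_nat_mono)
        have "card ?G \<le> m ^ (card ?J * p) * card {i \<in> ?J \<times> {..<p} \<rightarrow>\<^sub>E {..<N}. Q i}"
          by (rule card_words_le) (use m in auto)
        also have "card {i \<in> ?J \<times> {..<p} \<rightarrow>\<^sub>E {..<N}. Q i} \<le> (4 * p) ^ (4 * p) * 2 ^ (4 * p) * N ^ (2 * p + 2)"
          unfolding Q_def by (rule card_linked_quadruples) (use p N in auto)
        finally show "card ?G \<le> m ^ (4 * p) * ((4 * p) ^ (4 * p) * 2 ^ (4 * p) * N ^ (2 * p + 2))" by simp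
        show "0 \<le> K'" unfolding K'_def using cf.product_bound_ge_1[of "4 * p"] by simp
      qed
      also have "\<dots> = K * real N ^ (2 * p + 2)" unfolding K_def by (simp add: mult_ac)
      finally show ?thesis .
    qed
    ultimately show ?thesis using iff by simp
  qed
  then show ?thesis by blast
qed

end

section \<open>Pair partitions\<close>

lemma pair_partition_block:
  assumes \<pi>: "\<pi> \<in> pair_partitions n" and q: "q \<in> {1..n}"
  shows "block_of \<pi> q \<in> \<pi>" "q \<in> block_of \<pi> q" "block_of \<pi> q = {q, partner \<pi> q}"
    "partner \<pi> q \<noteq> q" "partner \<pi> q \<in> {1..n}"
    "\<And>V. V \<in> \<pi> \<Longrightarrow> q \<in> V \<Longrightarrow> block_of \<pi> q = V"
proof -
  have part: "partition_on {1..n} \<pi>" and two: "\<And>V. V \<in> \<pi> \<Longrightarrow> card V = 2"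
    using \<pi> by (auto simp: pair_partitions_def)
  have ex: "\<exists>!V. V \<in> \<pi> \<and> q \<in> V"
  proof (rule ex_ex1I)
    show "\<exists>V. V \<in> \<pi> \<and> q \<in> V" using q partition_onD1[OF part] by blast
    show "V = W" if "V \<in> \<pi> \<and> q \<in> V" "W \<in> \<pi> \<and> q \<in> W" for V W
      using disjointD[OF partition_onD2[OF part], of V W] that by blast
  qed
  from theI'[OF this] show b: "block_of \<pi> q \<in> \<pi>" "q \<in> block_of \<pi> q" by (auto simp: block_of_def)
  show u: "block_of \<pi> q = V" if "V \<in> \<pi>" "q \<in> V" for V using ex b that by blast
  obtain x y where xy: "block_of \<pi> q = {x, y}" "x \<noteq> y" using two[OF b(1)] by (auto simp: card_2_iff)
  \<comment> \<open>The element of the block other than \<open>q\<close>.\<close>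
  define z where "z = (if q = x then y else x)"
  have z: "block_of \<pi> q = {q, z}" "z \<noteq> q" using xy b(2) by (auto simp: z_def)
  then have pz: "partner \<pi> q = z" unfolding partner_def by (intro the_equality) auto
  show "block_of \<pi> q = {q, partner \<pi> q}" "partner \<pi> q \<noteq> q" using z pz by auto
  show "partner \<pi> q \<in> {1..n}" using b(1) z pz partition_onD1[OF part] by blast
qed

lemma pair_partition_partner:
  assumes \<pi>: "\<pi> \<in> pair_partitions n" and q: "q \<in> {1..n}"
  shows "partner \<pi> (partner \<pi> q) = q" "block_of \<pi> (partner \<pi> q) = block_of \<pi> q"
    "block_label \<pi> (partner \<pi> q) = block_label \<pi> q"
    "pair_sign \<pi> q = (if q < partner \<pi> q then 1 else - 1)"
    "pair_sign \<pi> (partner \<pi> q) = - pair_sign \<pi> q"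
proof -
  note q' = pair_partition_block[OF \<pi> q] and p' = pair_partition_block[OF \<pi> pair_partition_block(5)[OF \<pi> q]]
  show b: "block_of \<pi> (partner \<pi> q) = block_of \<pi> q" using q' p'(6)[of "block_of \<pi> q"] by blast
  show pp: "partner \<pi> (partner \<pi> q) = q" using b q'(3,4) p'(3,4) by (metis doubleton_eq_iff)
  show "block_label \<pi> (partner \<pi> q) = block_label \<pi> q" by (simp add: block_label_def b)
  have m: "Min (block_of \<pi> q) = min q (partner \<pi> q)" using q'(3) by simp
  show s: "pair_sign \<pi> q = (if q < partner \<pi> q then 1 else - 1)"
    unfolding pair_sign_def m using q'(4) by (auto simp: min_def)
  show "pair_sign \<pi> (partner \<pi> q) = - pair_sign \<pi> q"
    unfolding pair_sign_def b m using q'(4) by (auto simp: min_def)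
qed

lemma finite_pair_partition:
  assumes \<pi>: "\<pi> \<in> pair_partitions n"
  shows "finite \<pi>" "2 * card \<pi> = n"
proof -
  have part: "partition_on {1..n} \<pi>" and two: "\<And>V. V \<in> \<pi> \<Longrightarrow> card V = 2"
    using \<pi> by (auto simp: pair_partitions_def)
  show fin: "finite \<pi>" using finite_elements[OF _ part] by simp
  have "card {1..n} = (\<Sum>V\<in>\<pi>. card V)"
    unfolding partition_onD1[OF part] using partition_onD2[OF part] two card_ge_0_finite
    by (intro card_Union_disjoint) (force simp: disjoint_def pairwise_def disjnt_def)+
  then show "2 * card \<pi> = n" using two by simp
qed

text \<open>Ranking the blocks by their minima numbers them from \<open>1\<close> to \<open>k\<close>.\<close>

lemma block_label_bij:
  assumes \<pi>: "\<pi> \<in> pair_partitions (2 * k)"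
  shows "bij_betw (\<lambda>V. card {W \<in> \<pi>. Min W \<le> Min V}) \<pi> {1..k}"
proof -
  have part: "partition_on {1..2 * k} \<pi>" and two: "\<And>V. V \<in> \<pi> \<Longrightarrow> card V = 2"
    using \<pi> by (auto simp: pair_partitions_def)
  have fin: "finite \<pi>" and card: "card \<pi> = k" using finite_pair_partition[OF \<pi>] by auto
  let ?f = "\<lambda>V. card {W \<in> \<pi>. Min W \<le> Min V}"
  have Min_in': "Min V \<in> V" if "V \<in> \<pi>" for V
    using two[OF that] by (intro Min_in) (auto intro: card_ge_0_finite)
  have minj: "V = W" if "V \<in> \<pi>" "W \<in> \<pi>" "Min V = Min W" for V W
    using that Min_in'[OF that(1)] Min_in'[OF that(2)] partition_onD2[OF part]
    by (metis disjointD disjoint_iff)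
  have "inj_on ?f \<pi>"
  proof (rule inj_onI, rule ccontr)
    have less: "?f V < ?f W" if "V \<in> \<pi>" "W \<in> \<pi>" "Min V < Min W" for V W
    proof (rule psubset_card_mono)
      show "finite {U \<in> \<pi>. Min U \<le> Min W}" using fin by simp
      have "W \<notin> {U \<in> \<pi>. Min U \<le> Min V}" "W \<in> {U \<in> \<pi>. Min U \<le> Min W}" using that by auto
      then show "{U \<in> \<pi>. Min U \<le> Min V} \<subset> {U \<in> \<pi>. Min U \<le> Min W}" using that(3) by fastforce
    qed
    fix V W assume VW: "V \<in> \<pi>" "W \<in> \<pi>" "?f V = ?f W" "V \<noteq> W"
    then have "Min V \<noteq> Min W" using minj by blast
    then show False using less[of V W] less[of W V] VW by force
  qed
  moreover have "?f ` \<pi> \<subseteq> {1..k}"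
  proof (rule image_subsetI)
    fix V assume V: "V \<in> \<pi>"
    have "?f V \<le> card \<pi>" using fin by (intro card_mono) auto
    moreover have "0 < ?f V" using V fin by (subst card_gt_0_iff) auto
    ultimately show "?f V \<in> {1..k}" using card by simp
  qed
  moreover have "card (?f ` \<pi>) = k" using \<open>inj_on ?f \<pi>\<close> card by (simp add: card_image)
  ultimately show ?thesis unfolding bij_betw_def by (simp add: card_subset_eq)
qed

lemma block_label_properties:
  assumes \<pi>: "\<pi> \<in> pair_partitions (2 * k)"
  shows "\<And>q. q \<in> {1..2 * k} \<Longrightarrow> block_label \<pi> q \<in> {1..k}"
    and "\<And>q r. q \<in> {1..2 * k} \<Longrightarrow> r \<in> {1..2 * k} \<Longrightarrow> block_label \<pi> q = block_label \<pi> r \<Longrightarrow> r = q \<or> r = partner \<pi> q"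
    and "\<And>l. l \<in> {1..k} \<Longrightarrow> \<exists>q\<in>{1..2 * k}. block_label \<pi> q = l \<and> pair_sign \<pi> q = 1"
proof -
  let ?f = "\<lambda>V. card {W \<in> \<pi>. Min W \<le> Min V}"
  note bij = block_label_bij[OF \<pi>]
  have lab: "block_label \<pi> q = ?f (block_of \<pi> q)" for q by (simp add: block_label_def)
  show "block_label \<pi> q \<in> {1..k}" if "q \<in> {1..2 * k}" for q
    unfolding lab using bij_betwE[OF bij] pair_partition_block(1)[OF \<pi> that] by blast
  show "r = q \<or> r = partner \<pi> q"
    if q: "q \<in> {1..2 * k}" and r: "r \<in> {1..2 * k}" and eq: "block_label \<pi> q = block_label \<pi> r" for q r
  proof -
    have "block_of \<pi> q = block_of \<pi> r"
      using inj_onD[OF bij_betw_imp_inj_on[OF bij], of "block_of \<pi> q" "block_of \<pi> r"] eq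
        pair_partition_block(1)[OF \<pi> q] pair_partition_block(1)[OF \<pi> r] unfolding lab by blast
    then show ?thesis using pair_partition_block(2)[OF \<pi> r] pair_partition_block(3)[OF \<pi> q] by auto
  qed
  show "\<exists>q\<in>{1..2 * k}. block_label \<pi> q = l \<and> pair_sign \<pi> q = 1" if l: "l \<in> {1..k}" for l
  proof -
    have "l \<in> ?f ` \<pi>" unfolding bij_betw_imp_surj_on[OF bij] by (rule l)
    then obtain V where V: "V \<in> \<pi>" "?f V = l" by (elim imageE) simp
    have part: "partition_on {1..2 * k} \<pi>" and two: "card V = 2" using \<pi> V by (auto simp: pair_partitions_def)
    have "Min V \<in> V" using two by (intro Min_in) (auto intro: card_ge_0_finite)
    moreover from this have q: "Min V \<in> {1..2 * k}" using V partition_onD1[OF part] by blast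
    ultimately have "block_of \<pi> (Min V) = V" using pair_partition_block(6)[OF \<pi> q] V by blast
    then show ?thesis using q V by (intro bexI[of _ "Min V"]) (auto simp: lab pair_sign_def)
  qed
qed

text \<open>The partner of a fixed element can be chosen in \<open>2k - 1\<close> ways, so the number is at most
  \<open>(2k - 1)!! = (2k)! / (2\<^sup>k k!)\<close>.\<close>

lemma card_pair_partitions_of_set:
  assumes "finite A" "card A = 2 * k"
  shows "finite {\<pi>. partition_on A \<pi> \<and> (\<forall>V\<in>\<pi>. card V = 2)}"
    and "card {\<pi>. partition_on A \<pi> \<and> (\<forall>V\<in>\<pi>. card V = 2)} * (2 ^ k * fact k) \<le> fact (2 * k)"
proof -
  let ?P = "\<lambda>A. {\<pi>. partition_on A \<pi> \<and> (\<forall>V\<in>\<pi>. card V = 2)}"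
  have fin: "finite (?P A)" if "finite A" for A :: "'a set"
    by (rule finite_subset[OF _ finitely_many_partition_on[OF that]]) auto
  then show "finite (?P A)" using assms by blast
  show "card (?P A) * (2 ^ k * fact k) \<le> fact (2 * k)"
    using assms
  proof (induction k arbitrary: A)
    case 0
    then have "?P A \<subseteq> {{}}" by (auto simp: partition_on_def)
    then have "card (?P A) \<le> card {{} :: 'a set set}" by (intro card_mono) auto
    then show ?case by simp
  next
    case (Suc k)
    then obtain x where x: "x \<in> A" by fastforce
    have sub: "?P A \<subseteq> (\<Union>y\<in>A - {x}. insert {x, y} ` ?P (A - {x, y}))"
    proof
      fix \<pi> assume "\<pi> \<in> ?P A"
      then have part: "partition_on A \<pi>" and two: "\<forall>V\<in>\<pi>. card V = 2" by auto
      obtain V where V: "V \<in> \<pi>" "x \<in> V" using x partition_onD1[OF part] by blast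
      have "card V = 2" using two V by blast
      then obtain y where y: "V = {x, y}" "y \<noteq> x" using V(2) by (auto simp: card_2_iff)
      have yA: "y \<in> A - {x}" using V y partition_onD1[OF part] by blast
      have "partition_on (A - V) (\<pi> - {V})" 
        using part V by (auto simp: partition_on_def disjoint_def)
      then have "\<pi> - {V} \<in> ?P (A - {x, y})" using two y by auto
      moreover have "\<pi> = insert {x, y} (\<pi> - {V})" using V y by auto
      ultimately show "\<pi> \<in> (\<Union>y\<in>A - {x}. insert {x, y} ` ?P (A - {x, y}))" using yA by blast
    qed
    have le: "card (?P A) * (2 ^ k * fact k) \<le> (\<Sum>y\<in>A - {x}. fact (2 * k))"
    proof -
      have "card (?P A) \<le> card (\<Union>y\<in>A - {x}. insert {x, y} ` ?P (A - {x, y}))"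
        using sub Suc.prems fin by (intro card_mono finite_UN_I finite_imageI) auto
      also have "\<dots> \<le> (\<Sum>y\<in>A - {x}. card (insert {x, y} ` ?P (A - {x, y})))"
        using Suc.prems by (intro card_UN_le) auto
      also have "\<dots> \<le> (\<Sum>y\<in>A - {x}. card (?P (A - {x, y})))"
        using Suc.prems fin by (intro sum_mono card_image_le) auto
      finally have "card (?P A) * (2 ^ k * fact k) \<le> (\<Sum>y\<in>A - {x}. card (?P (A - {x, y}))) * (2 ^ k * fact k)"
        by (rule mult_right_mono) simp
      also have "\<dots> = (\<Sum>y\<in>A - {x}. card (?P (A - {x, y})) * (2 ^ k * fact k))" by (rule sum_distrib_right)
      also have "\<dots> \<le> (\<Sum>y\<in>A - {x}. fact (2 * k))"
        using Suc.prems x by (intro sum_mono Suc.IH) (auto simp: card_Diff_subset)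
      finally show ?thesis .
    qed
    have "card (?P A) * (2 ^ Suc k * fact (Suc k)) = card (?P A) * (2 ^ k * fact k) * (2 * Suc k)" by (simp add: algebra_simps)
    also have "\<dots> \<le> (\<Sum>y\<in>A - {x}. fact (2 * k)) * (2 * Suc k)" using le by (rule mult_right_mono) simp
    also have "\<dots> = fact (2 * Suc k)" using Suc.prems x by (simp add: card_Diff_subset algebra_simps)
    finally show ?case .
  qed
qed

lemma card_pair_partitions:
  shows "finite (pair_partitions (2 * k))" "card (pair_partitions (2 * k)) * (2 ^ k * fact k) \<le> fact (2 * k)"
  using card_pair_partitions_of_set[of "{1..2 * k}" k] by (simp_all add: pair_partitions_def)

section \<open>The leading term of the expected trace\<close>

text \<open>The increment of a single circuit. Letters are numbered from \<open>0\<close> here and from \<open>1\<close> in pair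
  partitions, so letter \<open>q\<close> corresponds to the element \<open>Suc q\<close>.\<close>

definition step_difference :: "nat \<Rightarrow> (nat \<Rightarrow> nat) \<Rightarrow> nat \<Rightarrow> int" where
  "step_difference p i q = int (i q) - int (i (Suc q mod p))"

definition combine_word :: "nat \<Rightarrow> nat \<Rightarrow> (nat \<Rightarrow> nat) \<Rightarrow> (nat \<Rightarrow> nat) \<Rightarrow> nat \<Rightarrow> nat" where
  "combine_word m p i t = (\<lambda>q\<in>{..<p}. i q * m + t q)"

lemma sum_words:
  assumes m: "0 < m"
  shows "(\<Sum>w\<in>{..<p} \<rightarrow>\<^sub>E {..<m * N}. F w) =
    (\<Sum>i\<in>{..<p} \<rightarrow>\<^sub>E {..<N}. \<Sum>t\<in>{..<p} \<rightarrow>\<^sub>E {..<m}. F (combine_word m p i t))"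
proof -
  let ?A = "{..<p} \<rightarrow>\<^sub>E {..<N}" and ?B = "{..<p} \<rightarrow>\<^sub>E {..<m}" and ?\<Omega> = "{..<p} \<rightarrow>\<^sub>E {..<m * N}"
  let ?f = "\<lambda>(i, t). combine_word m p i t"
  let ?g = "\<lambda>w. (\<lambda>q\<in>{..<p}. w q div m, \<lambda>q\<in>{..<p}. w q mod m)"
  have "bij_betw ?f (?A \<times> ?B) ?\<Omega>"
  proof (rule bij_betw_byWitness[where f' = ?g])
    show "\<forall>x\<in>?A \<times> ?B. ?g (?f x) = x"
    proof
      fix x assume "x \<in> ?A \<times> ?B"
      then obtain i t where x: "x = (i, t)" "i \<in> ?A" "t \<in> ?B" by auto
      have tm: "t q < m" if "q < p" for q using PiE_mem[OF x(3)] that by simp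
      have "(\<lambda>q\<in>{..<p}. combine_word m p i t q div m) = i"
        by (rule PiE_ext[of _ "{..<p}" "\<lambda>_. UNIV" _]) (use x(2) tm m in \<open>auto simp: combine_word_def\<close>)
      moreover have "(\<lambda>q\<in>{..<p}. combine_word m p i t q mod m) = t"
        by (rule PiE_ext[of _ "{..<p}" "\<lambda>_. UNIV" _]) (use x(3) tm m in \<open>auto simp: combine_word_def\<close>)
      ultimately show "?g (?f x) = x" by (simp add: x(1))
    qed
    show "\<forall>w\<in>?\<Omega>. ?f (?g w) = w"
    proof
      fix w assume w: "w \<in> ?\<Omega>"
      show "?f (?g w) = w"
        by (rule PiE_ext[of _ "{..<p}" "\<lambda>_. UNIV" _]) (use w in \<open>auto simp: combine_word_def\<close>)
    qed
    show "?f ` (?A \<times> ?B) \<subseteq> ?\<Omega>"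
    proof (rule image_subsetI)
      fix x assume "x \<in> ?A \<times> ?B"
      then obtain i t where x: "x = (i, t)" "i \<in> ?A" "t \<in> ?B" by auto
      have "i q * m + t q < m * N" if "q < p" for q
      proof -
        have "i q < N" "t q < m" using PiE_mem[OF x(2)] PiE_mem[OF x(3)] that by auto
        then have "i q * m + t q < Suc (i q) * m" "Suc (i q) * m \<le> N * m" by (simp, intro mult_right_mono) auto
        then show ?thesis by (simp add: mult.commute)
      qed
      then show "?f x \<in> ?\<Omega>" by (simp add: x(1) combine_word_def restrict_PiE_iff)
    qed
    show "?g ` ?\<Omega> \<subseteq> ?A \<times> ?B"
    proof (rule image_subsetI)
      fix w assume w: "w \<in> ?\<Omega>"
      have "w q div m < N" if "q < p" for q
        using PiE_mem[OF w, of q] that by (simp add: less_mult_imp_div_less mult.commute)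
      then show "?g w \<in> ?A \<times> ?B" using m by (simp add: restrict_PiE_iff)
    qed
  qed
  then have "(\<Sum>w\<in>?\<Omega>. F w) = (\<Sum>x\<in>?A \<times> ?B. F (?f x))"
    by (rule sum.reindex_bij_betw[symmetric])
  then show ?thesis by (simp add: sum.cartesian_product case_prod_beta)
qed

lemma combine_word_PiE:
  assumes "i \<in> {..<p} \<rightarrow>\<^sub>E {..<N}" "t \<in> {..<p} \<rightarrow>\<^sub>E {..<m}"
  shows "combine_word m p i t \<in> {..<p} \<rightarrow>\<^sub>E {..<m * N}"
proof -
  have "i q * m + t q < m * N" if "q < p" for q
  proof -
    have "i q < N" "t q < m" using PiE_mem[OF assms(1)] PiE_mem[OF assms(2)] that by auto
    then have "i q * m + t q < Suc (i q) * m" "Suc (i q) * m \<le> N * m" by (simp, intro mult_right_mono) auto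
    then show ?thesis by (simp add: mult.commute)
  qed
  then show ?thesis by (simp add: combine_word_def restrict_PiE_iff)
qed

lemma word_key_combine:
  assumes "t \<in> {..<p} \<rightarrow>\<^sub>E {..<m}" "q < p"
  shows "word_key m p (combine_word m p i t) q = entry_key (step_difference p i q, t q, t (Suc q mod p))"
proof -
  have p: "Suc q mod p < p" using assms(2) by simp
  have "t q < m" "t (Suc q mod p) < m" using PiE_mem[OF assms(1)] assms(2) p by auto
  then show ?thesis using assms(2) p by (simp add: word_key_def combine_word_def step_difference_def)
qed

definition matched_word :: "nat \<Rightarrow> (nat \<Rightarrow> nat) \<Rightarrow> bool" where
  "matched_word p i \<longleftrightarrow> (\<forall>q<p. \<exists>q'<p. q' \<noteq> q \<and> \<bar>step_difference p i q'\<bar> = \<bar>step_difference p i q\<bar>)"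

definition opposite_step :: "nat \<Rightarrow> (nat \<Rightarrow> nat) \<Rightarrow> nat \<Rightarrow> nat \<Rightarrow> bool" where
  "opposite_step p i q q' \<longleftrightarrow> q' < p \<and> q' \<noteq> q \<and> step_difference p i q' = - step_difference p i q \<and>
     (\<forall>q''<p. \<bar>step_difference p i q''\<bar> = \<bar>step_difference p i q\<bar> \<longrightarrow> q'' = q \<or> q'' = q')"

definition paired_word :: "nat \<Rightarrow> (nat \<Rightarrow> nat) \<Rightarrow> bool" where
  "paired_word p i \<longleftrightarrow> (\<forall>q<p. step_difference p i q \<noteq> 0 \<and> (\<exists>q'. opposite_step p i q q'))"

lemma card_matched_unpaired_words:
  assumes p: "0 < p" and N: "0 < N"
  shows "card {i \<in> {..<p} \<rightarrow>\<^sub>E {..<N}. matched_word p i \<and> \<not> paired_word p i} \<le> p ^ p * 3 ^ p * N ^ ((p + 1) div 2)"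
    (is "card ?A \<le> _")
proof -
  let ?L = "{0::nat} \<times> {..<p}"
  let ?f = "\<lambda>i. \<lambda>l\<in>?L. i (snd l) :: nat"
  let ?B = "{i \<in> ?L \<rightarrow>\<^sub>E {..<N}. matched_circuit p ?L i \<and> \<not> paired_circuit p ?L i}"
  have inc: "increment p (?f i) (0, q) = step_difference p i q" if "q < p" for i q
    using that by (simp add: increment_def step_difference_def)
  have matched: "matched_circuit p ?L (?f i)" if mw: "matched_word p i" for i
    unfolding matched_circuit_def
  proof
    fix l assume "l \<in> ?L"
    then obtain q where l: "l = (0, q)" "q < p" by auto
    obtain q' where q': "q' < p" "q' \<noteq> q" "\<bar>step_difference p i q'\<bar> = \<bar>step_difference p i q\<bar>"
      using mw l(2) unfolding matched_word_def by blast
    show "\<exists>l'\<in>?L. l' \<noteq> l \<and> \<bar>increment p (?f i) l'\<bar> = \<bar>increment p (?f i) l\<bar>"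
      by (rule bexI[of _ "(0, q')"]) (use q' l inc[OF l(2), of i] inc[OF q'(1), of i] in \<open>simp_all only: prod.inject\<close>, auto)
  qed
  have paired: "paired_word p i" if pc: "paired_circuit p ?L (?f i)" for i
    unfolding paired_word_def
  proof (intro allI impI conjI)
    fix q assume q: "q < p"
    then have l: "(0, q) \<in> ?L" by simp
    note P = pc[unfolded paired_circuit_def, rule_format, OF l]
    show "step_difference p i q \<noteq> 0" using P inc[OF q, of i] by simp
    obtain l' where l': "l' \<in> ?L" "l' \<noteq> (0, q)" "increment p (?f i) l' = - increment p (?f i) (0, q)"
      "\<forall>l''\<in>?L. \<bar>increment p (?f i) l''\<bar> = \<bar>increment p (?f i) (0, q)\<bar> \<longrightarrow> l'' = (0, q) \<or> l'' = l'"
      using conjunct2[OF P] by (elim bexE conjE) (rule that)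
    obtain q' where q': "l' = (0, q')" "q' < p" using l'(1) by auto
    have "q'' = q \<or> q'' = q'" if "q'' < p" "\<bar>step_difference p i q''\<bar> = \<bar>step_difference p i q\<bar>" for q''
    proof -
      have "(0, q'') \<in> ?L" using that by simp
      from l'(4)[rule_format, OF this] show ?thesis
        using that(2) unfolding inc[OF that(1)] inc[OF q] q'(1) by simp
    qed
    then show "\<exists>q'. opposite_step p i q q'"
      using l'(2,3) q'(2) inc[OF q, of i] inc[OF q'(2), of i] unfolding q'(1) opposite_step_def
      by (intro exI[of _ q']) auto
  qed
  have finB: "finite ?B"
    by (rule finite_subset[OF _ finite_PiE[of ?L "\<lambda>_. {..<N}"]]) auto
  have "inj_on ?f ?A"
  proof (rule inj_onI)
    fix i i' assume i: "i \<in> ?A" "i' \<in> ?A" and eq: "?f i = ?f i'"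
    have "i q = i' q" if "q < p" for q using fun_cong[OF eq, of "(0, q)"] that by simp
    then show "i = i'" using i by (intro PiE_ext[of i "{..<p}" "\<lambda>_. {..<N}" i']) auto
  qed
  then have "card ?A = card (?f ` ?A)" by (rule card_image[symmetric])
  also have "\<dots> \<le> card ?B"
  proof (rule card_mono[OF finB], rule image_subsetI)
    fix i assume "i \<in> ?A"
    then have i: "i \<in> {..<p} \<rightarrow>\<^sub>E {..<N}" "matched_word p i" "\<not> paired_word p i" by blast+
    have "?f i \<in> ?L \<rightarrow>\<^sub>E {..<N}"
    proof (rule restrict_PiE_iff[THEN iffD2], rule ballI)
      fix l assume "l \<in> ?L"
      then have "snd l \<in> {..<p}" by (rule SigmaE) simp
      then show "i (snd l) \<in> {..<N}" by (rule PiE_mem[OF i(1)])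
    qed
    then show "?f i \<in> ?B" using matched[OF i(2)] paired[of i] i(3) by (intro CollectI conjI notI) blast+
  qed
  also have "\<dots> \<le> p ^ p * 3 ^ p * N ^ ((p + 1) div 2)" by (rule card_matched_unpaired[OF p N])
  finally show ?thesis .
qed

text \<open>Letter \<open>q\<close> is the element \<open>Suc q\<close> of the partition, so its partner letter is
  \<open>partner \<pi> (Suc q) - 1\<close>.\<close>

definition paired_blocks :: "nat \<Rightarrow> nat set set \<Rightarrow> nat \<Rightarrow> (nat \<Rightarrow> nat) set" where
  "paired_blocks p \<pi> N = {i \<in> {..<p} \<rightarrow>\<^sub>E {..<N}.
     \<forall>q<p. step_difference p i (partner \<pi> (Suc q) - 1) = - step_difference p i q}"

text \<open>Solutions in \<open>{..<m}\<close> of the linear system of \<open>\<pi>\<close>. The position after the partner letter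
  \<open>partner \<pi> (Suc q) - 1\<close> is \<open>partner \<pi> (Suc q)\<close>, read cyclically.\<close>

definition paired_components :: "nat \<Rightarrow> nat set set \<Rightarrow> nat \<Rightarrow> (nat \<Rightarrow> nat) set" where
  "paired_components p \<pi> m = {t \<in> {..<p} \<rightarrow>\<^sub>E {..<m}. \<forall>q<p. t q = t (partner \<pi> (Suc q) mod p)}"

lemma pair_partition_eqI:
  assumes "\<pi> \<in> pair_partitions n" "\<pi>' \<in> pair_partitions n" "\<And>q. q \<in> {1..n} \<Longrightarrow> partner \<pi> q = partner \<pi>' q"
  shows "\<pi> = \<pi>'"
proof -
  have sub: "\<pi> \<subseteq> \<pi>'" if \<pi>: "\<pi> \<in> pair_partitions n" and \<pi>': "\<pi>' \<in> pair_partitions n"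
    and eq: "\<And>q. q \<in> {1..n} \<Longrightarrow> partner \<pi> q = partner \<pi>' q" for \<pi> \<pi>'
  proof
    fix V assume V: "V \<in> \<pi>"
    have part: "partition_on {1..n} \<pi>" and two: "card V = 2" using \<pi> V by (auto simp: pair_partitions_def)
    obtain q where q: "q \<in> V" using two by fastforce
    then have qn: "q \<in> {1..n}" using V partition_onD1[OF part] by blast
    have "V = {q, partner \<pi> q}"
      using pair_partition_block(3,6)[OF \<pi> qn] V q by metis
    also have "\<dots> = block_of \<pi>' q" using pair_partition_block(3)[OF \<pi>' qn] eq[OF qn] by simp
    finally show "V \<in> \<pi>'" using pair_partition_block(1)[OF \<pi>' qn] by simp
  qed
  show ?thesis using sub[of \<pi> \<pi>'] sub[of \<pi>' \<pi>] assms by (intro equalityI) auto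
qed

text \<open>The pairing of the letters of such a word is an involution without fixed points, and its orbits
  form a pair partition.\<close>

lemma paired_word_partition:
  assumes pw: "paired_word p i"
  obtains \<pi> f where "\<pi> \<in> pair_partitions p" "\<And>q. q < p \<Longrightarrow> opposite_step p i q (f q)"
    "\<And>q. q < p \<Longrightarrow> partner \<pi> (Suc q) = Suc (f q)" "\<And>q. q < p \<Longrightarrow> f (f q) = q"
proof -
  \<comment> \<open>The partner letter.\<close>
  define f where "f q = (SOME q'. opposite_step p i q q')" for q
  have f: "opposite_step p i q (f q)" if "q < p" for q
    using pw that unfolding f_def paired_word_def by (metis someI_ex)
  have fp: "f q < p" "f q \<noteq> q" "step_difference p i (f q) = - step_difference p i q" if "q < p" for q
    using f[OF that] by (auto simp: opposite_step_def)
  have u: "q'' = q \<or> q'' = f q" if "q < p" "q'' < p" "\<bar>step_difference p i q''\<bar> = \<bar>step_difference p i q\<bar>" for q q''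
    using f[OF that(1)] that(2,3) unfolding opposite_step_def by blast
  have ff: "f (f q) = q" if q: "q < p" for q
    using u[OF fp(1)[OF q] q] fp(2)[OF q] fp(3)[OF q] by simp
  define b where "b q = {Suc q, Suc (f q)}" for q
  define \<pi> where "\<pi> = b ` {..<p}"
  have beq: "b q = b q'" if "q < p" "q' < p" "x \<in> b q" "x \<in> b q'" for q q' x
  proof -
    have "q = q' \<or> q = f q' \<or> f q = q' \<or> f q = f q'" using that(3,4) by (auto simp: b_def)
    then have "q' = q \<or> q' = f q" using ff[OF that(1)] ff[OF that(2)] by metis
    then show ?thesis using ff[OF that(1)] by (auto simp: b_def)
  qed
  have "\<pi> \<in> pair_partitions p"
    unfolding pair_partitions_def
  proof (intro CollectI conjI ballI)
    show "partition_on {1..p} \<pi>"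
    proof (rule partition_onI)
      show "\<Union>\<pi> = {1..p}"
      proof (intro equalityI subsetI)
        fix x assume "x \<in> \<Union>\<pi>"
        then obtain q where "q < p" "x \<in> b q" by (auto simp: \<pi>_def)
        then show "x \<in> {1..p}" using fp(1)[of q] by (auto simp: b_def)
      next
        fix x assume "x \<in> {1..p}"
        then have "x - 1 < p" "x \<in> b (x - 1)" by (auto simp: b_def)
        then show "x \<in> \<Union>\<pi>" by (auto simp: \<pi>_def)
      qed
      show "disjnt V W" if V: "V \<in> \<pi>" and W: "W \<in> \<pi>" and ne: "V \<noteq> W" for V W
      proof (rule ccontr)
        assume "\<not> disjnt V W"
        then obtain x where x: "x \<in> V" "x \<in> W" by (auto simp: disjnt_def)
        obtain q q' where "V = b q" "q < p" "W = b q'" "q' < p" using V W by (auto simp: \<pi>_def)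
        then show False using beq[of q q' x] x ne by simp
      qed
      show "{} \<notin> \<pi>" by (auto simp: \<pi>_def b_def)
    qed
    fix V assume "V \<in> \<pi>"
    then obtain q where "q < p" "V = b q" by (auto simp: \<pi>_def)
    then show "card V = 2" using fp(2)[of q] by (simp add: b_def)
  qed
  moreover have "partner \<pi> (Suc q) = Suc (f q)" if q: "q < p" for q
  proof -
    have q': "Suc q \<in> {1..p}" using q by simp
    have "b q \<in> \<pi>" "Suc q \<in> b q" using q by (auto simp: \<pi>_def b_def)
    then have "block_of \<pi> (Suc q) = b q" by (rule pair_partition_block(6)[OF \<open>\<pi> \<in> pair_partitions p\<close> q'])
    then have "{Suc q, partner \<pi> (Suc q)} = {Suc q, Suc (f q)}"
      using pair_partition_block(3)[OF \<open>\<pi> \<in> pair_partitions p\<close> q'] by (simp add: b_def)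
    then show ?thesis by (auto simp: doubleton_eq_iff)
  qed
  ultimately show thesis using f ff by (intro that)
qed

text \<open>Two entries in blocks \<open>A\<^sub>s\<close> and \<open>A\<^sub>-\<^sub>s\<close> with \<open>s \<noteq> 0\<close> are the same variable only as transposes of each
  other. This is where the equations of the linear system come from.\<close>

lemma entry_key_opposite:
  assumes "s \<noteq> 0"
  shows "entry_key (s, i, j) = entry_key (- s, i', j') \<longleftrightarrow> i = j' \<and> j = i'"
  using assms by (auto simp: entry_key_def)

context block_toeplitz_model
begin

lemma word_mean_unmatched:
  assumes m: "1 \<le> m" and i: "i \<in> {..<p} \<rightarrow>\<^sub>E {..<N}" and t: "t \<in> {..<p} \<rightarrow>\<^sub>E {..<m}"
    and q: "q < p" "\<And>q'. q' < p \<Longrightarrow> q' \<noteq> q \<Longrightarrow>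
      entry_key (step_difference p i q', t q', t (Suc q' mod p)) \<noteq> entry_key (step_difference p i q, t q, t (Suc q mod p))"
  shows "word_mean m N p (combine_word m p i t) = 0"
proof -
  interpret cf: centered_family M "entry m N" "independent_keys m N" "entry_moment m"
    by (rule centered_family_entry[OF m])
  have "cf.product_mean (word_key m p (combine_word m p i t)) {..<p} = 0"
  proof (rule cf.product_mean_singleton_fibre[where l = q])
    show "word_key m p (combine_word m p i t) ` {..<p} \<subseteq> independent_keys m N"
      using word_key_in_independent_keys[OF combine_word_PiE[OF i t]] by auto
    fix q' assume "q' \<in> {..<p}" and eq: "word_key m p (combine_word m p i t) q' = word_key m p (combine_word m p i t) q"
    then have q': "q' < p" by simp
    show "q' = q"
      using q(2)[OF q'] eq unfolding word_key_combine[OF t q'] word_key_combine[OF t q(1)] by blast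
  qed (use q in auto)
  then show ?thesis by (simp add: word_mean_def cf.product_mean_def)
qed

text \<open>If the components solve the equations, every variable occurs exactly twice and contributes its
  variance \<open>1\<close>; otherwise some variable occurs only once.\<close>

lemma word_mean_paired:
  assumes m: "1 \<le> m" and i: "i \<in> {..<p} \<rightarrow>\<^sub>E {..<N}" and t: "t \<in> {..<p} \<rightarrow>\<^sub>E {..<m}"
    and nz: "\<And>q. q < p \<Longrightarrow> step_difference p i q \<noteq> 0"
    and f: "\<And>q. q < p \<Longrightarrow> opposite_step p i q (f q)" "\<And>q. q < p \<Longrightarrow> f (f q) = q"
  shows "word_mean m N p (combine_word m p i t) = of_bool (\<forall>q<p. t q = t (Suc (f q) mod p))"
proof -
  interpret cf: centered_family M "entry m N" "independent_keys m N" "entry_moment m"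
    by (rule centered_family_entry[OF m])
  let ?k = "\<lambda>q. entry_key (step_difference p i q, t q, t (Suc q mod p))"
  have fp: "f q < p" "f q \<noteq> q" "step_difference p i (f q) = - step_difference p i q" if "q < p" for q
    using f(1)[OF that] by (auto simp: opposite_step_def)
  have u: "q'' = q \<or> q'' = f q" if "q < p" "q'' < p" "\<bar>step_difference p i q''\<bar> = \<bar>step_difference p i q\<bar>" for q q''
    using f(1)[OF that(1)] that(2,3) unfolding opposite_step_def by blast
  have key_cases: "q'' = q \<or> q'' = f q" if "q < p" "q'' < p" "?k q'' = ?k q" for q q''
    using arg_cong[OF that(3), of fst] u[OF that(1,2)] unfolding fst_entry_key by blast
  have key_iff: "?k q = ?k (f q) \<longleftrightarrow> t q = t (Suc (f q) mod p) \<and> t (Suc q mod p) = t (f q)" if q: "q < p" for q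
    unfolding fp(3)[OF q] by (rule entry_key_opposite[OF nz[OF q]])
  show ?thesis
  proof (cases "\<forall>q<p. t q = t (Suc (f q) mod p)")
    case True
    let ?\<kappa> = "word_key m p (combine_word m p i t)"
    have \<kappa>: "?\<kappa> q = ?k q" if "q < p" for q by (rule word_key_combine[OF t that])
    have V: "?\<kappa> ` {..<p} \<subseteq> independent_keys m N"
      using word_key_in_independent_keys[OF combine_word_PiE[OF i t]] by auto
    have keq: "?k q = ?k (f q)" if q: "q < p" for q
    proof -
      have "t q = t (Suc (f q) mod p)" using True q by blast
      moreover have "t (f q) = t (Suc (f (f q)) mod p)" using True fp(1)[OF q] by blast
      ultimately show ?thesis unfolding key_iff[OF q] f(2)[OF q] by simp
    qed
    have fib: "{q' \<in> {..<p}. ?\<kappa> q' = v} = {q, f q}" if q: "q < p" and v: "v = ?\<kappa> q" for q v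
    proof (intro equalityI subsetI)
      fix q' assume q': "q' \<in> {q' \<in> {..<p}. ?\<kappa> q' = v}"
      then have "?k q' = ?k q" using \<kappa>[OF q] \<kappa>[of q'] v by simp
      then show "q' \<in> {q, f q}" using key_cases[OF q] q' by auto
    next
      fix q' assume "q' \<in> {q, f q}"
      then show "q' \<in> {q' \<in> {..<p}. ?\<kappa> q' = v}" using q fp(1)[OF q] keq[OF q] \<kappa>[OF q] \<kappa>[OF fp(1)[OF q]] v by auto
    qed
    have "cf.product_mean ?\<kappa> {..<p} =
        (\<Prod>v\<in>?\<kappa> ` {..<p}. expectation (\<lambda>\<omega>. entry m N v \<omega> ^ card {q' \<in> {..<p}. ?\<kappa> q' = v}))"
      by (rule cf.product_mean_fibres(2)[OF _ V]) simp
    also have "\<dots> = 1"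
    proof (rule prod.neutral, rule ballI)
      fix v assume v: "v \<in> ?\<kappa> ` {..<p}"
      then obtain q where q: "q < p" "v = ?\<kappa> q" by auto
      have "card {q, f q} = 2" using fp(2)[OF q(1)] by simp
      then have "card {q' \<in> {..<p}. ?\<kappa> q' = v} = 2" unfolding fib[OF q] .
      then show "expectation (\<lambda>\<omega>. entry m N v \<omega> ^ card {q' \<in> {..<p}. ?\<kappa> q' = v}) = 1"
        using entry_variance[OF subsetD[OF V v]] by simp
    qed
    finally have "word_mean m N p (combine_word m p i t) = 1"
      unfolding word_mean_def cf.product_mean_def .
    then show ?thesis unfolding of_bool_def if_P[OF True] .
  next
    case False
    then obtain q where q: "q < p" "t q \<noteq> t (Suc (f q) mod p)" by blast
    have "word_mean m N p (combine_word m p i t) = 0"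
    proof (rule word_mean_unmatched[OF m i t q(1)])
      fix q' assume q': "q' < p" "q' \<noteq> q"
      show "?k q' \<noteq> ?k q"
      proof
        assume eq: "?k q' = ?k q"
        then have "q' = f q" using key_cases[OF q(1) q'(1)] q'(2) by blast
        then have "?k q = ?k (f q)" using eq by simp
        then show False using key_iff[OF q(1)] q(2) by blast
      qed
    qed
    then show ?thesis unfolding of_bool_def if_not_P[OF False] .
  qed
qed

lemma word_mean_bound:
  assumes m: "1 \<le> m" and i: "i \<in> {..<p} \<rightarrow>\<^sub>E {..<N}" and t: "t \<in> {..<p} \<rightarrow>\<^sub>E {..<m}"
  shows "\<bar>word_mean m N p (combine_word m p i t)\<bar> \<le> centered_family.product_bound (entry_moment m) p"
proof -
  interpret cf: centered_family M "entry m N" "independent_keys m N" "entry_moment m"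
    by (rule centered_family_entry[OF m])
  have "\<bar>cf.product_mean (word_key m p (combine_word m p i t)) {..<p}\<bar> \<le> cf.product_bound p"
    using word_key_in_independent_keys[OF combine_word_PiE[OF i t]] by (intro cf.product_mean_bound) auto
  then show ?thesis by (simp add: word_mean_def cf.product_mean_def)
qed

text \<open>The estimate holds word by word. If the block indices are unmatched, the mean of the word and its
  share of the main term vanish; if they are properly paired, exactly one pair partition is compatible
  with them, and both quantities are the indicator of the equations for the components. The remaining
  block indices number \<open>O(N\<close> to the power \<open>(p + 1) div 2)\<close>. For odd \<open>p\<close> there are no pair partitions
  and the main term is zero.\<close>

lemma expected_trace_main_term:
  assumes m: "1 \<le> m" and p: "0 < p" and fin: "finite (pair_partitions p)"
  shows "\<exists>K. \<forall>N\<ge>1. \<bar>expectation (toeplitz_trace m N p) -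
    (\<Sum>\<pi>\<in>pair_partitions p. real (card (paired_components p \<pi> m)) * real (card (paired_blocks p \<pi> N)))\<bar>
    \<le> K * real N ^ ((p + 1) div 2)"
proof -
  let ?PP = "pair_partitions p"
  define C where "C = centered_family.product_bound (entry_moment m) p + real (card ?PP)"
  define K where "K = real (m ^ p) * C * real (p ^ p * 3 ^ p)"
  have "\<bar>expectation (toeplitz_trace m N p) -
    (\<Sum>\<pi>\<in>?PP. real (card (paired_components p \<pi> m)) * real (card (paired_blocks p \<pi> N)))\<bar>
    \<le> K * real N ^ ((p + 1) div 2)" if N: "1 \<le> N" for N
  proof -
    interpret cf: centered_family M "entry m N" "independent_keys m N" "entry_moment m"
      by (rule centered_family_entry[OF m])
    let ?A = "{..<p} \<rightarrow>\<^sub>E {..<N}" and ?B = "{..<p} \<rightarrow>\<^sub>E {..<m}"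
    let ?Bad = "{i \<in> ?A. matched_word p i \<and> \<not> paired_word p i}"
    have finA: "finite ?A" and finB: "finite ?B" by (intro finite_PiE; simp)+
    have C0: "0 \<le> C" unfolding C_def using cf.product_bound_ge_1[of p] by simp
    \<comment> \<open>The share of a word in the main term; the word is given by its block indices \<open>i\<close> and components \<open>t\<close>.\<close>
    define g where "g i t = (\<Sum>\<pi>\<in>?PP. of_bool (i \<in> paired_blocks p \<pi> N) * of_bool (t \<in> paired_components p \<pi> m) :: real)" for i t
    define h where "h i t = word_mean m N p (combine_word m p i t)" for i t
    have E: "expectation (toeplitz_trace m N p) = (\<Sum>i\<in>?A. \<Sum>t\<in>?B. h i t)"
      unfolding expectation_toeplitz_trace(2)[OF m p] h_def by (rule sum_words) (use m in simp)
    have G: "(\<Sum>\<pi>\<in>?PP. real (card (paired_components p \<pi> m)) * real (card (paired_blocks p \<pi> N))) =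
        (\<Sum>i\<in>?A. \<Sum>t\<in>?B. g i t)"
    proof -
      have card_eq: "real (card S) = (\<Sum>x\<in>X. of_bool (x \<in> S))" if "finite X" "S \<subseteq> X" for S X :: "(nat \<Rightarrow> nat) set"
      proof -
        have "{x \<in> X. x \<in> S} = S" using that by auto
        then show ?thesis using that by (simp add: of_bool_def sum.If_cases Int_def)
      qed
      have "(\<Sum>i\<in>?A. \<Sum>t\<in>?B. g i t) = (\<Sum>\<pi>\<in>?PP. \<Sum>i\<in>?A. \<Sum>t\<in>?B.
          of_bool (i \<in> paired_blocks p \<pi> N) * of_bool (t \<in> paired_components p \<pi> m))"
      proof -
        have "(\<Sum>t\<in>?B. g i t) = (\<Sum>\<pi>\<in>?PP. \<Sum>t\<in>?B.
            of_bool (i \<in> paired_blocks p \<pi> N) * of_bool (t \<in> paired_components p \<pi> m))" for i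
          unfolding g_def by (rule sum.swap)
        then show ?thesis by (simp only:) (rule sum.swap)
      qed
      also have "\<dots> = (\<Sum>\<pi>\<in>?PP. (\<Sum>i\<in>?A. of_bool (i \<in> paired_blocks p \<pi> N)) * (\<Sum>t\<in>?B. of_bool (t \<in> paired_components p \<pi> m)))"
        by (simp only: sum_product)
      also have "\<dots> = (\<Sum>\<pi>\<in>?PP. real (card (paired_components p \<pi> m)) * real (card (paired_blocks p \<pi> N)))"
      proof (rule sum.cong[OF refl])
        fix \<pi>
        have 1: "paired_blocks p \<pi> N \<subseteq> ?A" "paired_components p \<pi> m \<subseteq> ?B"
          unfolding paired_blocks_def paired_components_def by blast+
        show "(\<Sum>i\<in>?A. of_bool (i \<in> paired_blocks p \<pi> N)) * (\<Sum>t\<in>?B. of_bool (t \<in> paired_components p \<pi> m)) =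
            real (card (paired_components p \<pi> m)) * real (card (paired_blocks p \<pi> N))"
          unfolding card_eq[OF finA 1(1)] card_eq[OF finB 1(2)] by (rule mult.commute)
      qed
      finally show ?thesis by simp
    qed
    have pr: "partner \<pi> (Suc q) - 1 < p" "partner \<pi> (Suc q) - 1 \<noteq> q" "Suc (partner \<pi> (Suc q) - 1) = partner \<pi> (Suc q)"
      if "\<pi> \<in> ?PP" "q < p" for \<pi> q
    proof -
      have "Suc q \<in> {1..p}" using that by simp
      note b = pair_partition_block(4,5)[OF that(1) this]
      then have "1 \<le> partner \<pi> (Suc q)" "partner \<pi> (Suc q) \<le> p" "partner \<pi> (Suc q) \<noteq> Suc q" by auto
      then show "partner \<pi> (Suc q) - 1 < p" "partner \<pi> (Suc q) - 1 \<noteq> q" "Suc (partner \<pi> (Suc q) - 1) = partner \<pi> (Suc q)"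
        by linarith+
    qed
    have good: "h i t = g i t" if i: "i \<in> ?A - ?Bad" and t: "t \<in> ?B" for i t
    proof -
      have iA: "i \<in> ?A" using i by blast
      consider (unmatched) "\<not> matched_word p i" | (paired) "paired_word p i" using i by blast
      then show ?thesis
      proof cases
        case unmatched
        then obtain q where q: "q < p" "\<And>q'. q' < p \<Longrightarrow> q' \<noteq> q \<Longrightarrow> \<bar>step_difference p i q'\<bar> \<noteq> \<bar>step_difference p i q\<bar>"
          unfolding matched_word_def by blast
        have "h i t = 0"
          unfolding h_def
        proof (rule word_mean_unmatched[OF m iA t q(1)])
          fix q' assume q': "q' < p" "q' \<noteq> q"
          show "entry_key (step_difference p i q', t q', t (Suc q' mod p)) \<noteq> entry_key (step_difference p i q, t q, t (Suc q mod p))"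
          proof
            assume "entry_key (step_difference p i q', t q', t (Suc q' mod p)) = entry_key (step_difference p i q, t q, t (Suc q mod p))"
            from arg_cong[OF this, of fst] show False using q(2)[OF q'] unfolding fst_entry_key by contradiction
          qed
        qed
        moreover have "i \<notin> paired_blocks p \<pi> N" if "\<pi> \<in> ?PP" for \<pi>
        proof
          assume "i \<in> paired_blocks p \<pi> N"
          then have "step_difference p i (partner \<pi> (Suc q) - 1) = - step_difference p i q"
            using q(1) unfolding paired_blocks_def by blast
          then show False using q(2)[OF pr(1,2)[OF that q(1)]] by simp
        qed
        then have "g i t = 0" unfolding g_def by (intro sum.neutral ballI) simp
        ultimately show ?thesis by simp
      next
        case paired
        obtain \<pi>0 f where \<pi>0: "\<pi>0 \<in> ?PP" and f: "\<And>q. q < p \<Longrightarrow> opposite_step p i q (f q)"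
          "\<And>q. q < p \<Longrightarrow> partner \<pi>0 (Suc q) = Suc (f q)" "\<And>q. q < p \<Longrightarrow> f (f q) = q"
          by (rule paired_word_partition[OF paired]) (rule that)
        have nz: "step_difference p i q \<noteq> 0" if "q < p" for q using paired that unfolding paired_word_def by blast
        have "h i t = of_bool (\<forall>q<p. t q = t (Suc (f q) mod p))"
          unfolding h_def by (rule word_mean_paired[OF m iA t nz f(1,3)])
        also have "(\<forall>q<p. t q = t (Suc (f q) mod p)) \<longleftrightarrow> t \<in> paired_components p \<pi>0 m"
          unfolding paired_components_def using t f(2) by simp
        finally have H: "h i t = of_bool (t \<in> paired_components p \<pi>0 m)" .
        have in_iff: "i \<in> paired_blocks p \<pi> N \<longleftrightarrow> \<pi> = \<pi>0" if \<pi>: "\<pi> \<in> ?PP" for \<pi>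
        proof
          assume ib: "i \<in> paired_blocks p \<pi> N"
          show "\<pi> = \<pi>0"
          proof (rule pair_partition_eqI[OF \<pi> \<pi>0])
            fix x assume "x \<in> {1..p}"
            then obtain q where q: "x = Suc q" "q < p" by (cases x) auto
            have "step_difference p i (partner \<pi> (Suc q) - 1) = - step_difference p i q"
              using ib q(2) unfolding paired_blocks_def by blast
            then have "partner \<pi> (Suc q) - 1 = f q"
              using f(1)[OF q(2)] pr(1,2)[OF \<pi> q(2)] unfolding opposite_step_def by force
            then show "partner \<pi> x = partner \<pi>0 x" using pr(3)[OF \<pi> q(2)] f(2)[OF q(2)] q(1) by simp
          qed
        next
          assume "\<pi> = \<pi>0"
          then show "i \<in> paired_blocks p \<pi> N"
            unfolding paired_blocks_def using iA f(1,2) by (simp add: opposite_step_def)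
        qed
        have "g i t = (\<Sum>\<pi>\<in>?PP. if \<pi> = \<pi>0 then of_bool (t \<in> paired_components p \<pi>0 m) else 0)"
          unfolding g_def by (rule sum.cong[OF refl]) (simp add: in_iff)
        also have "\<dots> = h i t" using fin \<pi>0 H by simp
        finally show ?thesis by simp
      qed
    qed
    have bad: "\<bar>h i t - g i t\<bar> \<le> C" if i: "i \<in> ?A" and t: "t \<in> ?B" for i t
    proof -
      have "\<bar>g i t\<bar> \<le> (\<Sum>\<pi>\<in>?PP. \<bar>of_bool (i \<in> paired_blocks p \<pi> N) * of_bool (t \<in> paired_components p \<pi> m)\<bar>)"
        unfolding g_def by (rule sum_abs)
      also have "\<dots> \<le> (\<Sum>\<pi>\<in>?PP. 1)" by (intro sum_mono) simp
      finally have "\<bar>g i t\<bar> \<le> real (card ?PP)" by simp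
      moreover have "\<bar>h i t\<bar> \<le> centered_family.product_bound (entry_moment m) p"
        unfolding h_def by (rule word_mean_bound[OF m i t])
      ultimately show ?thesis unfolding C_def by linarith
    qed
    have "\<bar>(\<Sum>i\<in>?A. \<Sum>t\<in>?B. h i t) - (\<Sum>i\<in>?A. \<Sum>t\<in>?B. g i t)\<bar> = \<bar>\<Sum>i\<in>?A. \<Sum>t\<in>?B. h i t - g i t\<bar>"
      by (simp add: sum_subtractf)
    also have "(\<Sum>i\<in>?A. \<Sum>t\<in>?B. h i t - g i t) = (\<Sum>i\<in>?Bad. \<Sum>t\<in>?B. h i t - g i t)"
    proof (rule sum.mono_neutral_right[OF finA])
      show "\<forall>i\<in>?A - ?Bad. (\<Sum>t\<in>?B. h i t - g i t) = 0"
        using good by (intro ballI sum.neutral) simp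
    qed blast
    also have "\<bar>\<dots>\<bar> \<le> (\<Sum>i\<in>?Bad. \<Sum>t\<in>?B. C)"
    proof (rule order_trans[OF sum_abs], rule sum_mono)
      fix i assume "i \<in> ?Bad"
      then have i: "i \<in> ?A" by blast
      show "\<bar>\<Sum>t\<in>?B. h i t - g i t\<bar> \<le> (\<Sum>t\<in>?B. C)"
        by (rule order_trans[OF sum_abs], rule sum_mono) (rule bad[OF i])
    qed
    also have "\<dots> = real (card ?Bad) * (real (m ^ p) * C)" by (simp add: card_PiE)
    also have "\<dots> \<le> real (p ^ p * 3 ^ p * N ^ ((p + 1) div 2)) * (real (m ^ p) * C)"
      using card_matched_unpaired_words[OF p, of N] N C0 by (intro mult_right_mono of_nat_mono) auto
    also have "\<dots> = K * real N ^ ((p + 1) div 2)" unfolding K_def by simp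
    finally show ?thesis unfolding E G .
  qed
  then show ?thesis by blast
qed

end

section \<open>Lattice points and volumes\<close>

abbreviation lebesgue_power :: "'i set \<Rightarrow> ('i \<Rightarrow> real) measure" where
  "lebesgue_power I \<equiv> \<Pi>\<^sub>M l\<in>I. lborel"

text \<open>By Fubini, as each line in a direction with nonzero coefficient meets the hyperplane in one point.\<close>

lemma AE_not_in_hyperplane:
  fixes \<alpha> :: "'i \<Rightarrow> real"
  assumes I: "finite I" "l \<in> I" "\<alpha> l \<noteq> 0"
  shows "AE x in lebesgue_power I. (\<Sum>i\<in>I. \<alpha> i * x i) \<noteq> c"
proof -
  interpret product_sigma_finite "\<lambda>_::'i. lborel :: real measure" by standard
  define I' where "I' = I - {l}"
  have I': "finite I'" "l \<notin> I'" "I = insert l I'" using I by (auto simp: I'_def)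
  define A where "A = {x \<in> space (lebesgue_power I). (\<Sum>i\<in>I. \<alpha> i * x i) = c}"
  have [measurable]: "A \<in> sets (lebesgue_power I)" unfolding A_def by measurable
  have "emeasure (lebesgue_power I) A = (\<integral>\<^sup>+x. indicator A x \<partial>lebesgue_power (insert l I'))"
    unfolding I'(3)[symmetric] by simp
  also have "\<dots> = (\<integral>\<^sup>+x. (\<integral>\<^sup>+y. indicator A (x(l := y)) \<partial>lborel) \<partial>lebesgue_power I')"
    by (rule product_nn_integral_insert[OF I'(1,2)]) (simp add: I'(3)[symmetric])
  also have "\<dots> = (\<integral>\<^sup>+x. 0 \<partial>lebesgue_power I')"
  proof (rule nn_integral_cong)
    fix x :: "'i \<Rightarrow> real"
    define d where "d = (c - (\<Sum>i\<in>I'. \<alpha> i * x i)) / \<alpha> l"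
    have "indicator A (x(l := y)) \<le> (indicator {d} y :: ennreal)" for y
    proof (cases "x(l := y) \<in> A")
      case True
      have "(\<Sum>i\<in>I'. \<alpha> i * (x(l := y)) i) = (\<Sum>i\<in>I'. \<alpha> i * x i)"
        using I'(2) by (intro sum.cong) auto
      then have "\<alpha> l * y + (\<Sum>i\<in>I'. \<alpha> i * x i) = c"
        using True I' unfolding A_def by simp
      then have "y = d" using I(3) by (simp add: d_def field_simps)
      then show ?thesis by (simp add: indicator_def)
    qed simp
    then have "(\<integral>\<^sup>+y. indicator A (x(l := y)) \<partial>lborel) \<le> (\<integral>\<^sup>+y. indicator {d} y \<partial>lborel)"
      by (rule nn_integral_mono)
    then show "(\<integral>\<^sup>+y. indicator A (x(l := y)) \<partial>lborel) = 0" by simp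
  qed
  finally have "emeasure (lebesgue_power I) A = 0" by simp
  then show ?thesis by (intro AE_I[of _ _ A]) (auto simp: A_def)
qed

lemma floor_scaled_tendsto:
  "(\<lambda>N. real_of_int \<lfloor>real N * x\<rfloor> / real N) \<longlonglongrightarrow> x"
proof (rule tendsto_sandwich)
  show "\<forall>\<^sub>F N in sequentially. x - 1 / real N \<le> real_of_int \<lfloor>real N * x\<rfloor> / real N"
    unfolding eventually_sequentially
  proof (intro exI allI impI)
    fix N :: nat assume N: "1 \<le> N"
    have "x - 1 / real N = (real N * x - 1) / real N" using N by (simp add: field_simps)
    also have "\<dots> \<le> real_of_int \<lfloor>real N * x\<rfloor> / real N" by (intro divide_right_mono) linarith+
    finally show "x - 1 / real N \<le> real_of_int \<lfloor>real N * x\<rfloor> / real N" .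
  qed
  show "\<forall>\<^sub>F N in sequentially. real_of_int \<lfloor>real N * x\<rfloor> / real N \<le> x"
    unfolding eventually_sequentially
  proof (intro exI allI impI)
    fix N :: nat assume N: "1 \<le> N"
    have "real_of_int \<lfloor>real N * x\<rfloor> / real N \<le> (real N * x) / real N" by (intro divide_right_mono) linarith+
    then show "real_of_int \<lfloor>real N * x\<rfloor> / real N \<le> x" using N by simp
  qed
  show "(\<lambda>N. x - 1 / real N) \<longlonglongrightarrow> x" by real_asymp
qed auto

lemma in_cube_iff_floor:
  assumes "0 < N"
  shows "x \<in> {real_of_int z / real N..<(real_of_int z + 1) / real N} \<longleftrightarrow> z = \<lfloor>real N * x\<rfloor>"
proof -
  have "x \<in> {real_of_int z / real N..<(real_of_int z + 1) / real N} \<longleftrightarrow>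
      real_of_int z \<le> real N * x \<and> real N * x < real_of_int z + 1"
    using assms by (auto simp: field_simps)
  also have "\<dots> \<longleftrightarrow> z = \<lfloor>real N * x\<rfloor>" by linarith
  finally show ?thesis .
qed

lemma prod_of_bool:
  assumes "finite A"
  shows "(\<Prod>x\<in>A. of_bool (Q x) :: 'a :: comm_semiring_1) = of_bool (\<forall>x\<in>A. Q x)"
  using assms by (induction A rule: finite_induct) auto

text \<open>The unit cubes at the lattice points, scaled by \<open>1/N\<close>, make the normalised count the integral of an
  indicator function. It converges to the indicator of the polytope off the bounding hyperplanes, and
  the common bounding box gives a dominating function. The family \<open>Z\<close> is only required to lie between
  the open and the closed dilated polytope, because boundary points do not affect the limit.\<close>

lemma lattice_points_tendsto_volume:
  fixes Z :: "nat \<Rightarrow> ('i \<Rightarrow> int) set" and \<alpha> :: "'s \<Rightarrow> 'i \<Rightarrow> real" and lo hi :: "'s \<Rightarrow> real"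
  assumes I: "finite I" "I \<noteq> {}" and F: "finite F"
    and nontrivial: "\<And>s. s \<in> F \<Longrightarrow> \<exists>l\<in>I. \<alpha> s l \<noteq> 0"
    and box: "\<And>N. Z N \<subseteq> I \<rightarrow>\<^sub>E {- int N..int N}"
    and outer: "\<And>N y s. y \<in> Z N \<Longrightarrow> s \<in> F \<Longrightarrow>
      lo s * real N \<le> (\<Sum>l\<in>I. \<alpha> s l * real_of_int (y l)) \<and> (\<Sum>l\<in>I. \<alpha> s l * real_of_int (y l)) \<le> hi s * real N"
    and inner: "\<And>N y. 0 < N \<Longrightarrow> y \<in> I \<rightarrow>\<^sub>E UNIV \<Longrightarrow> (\<And>s. s \<in> F \<Longrightarrow>
      lo s * real N < (\<Sum>l\<in>I. \<alpha> s l * real_of_int (y l)) \<and> (\<Sum>l\<in>I. \<alpha> s l * real_of_int (y l)) < hi s * real N) \<Longrightarrow> y \<in> Z N"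
  shows "(\<lambda>N. real (card (Z N)) / real N ^ card I) \<longlonglongrightarrow>
    (\<integral>x. of_bool (\<forall>s\<in>F. lo s \<le> (\<Sum>l\<in>I. \<alpha> s l * x l) \<and> (\<Sum>l\<in>I. \<alpha> s l * x l) \<le> hi s) \<partial>lebesgue_power I)"
proof -
  interpret product_sigma_finite "\<lambda>_::'i. lborel :: real measure" by standard
  let ?M = "lebesgue_power I"
  define \<phi> where "\<phi> s x = (\<Sum>l\<in>I. \<alpha> s l * x l)" for s and x :: "'i \<Rightarrow> real"
  define P where "P x \<longleftrightarrow> (\<forall>s\<in>F. lo s \<le> \<phi> s x \<and> \<phi> s x \<le> hi s)" for x
  define cube where "cube N z = {real_of_int z / real N..<(real_of_int z + 1) / real N}" for N z
  define g where "g N x = (\<Sum>z\<in>Z N. \<Prod>l\<in>I. indicator (cube N (z l)) (x l) :: real)" for N and x :: "'i \<Rightarrow> real"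
  define fl where "fl N x = (\<lambda>l\<in>I. \<lfloor>real N * x l\<rfloor>)" for N and x :: "'i \<Rightarrow> real"
  have finZ: "finite (Z N)" for N
    using box by (rule finite_subset[OF _ finite_PiE]) (use I(1) in auto)
  have g_eq: "g N x = of_bool (fl N x \<in> Z N)" if N: "0 < N" for N x
  proof -
    have "(\<Prod>l\<in>I. indicator (cube N (z l)) (x l) :: real) = of_bool (z = fl N x)" if z: "z \<in> Z N" for z
    proof -
      have "(\<Prod>l\<in>I. indicator (cube N (z l)) (x l) :: real) = (\<Prod>l\<in>I. of_bool (z l = \<lfloor>real N * x l\<rfloor>))"
        unfolding cube_def indicator_def using in_cube_iff_floor[OF N] by (intro prod.cong) auto
      also have "\<dots> = of_bool (\<forall>l\<in>I. z l = \<lfloor>real N * x l\<rfloor>)"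
        by (rule prod_of_bool[OF I(1)])
      also have "(\<forall>l\<in>I. z l = \<lfloor>real N * x l\<rfloor>) \<longleftrightarrow> z = fl N x"
      proof
        assume "\<forall>l\<in>I. z l = \<lfloor>real N * x l\<rfloor>"
        moreover have "z \<in> extensional I" using subsetD[OF box z] by (simp add: PiE_iff)
        ultimately show "z = fl N x" by (intro extensionalityI[of _ I]) (auto simp: fl_def)
      qed (simp add: fl_def)
      finally show ?thesis .
    qed
    then have "g N x = (\<Sum>z\<in>Z N. if z = fl N x then 1 else 0)"
      unfolding g_def by (intro sum.cong) auto
    then show ?thesis using finZ by simp
  qed
  have int_cube: "integrable lborel (indicator (cube N z) :: real \<Rightarrow> real)" for N z
    unfolding cube_def
    by (rule integrable_real_indicator) (simp_all add: emeasure_lborel_Ico divide_right_mono)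
  have int_prod: "integrable ?M (\<lambda>x. \<Prod>l\<in>I. indicator (cube N (z l)) (x l) :: real)" for N z
    by (rule product_integrable_prod[OF I(1), where f = "\<lambda>l. indicator (cube N (z l))"]) (rule int_cube)
  have val: "(\<integral>x. (\<Prod>l\<in>I. indicator (cube N (z l)) (x l)) \<partial>?M) = (1 / real N) ^ card I" if N: "0 < N" for N z
  proof -
    have "(\<integral>x. (\<Prod>l\<in>I. indicator (cube N (z l)) (x l) :: real) \<partial>?M) = (\<Prod>l\<in>I. \<integral>x. indicator (cube N (z l)) x \<partial>lborel)"
      by (rule product_integral_prod[OF I(1), where f = "\<lambda>l. indicator (cube N (z l))"]) (rule int_cube)
    also have "\<dots> = (\<Prod>l\<in>I. 1 / real N)"
      using N by (intro prod.cong) (auto simp: cube_def field_simps measure_def divide_right_mono)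
    finally show ?thesis by simp
  qed
  have lim: "(\<lambda>N. integral\<^sup>L ?M (g N)) \<longlonglongrightarrow> integral\<^sup>L ?M (\<lambda>x. of_bool (P x))"
  proof (rule integral_dominated_convergence[where w = "\<lambda>x. \<Prod>l\<in>I. indicator {- 2..2} (x l)"])
    show "(\<lambda>x. of_bool (P x) :: real) \<in> borel_measurable ?M"
    proof -
      have eq: "(\<lambda>x. of_bool (P x)) = (\<lambda>x. \<Prod>s\<in>F. indicator {lo s..hi s} (\<phi> s x) :: real)"
        unfolding P_def indicator_def atLeastAtMost_iff by (intro ext) (rule prod_of_bool[OF F, symmetric])
      have [measurable]: "\<phi> s \<in> borel_measurable ?M" for s unfolding \<phi>_def[abs_def] by measurable
      show ?thesis unfolding eq by (intro borel_measurable_prod) measurable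
    qed
    show "g N \<in> borel_measurable ?M" for N
      using int_prod unfolding g_def[abs_def] by (intro borel_measurable_sum) auto
    show "integrable ?M (\<lambda>x. \<Prod>l\<in>I. indicator {- 2..2} (x l) :: real)"
      by (rule product_integrable_prod[OF I(1)]) simp
    have "AE x in ?M. \<forall>s\<in>F. \<phi> s x \<noteq> lo s \<and> \<phi> s x \<noteq> hi s"
    proof (subst AE_finite_all[OF F], rule ballI)
      fix s assume "s \<in> F"
      then obtain l where l: "l \<in> I" "\<alpha> s l \<noteq> 0" using nontrivial by blast
      show "AE x in ?M. \<phi> s x \<noteq> lo s \<and> \<phi> s x \<noteq> hi s"
        using AE_not_in_hyperplane[of I l "\<alpha> s", OF I(1) l, of "lo s"]
          AE_not_in_hyperplane[of I l "\<alpha> s", OF I(1) l, of "hi s"]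
        unfolding \<phi>_def by eventually_elim blast
    qed
    then show "AE x in ?M. (\<lambda>N. g N x) \<longlonglongrightarrow> of_bool (P x)"
    proof eventually_elim
      case (elim x)
      define y where "y N l = real_of_int (fl N x l) / real N" for N l
      have "(\<lambda>N. y N l) \<longlonglongrightarrow> x l" if "l \<in> I" for l
        using floor_scaled_tendsto[of "x l"] that by (simp add: y_def fl_def)
      then have conv: "(\<lambda>N. \<phi> s (y N)) \<longlonglongrightarrow> \<phi> s x" for s
        unfolding \<phi>_def by (intro tendsto_sum tendsto_mult_left) auto
      have scale: "(\<Sum>l\<in>I. \<alpha> s l * real_of_int (fl N x l)) = \<phi> s (y N) * real N" if "0 < N" for s N
        using that by (simp add: \<phi>_def y_def sum_distrib_right)
      have pos: "\<forall>\<^sub>F N::nat in sequentially. 0 < N" by (rule eventually_gt_at_top)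
      show ?case
      proof (cases "P x")
        case True
        have "\<forall>\<^sub>F N in sequentially. \<forall>s\<in>F. lo s < \<phi> s (y N) \<and> \<phi> s (y N) < hi s"
        proof (intro eventually_ball_finite F ballI eventually_conj)
          fix s assume s: "s \<in> F"
          have "lo s < \<phi> s x" "\<phi> s x < hi s" using True elim s unfolding P_def by force+
          then show "\<forall>\<^sub>F N in sequentially. lo s < \<phi> s (y N)" "\<forall>\<^sub>F N in sequentially. \<phi> s (y N) < hi s"
            using order_tendstoD[OF conv[of s]] by auto
        qed
        with pos have "\<forall>\<^sub>F N in sequentially. g N x = of_bool (P x)"
        proof eventually_elim
          case (elim N)
          have "fl N x \<in> Z N"
          proof (rule inner[OF elim(1)])
            show "fl N x \<in> I \<rightarrow>\<^sub>E UNIV" by (simp add: fl_def)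
            show "lo s * real N < (\<Sum>l\<in>I. \<alpha> s l * real_of_int (fl N x l)) \<and>
                (\<Sum>l\<in>I. \<alpha> s l * real_of_int (fl N x l)) < hi s * real N" if "s \<in> F" for s
              unfolding scale[OF elim(1)] using elim that by simp
          qed
          then show ?case using True g_eq[OF elim(1)] by simp
        qed
        then show ?thesis by (rule tendsto_eventually)
      next
        case False
        then obtain s where s: "s \<in> F" "\<phi> s x < lo s \<or> hi s < \<phi> s x" unfolding P_def by force
        have "\<forall>\<^sub>F N in sequentially. \<phi> s (y N) < lo s \<or> hi s < \<phi> s (y N)"
          using s(2)
        proof
          assume "\<phi> s x < lo s"
          from order_tendstoD(2)[OF conv this] show ?thesis by (rule eventually_mono) simp
        next
          assume "hi s < \<phi> s x"
          from order_tendstoD(1)[OF conv this] show ?thesis by (rule eventually_mono) simp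
        qed
        with pos have "\<forall>\<^sub>F N in sequentially. g N x = of_bool (P x)"
        proof eventually_elim
          case (elim N)
          have "fl N x \<notin> Z N"
          proof
            assume "fl N x \<in> Z N"
            from outer[OF this s(1)] have "lo s * real N \<le> \<phi> s (y N) * real N" "\<phi> s (y N) * real N \<le> hi s * real N"
              unfolding scale[OF elim(1)] by auto
            then have "lo s \<le> \<phi> s (y N)" "\<phi> s (y N) \<le> hi s" using elim(1) by auto
            then show False using elim(2) by linarith
          qed
          then show ?case using False g_eq[OF elim(1)] by simp
        qed
        then show ?thesis by (rule tendsto_eventually)
      qed
    qed
    show "AE x in ?M. norm (g N x) \<le> (\<Prod>l\<in>I. indicator {- 2..2} (x l))" for N
    proof (rule always_eventually, rule allI)
      fix x :: "'i \<Rightarrow> real"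
      show "norm (g N x) \<le> (\<Prod>l\<in>I. indicator {- 2..2} (x l))"
      proof (cases "0 < N \<and> fl N x \<in> Z N")
        case True
        have "x l \<in> {- 2..2}" if l: "l \<in> I" for l
        proof -
          have "fl N x l \<in> {- int N..int N}" using PiE_mem[OF subsetD[OF box[of N]] l] True by blast
          then have "- real N \<le> real_of_int \<lfloor>real N * x l\<rfloor>" "real_of_int \<lfloor>real N * x l\<rfloor> \<le> real N"
            using l by (auto simp: fl_def)
          then have "- real N \<le> real N * x l" "real N * x l \<le> real N + 1" by linarith+
          moreover have "1 \<le> real N" using True by simp
          \<comment> \<open>The cubes at lattice points of the box \<open>[-N, N]\<close> cover \<open>[-1, 1 + 1/N]\<close> in each coordinate.\<close>
          ultimately have "real N * (- 2) \<le> real N * x l" "real N * x l \<le> real N * 2" by linarith+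
          moreover have "0 < real N" using True by simp
          ultimately have "- 2 \<le> x l" "x l \<le> 2" using mult_left_le_imp_le by blast+
          then show ?thesis by simp
        qed
        then have "(\<Prod>l\<in>I. indicator {- 2..2} (x l) :: real) = 1" by (intro prod.neutral) auto
        then show ?thesis using True g_eq[of N x] by simp
      next
        case False
        have "g N x = 0"
        proof (cases "0 < N")
          case True then show ?thesis using False g_eq[of N x] by simp
        next
          case N: False
          show ?thesis unfolding g_def cube_def using N I by (intro sum.neutral ballI) (auto simp: prod_zero_iff)
        qed
        then show ?thesis by (simp add: prod_nonneg)
      qed
    qed
  qed
  have vol: "integral\<^sup>L ?M (g N) = real (card (Z N)) / real N ^ card I" if "0 < N" for N
    unfolding g_def using int_prod val[OF that]
    by (subst Bochner_Integration.integral_sum) (simp_all add: power_one_over divide_inverse power_inverse)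
  have "\<forall>\<^sub>F N in sequentially. integral\<^sup>L ?M (g N) = real (card (Z N)) / real N ^ card I"
    by (rule eventually_mono[OF eventually_gt_at_top[of 0] vol])
  from Lim_transform_eventually[OF lim this] show ?thesis unfolding P_def \<phi>_def .
qed

section \<open>The moment integral of a pair partition\<close>

text \<open>The sign of a letter as an integer, because lattice paths have integer values.\<close>

definition block_sign :: "nat set set \<Rightarrow> nat \<Rightarrow> int" where
  "block_sign \<pi> q = (if q < partner \<pi> q then 1 else - 1)"

text \<open>The form whose values at \<open>j = 1, \<dots>, 2k\<close> occur in the moment integral, on integer arguments.\<close>

definition lattice_path :: "nat set set \<Rightarrow> (nat \<Rightarrow> int) \<Rightarrow> nat \<Rightarrow> int" where
  "lattice_path \<pi> y j = y 0 + (\<Sum>q=1..j. block_sign \<pi> q * y (block_label \<pi> q))"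

definition lattice_paths :: "nat \<Rightarrow> nat set set \<Rightarrow> nat \<Rightarrow> (nat \<Rightarrow> int) set" where
  "lattice_paths k \<pi> N = {y \<in> {0..k} \<rightarrow>\<^sub>E UNIV. y 0 \<in> {0..<int N} \<and> (\<forall>l\<in>{1..k}. \<bar>y l\<bar> \<le> int N) \<and>
     (\<forall>j\<in>{1..2 * k}. lattice_path \<pi> y j \<in> {0..<int N})}"

lemma lattice_paths_box: "lattice_paths k \<pi> N \<subseteq> {0..k} \<rightarrow>\<^sub>E {- int N..int N}"
proof
  fix y assume y: "y \<in> lattice_paths k \<pi> N"
  have "y l \<in> {- int N..int N}" if "l \<in> {0..k}" for l
  proof (cases "l = 0")
    case True
    have "y 0 \<in> {0..<int N}" using y unfolding lattice_paths_def by blast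
    then show ?thesis using True by simp
  next
    case False
    then have "l \<in> {1..k}" using that by simp
    then have "\<bar>y l\<bar> \<le> int N" using y unfolding lattice_paths_def by blast
    then show ?thesis unfolding atLeastAtMost_iff by linarith
  qed
  moreover have "y \<in> {0..k} \<rightarrow>\<^sub>E UNIV" using y unfolding lattice_paths_def by blast
  ultimately show "y \<in> {0..k} \<rightarrow>\<^sub>E {- int N..int N}" by (simp add: PiE_iff)
qed

lemma block_sign_properties:
  assumes \<pi>: "\<pi> \<in> pair_partitions n" and q: "q \<in> {1..n}"
  shows "block_sign \<pi> (partner \<pi> q) = - block_sign \<pi> q" "pair_sign \<pi> q = real_of_int (block_sign \<pi> q)"
  using pair_partition_partner(1,4)[OF \<pi> q] pair_partition_block(4)[OF \<pi> q] by (auto simp: block_sign_def)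

lemma lattice_path_Suc:
  "lattice_path \<pi> y (Suc j) = lattice_path \<pi> y j + block_sign \<pi> (Suc j) * y (block_label \<pi> (Suc j))"
  by (simp add: lattice_path_def)

text \<open>The two letters of a block have the same label and opposite signs.\<close>

lemma lattice_path_closes:
  assumes \<pi>: "\<pi> \<in> pair_partitions n"
  shows "lattice_path \<pi> y n = y 0"
proof -
  let ?g = "\<lambda>q. block_sign \<pi> q * y (block_label \<pi> q)"
  have "(\<Sum>q=1..n. ?g q) = (\<Sum>q=1..n. - ?g q)"
  proof (rule sum.reindex_bij_witness[where i = "partner \<pi>" and j = "partner \<pi>"])
    fix q assume q: "q \<in> {1..n}"
    show "partner \<pi> (partner \<pi> q) = q" by (rule pair_partition_partner(1)[OF \<pi> q])
    show "partner \<pi> (partner \<pi> q) = q" by (rule pair_partition_partner(1)[OF \<pi> q])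
    show "partner \<pi> q \<in> {1..n}" by (rule pair_partition_block(5)[OF \<pi> q])
    show "partner \<pi> q \<in> {1..n}" by (rule pair_partition_block(5)[OF \<pi> q])
    show "- ?g (partner \<pi> q) = ?g q"
      using pair_partition_partner(3)[OF \<pi> q] block_sign_properties(1)[OF \<pi> q] by simp
  qed
  then have "(\<Sum>q=1..n. ?g q) = 0" by (simp add: sum_negf)
  then show ?thesis by (simp add: lattice_path_def)
qed

text \<open>The coordinate \<open>y 0\<close> is the first block index, and \<open>y l\<close> is minus the increment at the smaller letter
  of the block with label \<open>l\<close>; conversely the path through the values \<open>lattice_path \<pi> y j\<close> recovers the
  circuit.\<close>

lemma card_paired_blocks:
  assumes k: "1 \<le> k" and \<pi>: "\<pi> \<in> pair_partitions (2 * k)"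
  shows "card (paired_blocks (2 * k) \<pi> N) = card (lattice_paths k \<pi> N)"
proof -
  let ?p = "2 * k"
  have p: "0 < ?p" using k by simp
  \<comment> \<open>The smaller letter of the block with label \<open>l\<close>, numbered from \<open>1\<close>.\<close>
  define pos where "pos l = (SOME q. q \<in> {1..?p} \<and> block_label \<pi> q = l \<and> pair_sign \<pi> q = 1)" for l
  have pos: "pos l \<in> {1..?p}" "block_label \<pi> (pos l) = l" "block_sign \<pi> (pos l) = 1" if l: "l \<in> {1..k}" for l
  proof -
    have "\<exists>q. q \<in> {1..?p} \<and> block_label \<pi> q = l \<and> pair_sign \<pi> q = 1"
      using block_label_properties(3)[OF \<pi> l] by (simp only: Bex_def)
    from someI_ex[OF this] have *: "pos l \<in> {1..?p}" "block_label \<pi> (pos l) = l" "pair_sign \<pi> (pos l) = 1"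
      unfolding pos_def by blast+
    then show "pos l \<in> {1..?p}" "block_label \<pi> (pos l) = l" by auto
    show "block_sign \<pi> (pos l) = 1" using block_sign_properties(2)[OF \<pi> *(1)] *(3) by simp
  qed
  define \<Phi> where "\<Phi> y = (\<lambda>j\<in>{..<?p}. nat (lattice_path \<pi> y j))" for y
  define \<Psi> where "\<Psi> i = (\<lambda>l\<in>{0..k}. if l = 0 then int (i 0) else - step_difference ?p i (pos l - 1))" for i
  have path0: "lattice_path \<pi> y 0 = y 0" for y by (simp add: lattice_path_def)
  have path_range: "0 \<le> lattice_path \<pi> y j" "lattice_path \<pi> y j < int N"
    if "y \<in> lattice_paths k \<pi> N" "j \<le> ?p" for y j
    using that path0[of y] unfolding lattice_paths_def by (cases "j = 0"; force)+
  have \<Phi>_step: "step_difference ?p (\<Phi> y) q = - (block_sign \<pi> (Suc q) * y (block_label \<pi> (Suc q)))"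
    if y: "y \<in> lattice_paths k \<pi> N" and q: "q < ?p" for y q
  proof -
    have 1: "int (\<Phi> y q) = lattice_path \<pi> y q" using q path_range(1)[OF y, of q] by (simp add: \<Phi>_def)
    have 2: "int (\<Phi> y (Suc q mod ?p)) = lattice_path \<pi> y (Suc q)"
    proof (cases "Suc q = ?p")
      case True
      then show ?thesis using p path_range(1)[OF y, of 0] path0[of y] lattice_path_closes[OF \<pi>, of y]
        by (simp add: \<Phi>_def)
    next
      case False
      then have "Suc q < ?p" using q by simp
      then show ?thesis using path_range(1)[OF y, of "Suc q"] by (simp add: \<Phi>_def)
    qed
    show ?thesis unfolding step_difference_def 1 2 by (simp add: lattice_path_Suc)
  qed
  have \<Psi>_label: "block_sign \<pi> (Suc q) * \<Psi> i (block_label \<pi> (Suc q)) = - step_difference ?p i q"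
    if i: "i \<in> paired_blocks ?p \<pi> N" and q: "q < ?p" for i q
  proof -
    have q': "Suc q \<in> {1..?p}" using q by simp
    let ?l = "block_label \<pi> (Suc q)"
    have l: "?l \<in> {1..k}" by (rule block_label_properties(1)[OF \<pi> q'])
    have \<Psi>: "\<Psi> i ?l = - step_difference ?p i (pos ?l - 1)" using l by (simp add: \<Psi>_def)
    have pair: "step_difference ?p i (partner \<pi> (Suc q) - 1) = - step_difference ?p i q"
      using i q unfolding paired_blocks_def by blast
    have "pos ?l = Suc q \<or> pos ?l = partner \<pi> (Suc q)"
      using block_label_properties(2)[OF \<pi> q' pos(1)[OF l]] pos(2)[OF l] by simp
    then show ?thesis
    proof
      assume "pos ?l = Suc q"
      then show ?thesis using \<Psi> pos(3)[OF l] by simp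
    next
      assume e: "pos ?l = partner \<pi> (Suc q)"
      then have "block_sign \<pi> (Suc q) = - 1"
        using pos(3)[OF l] block_sign_properties(1)[OF \<pi> q'] by simp
      then show ?thesis using \<Psi> pair e by simp
    qed
  qed
  have \<Psi>_path: "lattice_path \<pi> (\<Psi> i) j = int (i (j mod ?p))" if i: "i \<in> paired_blocks ?p \<pi> N" and j: "j \<le> ?p" for i j
    using j
  proof (induction j)
    case 0
    then show ?case by (simp add: path0 \<Psi>_def)
  next
    case (Suc j)
    then have "lattice_path \<pi> (\<Psi> i) (Suc j) = int (i j) - step_difference ?p i j"
      unfolding lattice_path_Suc using \<Psi>_label[OF i, of j] by simp
    then show ?case by (simp add: step_difference_def)
  qed
  have iN: "i q < N" if "i \<in> paired_blocks ?p \<pi> N" "q < ?p" for i q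
    using that unfolding paired_blocks_def by (auto dest: PiE_mem)
  have "bij_betw \<Phi> (lattice_paths k \<pi> N) (paired_blocks ?p \<pi> N)"
  proof (rule bij_betw_byWitness[where f' = \<Psi>])
    have \<Phi>_in: "\<Phi> y \<in> paired_blocks ?p \<pi> N" if y: "y \<in> lattice_paths k \<pi> N" for y
      unfolding paired_blocks_def
    proof (intro CollectI conjI allI impI)
      show "\<Phi> y \<in> {..<?p} \<rightarrow>\<^sub>E {..<N}"
        unfolding \<Phi>_def
      proof (rule restrict_PiE_iff[THEN iffD2], rule ballI)
        fix j assume "j \<in> {..<?p}"
        then show "nat (lattice_path \<pi> y j) \<in> {..<N}" using path_range[OF y, of j] by simp
      qed
      fix q assume q: "q < ?p"
      have q': "Suc q \<in> {1..?p}" using q by simp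
      have pb: "partner \<pi> (Suc q) \<in> {1..?p}" by (rule pair_partition_block(5)[OF \<pi> q'])
      then have lt: "partner \<pi> (Suc q) - 1 < ?p" and s: "Suc (partner \<pi> (Suc q) - 1) = partner \<pi> (Suc q)" by auto
      show "step_difference ?p (\<Phi> y) (partner \<pi> (Suc q) - 1) = - step_difference ?p (\<Phi> y) q"
        unfolding \<Phi>_step[OF y lt] \<Phi>_step[OF y q] s
        using pair_partition_partner(3)[OF \<pi> q'] block_sign_properties(1)[OF \<pi> q'] by simp
    qed
    then show "\<Phi> ` lattice_paths k \<pi> N \<subseteq> paired_blocks ?p \<pi> N" by blast
    show "\<forall>y\<in>lattice_paths k \<pi> N. \<Psi> (\<Phi> y) = y"
    proof
      fix y assume y: "y \<in> lattice_paths k \<pi> N"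
      have "\<Psi> (\<Phi> y) l = y l" if "l \<in> {0..k}" for l
      proof (cases "l = 0")
        case True
        then show ?thesis using p path_range(1)[OF y, of 0] path0[of y] by (simp add: \<Psi>_def \<Phi>_def)
      next
        case False
        then have l: "l \<in> {1..k}" using that by simp
        have "pos l - 1 < ?p" "Suc (pos l - 1) = pos l" using pos(1)[OF l] by auto
        then show ?thesis using \<Phi>_step[OF y, of "pos l - 1"] pos(2,3)[OF l] l by (simp add: \<Psi>_def)
      qed
      moreover have "y \<in> {0..k} \<rightarrow>\<^sub>E UNIV" using y unfolding lattice_paths_def by blast
      ultimately show "\<Psi> (\<Phi> y) = y" by (intro PiE_ext[of _ "{0..k}" "\<lambda>_. UNIV" y]) (auto simp: \<Psi>_def)
    qed
    show "\<forall>i\<in>paired_blocks ?p \<pi> N. \<Phi> (\<Psi> i) = i"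
    proof
      fix i assume i: "i \<in> paired_blocks ?p \<pi> N"
      have "\<Phi> (\<Psi> i) j = i j" if "j < ?p" for j
        using that \<Psi>_path[OF i, of j] by (simp add: \<Phi>_def)
      moreover have "i \<in> {..<?p} \<rightarrow>\<^sub>E {..<N}" using i unfolding paired_blocks_def by blast
      ultimately show "\<Phi> (\<Psi> i) = i" by (intro PiE_ext[of _ "{..<?p}" "\<lambda>_. UNIV" i]) (auto simp: \<Phi>_def PiE_iff)
    qed
    show "\<Psi> ` paired_blocks ?p \<pi> N \<subseteq> lattice_paths k \<pi> N"
    proof (rule image_subsetI)
      fix i assume i: "i \<in> paired_blocks ?p \<pi> N"
      show "\<Psi> i \<in> lattice_paths k \<pi> N"
        unfolding lattice_paths_def
      proof (intro CollectI conjI ballI)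
        show "\<Psi> i \<in> {0..k} \<rightarrow>\<^sub>E UNIV" by (simp add: \<Psi>_def)
        show "\<Psi> i 0 \<in> {0..<int N}" using iN[OF i p] by (simp add: \<Psi>_def)
        show "lattice_path \<pi> (\<Psi> i) j \<in> {0..<int N}" if "j \<in> {1..?p}" for j
        proof -
          have "j \<le> ?p" using that by simp
          moreover have "j mod ?p < ?p" using p by simp
          ultimately show ?thesis using \<Psi>_path[OF i, of j] iN[OF i, of "j mod ?p"] by simp
        qed
        fix l assume l: "l \<in> {1..k}"
        have q: "pos l - 1 < ?p" "Suc (pos l - 1) mod ?p < ?p" using pos(1)[OF l] p by auto
        have "\<bar>step_difference ?p i (pos l - 1)\<bar> \<le> int N"
          using iN[OF i q(1)] iN[OF i q(2)] unfolding step_difference_def by linarith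
        then show "\<bar>\<Psi> i l\<bar> \<le> int N" using l by (simp add: \<Psi>_def)
      qed
    qed
  qed
  then show ?thesis by (rule bij_betw_same_card[symmetric])
qed

text \<open>Coefficients of the linear forms that bound the polytope: the coordinates, which describe the box
  of integration, and the path functionals.\<close>

definition path_form :: "nat set set \<Rightarrow> nat + nat \<Rightarrow> nat \<Rightarrow> real" where
  "path_form \<pi> s l = (case s of Inl l' \<Rightarrow> of_bool (l = l')
     | Inr j \<Rightarrow> of_bool (l = 0) + (\<Sum>q=1..j. if block_label \<pi> q = l then pair_sign \<pi> q else 0))"

lemma path_form_Inl:
  assumes "l' \<in> {0..k}"
  shows "(\<Sum>l\<in>{0..k}. path_form \<pi> (Inl l') l * x l) = x l'"
proof -
  have "(\<Sum>l\<in>{0..k}. path_form \<pi> (Inl l') l * x l) = (\<Sum>l\<in>{0..k}. if l = l' then x l else 0)"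
    by (rule sum.cong) (auto simp: path_form_def)
  then show ?thesis using assms by simp
qed

lemma path_form_Inr:
  assumes \<pi>: "\<pi> \<in> pair_partitions (2 * k)" and j: "j \<le> 2 * k"
  shows "(\<Sum>l\<in>{0..k}. path_form \<pi> (Inr j) l * x l) = x 0 + (\<Sum>q=1..j. pair_sign \<pi> q * x (block_label \<pi> q))"
proof -
  have "(\<Sum>l\<in>{0..k}. path_form \<pi> (Inr j) l * x l) =
      (\<Sum>l\<in>{0..k}. of_bool (l = 0) * x l) + (\<Sum>l\<in>{0..k}. \<Sum>q=1..j. (if block_label \<pi> q = l then pair_sign \<pi> q else 0) * x l)"
    by (simp add: path_form_def distrib_right sum.distrib sum_distrib_right)
  also have "(\<Sum>l\<in>{0..k}. of_bool (l = 0) * x l) = (\<Sum>l\<in>{0..k}. if l = 0 then x l else 0)"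
    by (rule sum.cong) auto
  also have "\<dots> = x 0" by simp
  also have "(\<Sum>l\<in>{0..k}. \<Sum>q=1..j. (if block_label \<pi> q = l then pair_sign \<pi> q else 0) * x l) =
      (\<Sum>q=1..j. \<Sum>l\<in>{0..k}. (if block_label \<pi> q = l then pair_sign \<pi> q else 0) * x l)"
    by (rule sum.swap)
  also have "\<dots> = (\<Sum>q=1..j. pair_sign \<pi> q * x (block_label \<pi> q))"
  proof (rule sum.cong[OF refl])
    fix q assume "q \<in> {1..j}"
    then have "q \<in> {1..2 * k}" using j by simp
    then have b: "block_label \<pi> q \<in> {0..k}" using block_label_properties(1)[OF \<pi>, of q] by simp
    have "(\<Sum>l\<in>{0..k}. (if block_label \<pi> q = l then pair_sign \<pi> q else 0) * x l) =
        (\<Sum>l\<in>{0..k}. if block_label \<pi> q = l then pair_sign \<pi> q * x l else 0)"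
      by (rule sum.cong) auto
    also have "\<dots> = pair_sign \<pi> q * x (block_label \<pi> q)" using b by simp
    finally show "(\<Sum>l\<in>{0..k}. (if block_label \<pi> q = l then pair_sign \<pi> q else 0) * x l) =
        pair_sign \<pi> q * x (block_label \<pi> q)" .
  qed
  finally show ?thesis .
qed

lemma path_form_lattice_path:
  assumes \<pi>: "\<pi> \<in> pair_partitions (2 * k)" and j: "j \<le> 2 * k"
  shows "(\<Sum>l\<in>{0..k}. path_form \<pi> (Inr j) l * real_of_int (y l)) = real_of_int (lattice_path \<pi> y j)"
  unfolding path_form_Inr[OF assms] lattice_path_def of_int_add of_int_sum
  using block_sign_properties(2)[OF \<pi>] j by (intro arg_cong2[of _ _ _ _ "(+)"] refl sum.cong) auto

lemma ball_image_iff: "(\<forall>y\<in>f ` A. P y) \<longleftrightarrow> (\<forall>x\<in>A. P (f x))"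
  by blast

text \<open>The integrand is the indicator of the polytope cut out by the path functionals inside the box, and
  the circuits compatible with \<open>\<pi>\<close> are the lattice points of its dilation by \<open>N\<close>.\<close>

lemma paired_blocks_tendsto_integral:
  assumes k: "1 \<le> k" and \<pi>: "\<pi> \<in> pair_partitions (2 * k)"
  shows "(\<lambda>N. real (card (paired_blocks (2 * k) \<pi> N)) / real N ^ (k + 1)) \<longlonglongrightarrow> partition_integral k \<pi>"
proof -
  let ?I = "{0..k}"
  let ?F = "Inl ` {0..k} \<union> Inr ` {1..2 * k} :: (nat + nat) set"
  define lo :: "nat + nat \<Rightarrow> real" where
    "lo s = (case s of Inl l \<Rightarrow> (if l = 0 then 0 else - 1) | Inr j \<Rightarrow> 0)" for s
  let ?\<phi> = "\<lambda>s x. \<Sum>l\<in>?I. path_form \<pi> s l * x l"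
  have "(\<lambda>N. real (card (lattice_paths k \<pi> N)) / real N ^ card ?I) \<longlonglongrightarrow>
    (\<integral>x. of_bool (\<forall>s\<in>?F. lo s \<le> ?\<phi> s x \<and> ?\<phi> s x \<le> 1) \<partial>lebesgue_power ?I)"
  proof (rule lattice_points_tendsto_volume)
    fix s assume s: "s \<in> ?F"
    show "\<exists>l\<in>?I. path_form \<pi> s l \<noteq> 0"
    proof (cases s)
      case (Inl l)
      then show ?thesis using s by (intro bexI[of _ l]) (auto simp: path_form_def)
    next
      case (Inr j)
      have "(\<Sum>q=1..j. if block_label \<pi> q = 0 then pair_sign \<pi> q else 0) = 0"
      proof (rule sum.neutral, rule ballI)
        fix q assume "q \<in> {1..j}"
        then have "q \<in> {1..2 * k}" using s Inr by auto
        from block_label_properties(1)[OF \<pi> this]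
        show "(if block_label \<pi> q = 0 then pair_sign \<pi> q else 0) = 0" by simp
      qed
      then have "path_form \<pi> s 0 = 1" unfolding Inr path_form_def by simp
      then show ?thesis by (intro bexI[of _ 0]) auto
    qed
  next
    fix N
    show "lattice_paths k \<pi> N \<subseteq> ?I \<rightarrow>\<^sub>E {- int N..int N}" by (rule lattice_paths_box)
  next
    fix N y s assume y: "y \<in> lattice_paths k \<pi> N" and s: "s \<in> ?F"
    show "lo s * real N \<le> (\<Sum>l\<in>?I. path_form \<pi> s l * real_of_int (y l)) \<and>
      (\<Sum>l\<in>?I. path_form \<pi> s l * real_of_int (y l)) \<le> 1 * real N"
    proof (cases s)
      case (Inl l)
      then have l: "l \<in> {0..k}" using s by auto
      show ?thesis
      proof (cases "l = 0")
        case True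
        have "y 0 \<in> {0..<int N}" using y unfolding lattice_paths_def by blast
        then show ?thesis unfolding Inl path_form_Inl[OF l] using True by (simp add: lo_def)
      next
        case False
        then have "l \<in> {1..k}" using l by simp
        then have "\<bar>y l\<bar> \<le> int N" using y unfolding lattice_paths_def by blast
        then have "- real N \<le> real_of_int (y l)" "real_of_int (y l) \<le> real N" by linarith+
        then show ?thesis unfolding Inl path_form_Inl[OF l] using False by (simp add: lo_def)
      qed
    next
      case (Inr j)
      then have j: "j \<in> {1..2 * k}" "j \<le> 2 * k" using s by auto
      have "lattice_path \<pi> y j \<in> {0..<int N}" using y j unfolding lattice_paths_def by blast
      then show ?thesis unfolding Inr path_form_lattice_path[OF \<pi> j(2)] by (simp add: lo_def)
    qed
  next
    fix N y assume N: "0 < N" and y: "y \<in> ?I \<rightarrow>\<^sub>E (UNIV :: int set)"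
      and inner: "\<And>s. s \<in> ?F \<Longrightarrow> lo s * real N < (\<Sum>l\<in>?I. path_form \<pi> s l * real_of_int (y l)) \<and>
        (\<Sum>l\<in>?I. path_form \<pi> s l * real_of_int (y l)) < 1 * real N"
    show "y \<in> lattice_paths k \<pi> N"
      unfolding lattice_paths_def
    proof (intro CollectI conjI ballI)
      show "y \<in> ?I \<rightarrow>\<^sub>E UNIV" by (rule y)
      have "0 < real_of_int (y 0) \<and> real_of_int (y 0) < real N"
        using inner[of "Inl 0"] path_form_Inl[of 0 k \<pi> "\<lambda>l. real_of_int (y l)"] by (simp add: lo_def)
      then show "y 0 \<in> {0..<int N}" by simp
      fix l assume l: "l \<in> {1..k}"
      have "Inl l \<in> ?F" "l \<in> {0..k}" using l by auto
      then have "- real N < real_of_int (y l) \<and> real_of_int (y l) < real N"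
        using inner[of "Inl l"] path_form_Inl[of l k \<pi> "\<lambda>l. real_of_int (y l)"] l by (simp add: lo_def)
      then show "\<bar>y l\<bar> \<le> int N" by linarith
    next
      fix j assume j: "j \<in> {1..2 * k}"
      have "Inr j \<in> ?F" "j \<le> 2 * k" using j by auto
      then have "0 < real_of_int (lattice_path \<pi> y j) \<and> real_of_int (lattice_path \<pi> y j) < real N"
        using inner[of "Inr j"] path_form_lattice_path[OF \<pi>, of j y] by (simp add: lo_def)
      then show "lattice_path \<pi> y j \<in> {0..<int N}" by simp
    qed
  qed auto
  moreover have "(\<integral>x. of_bool (\<forall>s\<in>?F. lo s \<le> ?\<phi> s x \<and> ?\<phi> s x \<le> 1) \<partial>lebesgue_power ?I) = partition_integral k \<pi>"
    unfolding partition_integral_def set_lebesgue_integral_def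
  proof (rule Bochner_Integration.integral_cong[OF refl])
    fix x assume "x \<in> space (lebesgue_power ?I)"
    then have ext: "x \<in> extensional ?I" by (auto simp: space_PiM PiE_iff)
    let ?box = "\<Pi>\<^sub>E l\<in>?I. if l = 0 then {0..1} else {- 1..1} :: real set"
    let ?path = "\<lambda>j. x 0 + (\<Sum>q=1..j. pair_sign \<pi> q * x (block_label \<pi> q))"
    have box: "(\<forall>s\<in>Inl ` {0..k}. lo s \<le> ?\<phi> s x \<and> ?\<phi> s x \<le> 1) \<longleftrightarrow> x \<in> ?box"
    proof -
      have "(\<forall>s\<in>Inl ` {0..k}. lo s \<le> ?\<phi> s x \<and> ?\<phi> s x \<le> 1) \<longleftrightarrow>
          (\<forall>l\<in>{0..k}. x l \<in> (if l = 0 then {0..1} else {- 1..1}))"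
        unfolding ball_image_iff by (rule ball_cong[OF refl]) (simp add: path_form_Inl lo_def)
      then show ?thesis using ext by (simp add: PiE_iff)
    qed
    have paths: "(\<forall>s\<in>Inr ` {1..2 * k}. lo s \<le> ?\<phi> s x \<and> ?\<phi> s x \<le> 1) \<longleftrightarrow> (\<forall>j\<in>{1..2 * k}. ?path j \<in> {0..1})"
      unfolding ball_image_iff by (rule ball_cong[OF refl]) (simp add: path_form_Inr[OF \<pi>] lo_def)
    have "(\<Prod>j=1..2 * k. indicator {0..1} (?path j) :: real) = of_bool (\<forall>j\<in>{1..2 * k}. ?path j \<in> {0..1})"
      unfolding indicator_def by (rule prod_of_bool) simp
    then show "of_bool (\<forall>s\<in>?F. lo s \<le> ?\<phi> s x \<and> ?\<phi> s x \<le> 1) =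
        indicator ?box x *\<^sub>R (\<Prod>j=1..2 * k. indicator {0..1} (?path j) :: real)"
      unfolding ball_Un box paths by (simp add: indicator_def)
  qed
  ultimately show ?thesis unfolding card_paired_blocks[OF assms] by simp
qed

section \<open>Labellings constant along edges and the rank of the equations\<close>

definition edge_connected :: "(nat \<Rightarrow> nat) \<Rightarrow> (nat \<Rightarrow> nat) \<Rightarrow> nat \<Rightarrow> nat \<Rightarrow> nat \<Rightarrow> bool" where
  "edge_connected u v e = rtranclp (\<lambda>x y. \<exists>p<e. (x = u p \<and> y = v p) \<or> (x = v p \<and> y = u p))"

lemma edge_connected_step:
  assumes "edge_connected u v e x y" "p < e"
  shows "y = u p \<Longrightarrow> edge_connected u v e x (v p)" "y = v p \<Longrightarrow> edge_connected u v e x (u p)"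
  using assms unfolding edge_connected_def by (auto intro: rtranclp.rtrancl_into_rtrancl)

lemma edge_connected_invariant:
  assumes "edge_connected u v e x y" "\<And>p. p < e \<Longrightarrow> t (u p) = t (v p)"
  shows "t x = t y"
  using assms(1) unfolding edge_connected_def by (induction rule: rtranclp_induct) (auto simp: assms(2))

definition edge_labellings :: "(nat \<Rightarrow> nat) \<Rightarrow> (nat \<Rightarrow> nat) \<Rightarrow> nat \<Rightarrow> nat \<Rightarrow> nat \<Rightarrow> (nat \<Rightarrow> nat) set" where
  "edge_labellings u v n m e = {t \<in> {..<n} \<rightarrow>\<^sub>E {..<m}. \<forall>p<e. t (u p) = t (v p)}"

text \<open>The label of the component of \<open>u e\<close> is arbitrary as long as the new edge is absent, and the edge
  forces it to be that of \<open>v e\<close>.\<close>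

lemma card_edge_labellings_split:
  assumes uv: "\<And>p. p < Suc e \<Longrightarrow> u p < n \<and> v p < n"
    and nc: "\<not> edge_connected u v e (u e) (v e)"
  shows "card (edge_labellings u v n m e) = m * card (edge_labellings u v n m (Suc e))"
proof -
  define D where "D = {y. y < n \<and> edge_connected u v e (u e) y}"
  have ue: "u e \<in> D" and ve: "v e \<notin> D" using uv[of e] nc by (auto simp: D_def edge_connected_def)
  have inv: "u p \<in> D \<longleftrightarrow> v p \<in> D" if "p < e" for p
    using edge_connected_step[of u v e "u e" _ p] uv[of p] that by (auto simp: D_def)
  define F where "F t = (\<lambda>x. if x \<in> D then t (v e) else t x)" for t :: "nat \<Rightarrow> nat"
  define G where "G = (\<lambda>(a::nat, s::nat \<Rightarrow> nat). \<lambda>x. if x \<in> D then a else s x)"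
  have Dn: "D \<subseteq> {..<n}" by (auto simp: D_def)
  have const: "t x = t (u e)" if "t \<in> edge_labellings u v n m e" "x \<in> D" for t x
    using edge_connected_invariant[of u v e "u e" x t] that by (auto simp: D_def edge_labellings_def)
  have "bij_betw (\<lambda>t. (t (u e), F t)) (edge_labellings u v n m e) ({..<m} \<times> edge_labellings u v n m (Suc e))"
  proof (rule bij_betw_byWitness[where f' = G])
    show "\<forall>t\<in>edge_labellings u v n m e. G (t (u e), F t) = t"
    proof (intro ballI ext)
      fix t x assume t: "t \<in> edge_labellings u v n m e"
      show "G (t (u e), F t) x = t x" using const[OF t, of x] by (cases "x \<in> D") (simp_all add: G_def F_def)
    qed
    show "\<forall>x\<in>{..<m} \<times> edge_labellings u v n m (Suc e). (\<lambda>t. (t (u e), F t)) (G x) = x"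
    proof
      fix x assume "x \<in> {..<m} \<times> edge_labellings u v n m (Suc e)"
      then obtain a s where x: "x = (a, s)" "s \<in> edge_labellings u v n m (Suc e)" by auto
      then have s: "\<And>p. p < Suc e \<Longrightarrow> s (u p) = s (v p)" by (auto simp: edge_labellings_def)
      have "s y = s (u e)" if "y \<in> D" for y
        using edge_connected_invariant[of u v e "u e" y s] that s by (auto simp: D_def)
      moreover have "s (u e) = s (v e)" by (rule s) simp
      ultimately have "F (G (a, s)) = s" using ve by (auto simp: F_def G_def fun_eq_iff)
      then show "(\<lambda>t. (t (u e), F t)) (G x) = x" using ue by (simp add: x G_def)
    qed
    show "(\<lambda>t. (t (u e), F t)) ` edge_labellings u v n m e \<subseteq> {..<m} \<times> edge_labellings u v n m (Suc e)"
    proof (rule image_subsetI)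
      fix t assume t: "t \<in> edge_labellings u v n m e"
      then have T: "t \<in> {..<n} \<rightarrow>\<^sub>E {..<m}" "\<And>p. p < e \<Longrightarrow> t (u p) = t (v p)" by (auto simp: edge_labellings_def)
      have "F t \<in> {..<n} \<rightarrow>\<^sub>E {..<m}" using T(1) Dn uv[of e] by (auto simp: F_def PiE_iff extensional_def)
      moreover have "F t (u p) = F t (v p)" if "p < Suc e" for p
        using that inv[of p] T(2)[of p] ue ve by (cases "p = e") (auto simp: F_def)
      moreover have "t (u e) < m" using T(1) uv[of e] by (auto dest: PiE_mem)
      ultimately show "(t (u e), F t) \<in> {..<m} \<times> edge_labellings u v n m (Suc e)"
        by (simp add: edge_labellings_def)
    qed
    show "G ` ({..<m} \<times> edge_labellings u v n m (Suc e)) \<subseteq> edge_labellings u v n m e"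
    proof (rule image_subsetI)
      fix x assume "x \<in> {..<m} \<times> edge_labellings u v n m (Suc e)"
      then obtain a s where x: "x = (a, s)" "a < m" "s \<in> {..<n} \<rightarrow>\<^sub>E {..<m}"
        "\<And>p. p < e \<Longrightarrow> s (u p) = s (v p)" by (auto simp: edge_labellings_def)
      have "G (a, s) \<in> {..<n} \<rightarrow>\<^sub>E {..<m}" using x Dn by (auto simp: G_def PiE_iff extensional_def)
      moreover have "G (a, s) (u p) = G (a, s) (v p)" if "p < e" for p
        using inv[OF that] x(4)[OF that] by (auto simp: G_def)
      ultimately show "G x \<in> edge_labellings u v n m e" by (simp add: edge_labellings_def x(1))
    qed
  qed
  then have "card (edge_labellings u v n m e) = card ({..<m} \<times> edge_labellings u v n m (Suc e))"
    by (rule bij_betw_same_card)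
  then show ?thesis by (simp add: card_cartesian_product)
qed

context vec_space
begin

text \<open>The column of the incidence matrix that belongs to the edge \<open>p\<close>.\<close>

definition edge_vec :: "(nat \<Rightarrow> nat) \<Rightarrow> (nat \<Rightarrow> nat) \<Rightarrow> nat \<Rightarrow> 'a Matrix.vec" where
  "edge_vec u v p = unit_vec n (u p) - unit_vec n (v p)"

lemma edge_vec_carrier: "edge_vec u v p \<in> carrier_vec n"
  by (simp add: edge_vec_def)

text \<open>Along a path the differences of consecutive unit vectors telescope.\<close>

lemma connected_difference_in_span:
  assumes "edge_connected u v e x y" "edge_vec u v ` {..<e} \<subseteq> span S" "S \<subseteq> carrier_vec n"
  shows "unit_vec n x - unit_vec n y \<in> span S"
  using assms(1) unfolding edge_connected_def
proof (induction rule: rtranclp_induct)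
  case base
  have "0\<^sub>v n \<in> span S" using submodule.zero_closed[OF span_is_submodule[OF assms(3)]] by simp
  moreover have eq: "unit_vec n x - unit_vec n x = (0\<^sub>v n :: 'a Matrix.vec)" by (intro eq_vecI) auto
  ultimately show ?case by (simp only: eq)
next
  case (step y z)
  then obtain p where p: "p < e" "(y = u p \<and> z = v p) \<or> (y = v p \<and> z = u p)" by blast
  have w: "edge_vec u v p \<in> span S" using p assms(2) by blast
  have neg: "(- 1) \<cdot>\<^sub>v edge_vec u v p = unit_vec n (v p) - unit_vec n (u p)"
    unfolding edge_vec_def by (intro eq_vecI) auto
  have "unit_vec n y - unit_vec n z \<in> span S"
    using p(2) w smult_in_span[OF assms(3) w, of "- 1"] unfolding neg by (auto simp: edge_vec_def)
  from span_add1[OF assms(3) step.IH this]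
  have "(unit_vec n x - unit_vec n y) + (unit_vec n y - unit_vec n z) \<in> span S" by simp
  also have "(unit_vec n x - unit_vec n y) + (unit_vec n y - unit_vec n z) = unit_vec n x - (unit_vec n z :: 'a Matrix.vec)"
    by (intro eq_vecI) auto
  finally show ?case .
qed

text \<open>The indicator vector of the component of \<open>u e\<close> is orthogonal to all earlier edges, but not to the
  new one.\<close>

lemma edge_vec_not_in_span:
  assumes uv: "\<And>p. p < Suc e \<Longrightarrow> u p < n \<and> v p < n"
    and nc: "\<not> edge_connected u v e (u e) (v e)" and S: "S \<subseteq> edge_vec u v ` {..<e}"
  shows "edge_vec u v e \<notin> span S"
proof
  assume in_span: "edge_vec u v e \<in> span S"
  define f where "f = Matrix.vec n (\<lambda>y. if edge_connected u v e (u e) y then 1 else 0 :: 'a)"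
  have f: "f \<in> carrier_vec n" by (simp add: f_def)
  have Sc: "S \<subseteq> carrier_vec n" using S edge_vec_carrier by blast
  have sp: "scalar_prod f (edge_vec u v p) = vec_index f (u p) - vec_index f (v p)" if "p < Suc e" for p
    using uv[OF that] f unfolding edge_vec_def
    by (subst scalar_prod_minus_distrib[of _ n]) (auto simp: scalar_prod_right_unit)
  have "scalar_prod f w = 0" if w: "w \<in> S" for w
  proof -
    obtain p where p: "p < e" "w = edge_vec u v p" using S w by blast
    have "edge_connected u v e (u e) (u p) \<longleftrightarrow> edge_connected u v e (u e) (v p)"
      using edge_connected_step[OF _ p(1)] by blast
    then show ?thesis using sp[of p] p uv[of p] by (simp add: f_def)
  qed
  then have "f \<in> orthogonal_complement S" using f by (simp add: orthogonal_complement_def)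
  then have "f \<in> orthogonal_complement (span S)" using Sc by simp
  then have "scalar_prod f (edge_vec u v e) = 0" using in_span by (simp add: orthogonal_complement_def)
  moreover have "scalar_prod f (edge_vec u v e) = 1"
    using sp[of e] uv[of e] nc by (simp add: f_def edge_connected_def)
  ultimately show False by simp
qed

text \<open>Edges are added one at a time. An edge within a component changes neither the span nor the
  labellings; an edge between two components raises the dimension by one and divides the number of
  labellings by \<open>m\<close>.\<close>

lemma independent_edges_count:
  assumes "\<And>p. p < e \<Longrightarrow> u p < n \<and> v p < n"
  shows "\<exists>S. S \<subseteq> edge_vec u v ` {..<e} \<and> lin_indpt S \<and> edge_vec u v ` {..<e} \<subseteq> span S \<and>
    m ^ card S * card (edge_labellings u v n m e) = m ^ n"
  using assms
proof (induction e)
  case 0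
  have "lin_indpt {}" by (simp add: lin_dep_def)
  moreover have "edge_labellings u v n m 0 = {..<n} \<rightarrow>\<^sub>E {..<m}" by (auto simp: edge_labellings_def)
  ultimately show ?case by (intro exI[of _ "{}"]) (auto simp: card_PiE)
next
  case (Suc e)
  then obtain S where S: "S \<subseteq> edge_vec u v ` {..<e}" "lin_indpt S" "edge_vec u v ` {..<e} \<subseteq> span S"
    "m ^ card S * card (edge_labellings u v n m e) = m ^ n" by force
  have Sc: "S \<subseteq> carrier_vec n" using S edge_vec_carrier by blast
  have split: "edge_vec u v ` {..<Suc e} = insert (edge_vec u v e) (edge_vec u v ` {..<e})"
    by (simp add: lessThan_Suc)
  show ?case
  proof (cases "edge_connected u v e (u e) (v e)")
    case True
    have "edge_vec u v e \<in> span S"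
      unfolding edge_vec_def by (rule connected_difference_in_span[OF True S(3) Sc])
    moreover have "edge_labellings u v n m (Suc e) = edge_labellings u v n m e"
      using edge_connected_invariant[OF True] by (auto simp: edge_labellings_def less_Suc_eq)
    ultimately show ?thesis using S unfolding split by (intro exI[of _ S]) auto
  next
    case False
    let ?w = "edge_vec u v e"
    have ns: "?w \<notin> span S" by (rule edge_vec_not_in_span[OF Suc.prems False S(1)])
    then have nS: "?w \<notin> S" using span_mem[OF Sc] by blast
    have "lin_indpt (S \<union> {?w})"
      using lin_dep_iff_in_span[OF _ S(2) _ nS] Sc edge_vec_carrier ns by simp
    moreover have sub: "insert ?w S \<subseteq> carrier_vec n" using Sc edge_vec_carrier by simp
    moreover have "span S \<subseteq> span (insert ?w S)" by (rule span_is_monotone) auto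
    moreover have "?w \<in> span (insert ?w S)" using span_mem[OF sub] by simp
    moreover have "finite S" using S(1) finite_subset by blast
    moreover have "m ^ Suc (card S) * card (edge_labellings u v n m (Suc e)) = m ^ n"
      using card_edge_labellings_split[OF Suc.prems False, of m] S(4) by (simp add: mult_ac)
    ultimately show ?thesis using S nS unfolding split by (intro exI[of _ "insert ?w S"]) auto
  qed
qed

lemma rank_edge_matrix:
  assumes uv: "\<And>p. p < e \<Longrightarrow> u p < n \<and> v p < n"
    and A: "A \<in> carrier_mat n e" "\<And>p. p < e \<Longrightarrow> Matrix.col A p = edge_vec u v p"
  shows "m ^ rank A * card (edge_labellings u v n m e) = m ^ n"
proof -
  have "\<exists>S. S \<subseteq> edge_vec u v ` {..<e} \<and> lin_indpt S \<and> edge_vec u v ` {..<e} \<subseteq> span S \<and>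
      m ^ card S * card (edge_labellings u v n m e) = m ^ n"
    by (rule independent_edges_count) (rule uv)
  then obtain S where S: "S \<subseteq> edge_vec u v ` {..<e}" "lin_indpt S" "edge_vec u v ` {..<e} \<subseteq> span S"
    "m ^ card S * card (edge_labellings u v n m e) = m ^ n" by (elim exE conjE) (rule that)
  have Sc: "S \<subseteq> carrier_vec n" using S edge_vec_carrier by blast
  have cols: "set (cols A) = edge_vec u v ` {..<e}"
    using A by (auto simp: cols_def image_iff)
  have "maximal S (\<lambda>T. T \<subseteq> set (cols A) \<and> lin_indpt T)"
    unfolding maximal_def cols
  proof (intro conjI allI impI)
    fix T assume T: "T \<supseteq> S \<and> T \<subseteq> edge_vec u v ` {..<e} \<and> lin_indpt T"
    show "T = S"
    proof (rule ccontr)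
      assume "T \<noteq> S"
      then obtain w where w: "w \<in> T" "w \<notin> S" using T by blast
      have "w \<in> span S" "w \<in> carrier_vec n" using w T S(3) edge_vec_carrier by blast+
      then have "lin_dep (S \<union> {w})" using lin_dep_iff_in_span[OF _ S(2) _ w(2)] Sc by simp
      moreover have "S \<union> {w} \<subseteq> T" using w T by blast
      moreover have "finite T" using T finite_subset by blast
      ultimately show False using T subset_li_is_li by blast
    qed
  qed (use S in auto)
  then have "rank A = card S" by (rule rank_card_indpt[OF A(1)])
  then show ?thesis using S(4) by simp
qed

end

text \<open>The equation for letter \<open>p\<close> is an edge from \<open>p\<close> to the position after its partner, so the rank of the
  system is the size of a spanning forest.\<close>

lemma card_labellings_equation_rank:
  assumes "0 < k"
  shows "m ^ equation_rank k \<pi> *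
    card {t \<in> {..<2 * k} \<rightarrow>\<^sub>E {..<m}. \<forall>p<2 * k. t p = t (partner \<pi> (Suc p) mod (2 * k))} = m ^ (2 * k)"
proof -
  let ?n = "2 * k"
  let ?v = "\<lambda>p. partner \<pi> (Suc p) mod ?n"
  have "m ^ vec_space.rank ?n (equation_matrix k \<pi>) * card (edge_labellings (\<lambda>p. p) ?v ?n m ?n) = m ^ ?n"
  proof (rule vec_space.rank_edge_matrix)
    show "p < ?n \<and> ?v p < ?n" if "p < ?n" for p using that assms by auto
    show "equation_matrix k \<pi> \<in> carrier_mat ?n ?n" by (simp add: equation_matrix_def)
    show "Matrix.col (equation_matrix k \<pi>) p = vec_space.edge_vec ?n (\<lambda>p. p) ?v p" if "p < ?n" for p
      using that by (intro eq_vecI) (auto simp: equation_matrix_def vec_space.edge_vec_def unit_vec_def)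
  qed
  then show ?thesis by (simp add: equation_rank_def edge_labellings_def)
qed

section \<open>Convergence of the moments and the theorem\<close>

text \<open>The sum of the fourth powers has a finite integral, hence is finite almost surely.\<close>

lemma (in prob_space) AE_tendsto_0_of_fourth_moments:
  assumes int: "\<And>n. integrable M (\<lambda>\<omega>. Z n \<omega> ^ 4)" and le: "\<And>n. expectation (\<lambda>\<omega>. Z n \<omega> ^ 4) \<le> b n"
    and b: "summable b"
  shows "AE \<omega> in M. (\<lambda>n. Z n \<omega>) \<longlonglongrightarrow> (0 :: real)"
proof -
  have nn: "0 \<le> x ^ 4" for x :: real by (rule zero_le_even_power) simp
  have E0: "0 \<le> expectation (\<lambda>\<omega>. Z n \<omega> ^ 4)" for n using nn by (intro integral_nonneg_AE) auto
  then have b0: "0 \<le> b n" for n using le[of n] order_trans by blast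
  have meas: "(\<lambda>\<omega>. ennreal (Z n \<omega> ^ 4)) \<in> borel_measurable M" for n
    using borel_measurable_integrable[OF int[of n]] by measurable
  have "(\<integral>\<^sup>+\<omega>. (\<Sum>n. ennreal (Z n \<omega> ^ 4)) \<partial>M) = (\<Sum>n. \<integral>\<^sup>+\<omega>. ennreal (Z n \<omega> ^ 4) \<partial>M)"
    by (rule nn_integral_suminf) (rule meas)
  also have "\<dots> \<le> (\<Sum>n. ennreal (b n))"
  proof (rule suminf_le)
    fix n
    have "(\<integral>\<^sup>+\<omega>. ennreal (Z n \<omega> ^ 4) \<partial>M) = ennreal (expectation (\<lambda>\<omega>. Z n \<omega> ^ 4))"
      by (rule nn_integral_eq_integral[OF int]) (simp add: nn)
    also have "\<dots> \<le> ennreal (b n)" by (rule ennreal_leI[OF le])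
    finally show "(\<integral>\<^sup>+\<omega>. ennreal (Z n \<omega> ^ 4) \<partial>M) \<le> ennreal (b n)" .
  qed auto
  also have "\<dots> = ennreal (\<Sum>n. b n)" by (rule suminf_ennreal2[OF b0 b])
  also have "\<dots> < \<infinity>" by simp
  finally have "(\<integral>\<^sup>+\<omega>. (\<Sum>n. ennreal (Z n \<omega> ^ 4)) \<partial>M) \<noteq> \<infinity>" by simp
  then have "AE \<omega> in M. (\<Sum>n. ennreal (Z n \<omega> ^ 4)) \<noteq> \<infinity>"
    by (rule nn_integral_PInf_AE[rotated]) (rule borel_measurable_suminf_order[OF meas])
  then show ?thesis
  proof eventually_elim
    case (elim \<omega>)
    have "summable (\<lambda>n. Z n \<omega> ^ 4)"
      by (rule summable_suminf_not_top[OF nn]) (use elim in simp)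
    then have "(\<lambda>n. Z n \<omega> ^ 4) \<longlonglongrightarrow> 0" by (rule summable_LIMSEQ_zero)
    then have "(\<lambda>n. root 4 (Z n \<omega> ^ 4)) \<longlonglongrightarrow> root 4 0" by (rule tendsto_real_root)
    moreover have "root 4 (x ^ 4) = \<bar>x\<bar>" for x :: real
    proof -
      have "x ^ 4 = \<bar>x\<bar> ^ 4" by (rule power_even_abs[symmetric]) simp
      then have "root 4 (x ^ 4) = root 4 (\<bar>x\<bar> ^ 4)" by (rule arg_cong)
      also have "\<dots> = \<bar>x\<bar>" by (rule real_root_power_cancel) auto
      finally show ?thesis .
    qed
    ultimately have "(\<lambda>n. \<bar>Z n \<omega>\<bar>) \<longlonglongrightarrow> 0" by simp
    then show ?case by (rule tendsto_rabs_zero_cancel)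
  qed
qed

lemma pow_mat_smult:
  fixes A :: "'a :: comm_semiring_1 Matrix.mat"
  assumes A: "A \<in> carrier_mat n n"
  shows "(c \<cdot>\<^sub>m A) ^\<^sub>m k = c ^ k \<cdot>\<^sub>m (A ^\<^sub>m k)"
proof (induction k)
  case 0
  show ?case using A by (intro eq_matI) auto
next
  case (Suc k)
  have Ak: "A ^\<^sub>m k \<in> carrier_mat n n" using A by simp
  have "(c \<cdot>\<^sub>m A) ^\<^sub>m Suc k = (c ^ k \<cdot>\<^sub>m (A ^\<^sub>m k)) * (c \<cdot>\<^sub>m A)" by (simp add: Suc.IH)
  also have "\<dots> = c ^ k \<cdot>\<^sub>m ((A ^\<^sub>m k) * (c \<cdot>\<^sub>m A))"
    using A Ak by (intro mult_smult_assoc_mat[of _ n n _ n]) auto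
  also have "(A ^\<^sub>m k) * (c \<cdot>\<^sub>m A) = c \<cdot>\<^sub>m ((A ^\<^sub>m k) * A)" by (rule mult_smult_distrib[OF Ak A])
  also have "c ^ k \<cdot>\<^sub>m (c \<cdot>\<^sub>m ((A ^\<^sub>m k) * A)) = c ^ Suc k \<cdot>\<^sub>m (A ^\<^sub>m Suc k)"
    by (intro eq_matI) (auto simp: mult_ac)
  finally show ?case .
qed

lemma mat_trace_smult: "mat_trace (c \<cdot>\<^sub>m A) = c * (mat_trace A :: 'a :: comm_semiring_1)" if "A \<in> carrier_mat n n" for A
  using that by (simp add: mat_trace_def sum_distrib_left)

text \<open>Read off from the lattice point count, since each of the \<open>k + 1\<close> coordinates takes at most \<open>3N\<close>
  values.\<close>

lemma partition_integral_bounds: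
  assumes k: "1 \<le> k" and \<pi>: "\<pi> \<in> pair_partitions (2 * k)"
  shows "0 \<le> partition_integral k \<pi>" "partition_integral k \<pi> \<le> 3 ^ (k + 1)"
proof -
  note lim = paired_blocks_tendsto_integral[OF assms]
  show "0 \<le> partition_integral k \<pi>"
    by (rule LIMSEQ_le_const[OF lim]) (intro exI allI impI divide_nonneg_nonneg; simp)
  show "partition_integral k \<pi> \<le> 3 ^ (k + 1)"
  proof (rule LIMSEQ_le_const2[OF lim], intro exI allI impI)
    fix N :: nat assume N: "1 \<le> N"
    have "card (paired_blocks (2 * k) \<pi> N) \<le> card ({0..k} \<rightarrow>\<^sub>E {- int N..int N})"
      unfolding card_paired_blocks[OF assms] by (intro card_mono finite_PiE lattice_paths_box) auto
    also have "\<dots> = (2 * N + 1) ^ (k + 1)"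
    proof -
      have "card {- int N..int N} = nat (int (2 * N + 1))" by simp
      also have "\<dots> = 2 * N + 1" by (rule nat_int)
      finally show ?thesis by (simp add: card_PiE del: card_atLeastAtMost_int)
    qed
    also have "\<dots> \<le> (3 * N) ^ (k + 1)" using N by (intro power_mono) auto
    finally have "real (card (paired_blocks (2 * k) \<pi> N)) \<le> 3 ^ (k + 1) * real N ^ (k + 1)"
      unfolding of_nat_le_iff[symmetric, where 'a = real] by (simp add: power_mult_distrib mult_ac)
    then show "real (card (paired_blocks (2 * k) \<pi> N)) / real N ^ (k + 1) \<le> 3 ^ (k + 1)"
      using N by (simp add: pos_divide_le_eq)
  qed
qed

lemma limit_even_moment_bounds:
  assumes m: "1 \<le> m" and k: "1 \<le> k"
  shows "0 \<le> limit_even_moment m k"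
    and "limit_even_moment m k \<le> real (card (pair_partitions (2 * k))) * (real m ^ k * 3 ^ (k + 1))"
proof -
  have pw: "0 \<le> real m powi (int k - 1 - int (equation_rank k \<pi>))" for \<pi> by simp
  have le: "real m powi (int k - 1 - int (equation_rank k \<pi>)) \<le> real m ^ k" for \<pi>
    using power_int_increasing[of "int k - 1 - int (equation_rank k \<pi>)" "int k" "real m"] m by simp
  show "0 \<le> limit_even_moment m k"
    unfolding limit_even_moment_def
    by (intro sum_nonneg mult_nonneg_nonneg pw partition_integral_bounds(1)[OF k])
  have "limit_even_moment m k \<le> (\<Sum>\<pi>\<in>pair_partitions (2 * k). real m ^ k * 3 ^ (k + 1))"
    unfolding limit_even_moment_def
    by (intro sum_mono mult_mono le partition_integral_bounds[OF k]) auto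
  then show "limit_even_moment m k \<le> real (card (pair_partitions (2 * k))) * (real m ^ k * 3 ^ (k + 1))"
    by simp
qed

text \<open>The factorials in the number of pair partitions cancel those of the Taylor coefficients up to
  \<open>1/k!\<close>, so the terms are bounded by those of an exponential series.\<close>

lemma small_moments_limit:
  assumes m: "1 \<le> m"
  shows "small_moments (even_moment_sequence (limit_even_moment m))"
  unfolding small_moments_def
proof
  fix t :: real
  define x where "x = 3 * real m * t\<^sup>2 / 2"
  have ub: "\<bar>t\<bar> ^ (2 * k) / fact (2 * k) * even_moment_sequence (limit_even_moment m) (2 * k) \<le> 3 * (x ^ k /\<^sub>R fact k)"
    (is "?L \<le> _") and lb: "0 \<le> \<bar>t\<bar> ^ (2 * k) / fact (2 * k) * even_moment_sequence (limit_even_moment m) (2 * k)"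
    if k: "1 \<le> k" for k
  proof -
    have mo: "even_moment_sequence (limit_even_moment m) (2 * k) = limit_even_moment m k"
      using k by (simp add: even_moment_sequence_def)
    show "0 \<le> ?L" unfolding mo using limit_even_moment_bounds(1)[OF m k] by simp
    have "real (card (pair_partitions (2 * k)) * (2 ^ k * fact k)) \<le> real (fact (2 * k))"
      using card_pair_partitions(2)[of k] by (rule of_nat_mono)
    then have c: "real (card (pair_partitions (2 * k))) * (2 ^ k * fact k) \<le> fact (2 * k)" by simp
    then have "real (card (pair_partitions (2 * k))) / fact (2 * k) \<le> 1 / (2 ^ k * fact k)"
      by (simp add: field_simps)
    then have "(\<bar>t\<bar> ^ (2 * k) * (real m ^ k * 3 ^ (k + 1))) * (real (card (pair_partitions (2 * k))) / fact (2 * k)) \<le>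
        (\<bar>t\<bar> ^ (2 * k) * (real m ^ k * 3 ^ (k + 1))) * (1 / (2 ^ k * fact k))"
      by (intro mult_left_mono) auto
    also have "\<dots> = 3 * (x ^ k /\<^sub>R fact k)"
    proof -
      have pt: "\<bar>t\<bar> ^ (2 * k) = (t\<^sup>2) ^ k" by (simp add: power_mult)
      show ?thesis unfolding pt x_def by (simp add: power_mult_distrib power_divide field_simps)
    qed
    finally have 1: "(\<bar>t\<bar> ^ (2 * k) * (real m ^ k * 3 ^ (k + 1))) * (real (card (pair_partitions (2 * k))) / fact (2 * k)) \<le>
        3 * (x ^ k /\<^sub>R fact k)" .
    have "?L \<le> \<bar>t\<bar> ^ (2 * k) / fact (2 * k) * (real (card (pair_partitions (2 * k))) * (real m ^ k * 3 ^ (k + 1)))"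
      unfolding mo by (intro mult_left_mono limit_even_moment_bounds(2)[OF m k]) simp
    also have "\<dots> = (\<bar>t\<bar> ^ (2 * k) * (real m ^ k * 3 ^ (k + 1))) * (real (card (pair_partitions (2 * k))) / fact (2 * k))"
      by simp
    finally show "?L \<le> 3 * (x ^ k /\<^sub>R fact k)" using 1 by linarith
  qed
  have "(\<lambda>k. x ^ k /\<^sub>R fact k) \<longlonglongrightarrow> 0"
    by (rule summable_LIMSEQ_zero[OF summable_exp_generic])
  then have "(\<lambda>k. 3 * (x ^ k /\<^sub>R fact k)) \<longlonglongrightarrow> 3 * 0" by (rule tendsto_mult_left)
  then have lim: "(\<lambda>k. 3 * (x ^ k /\<^sub>R fact k)) \<longlonglongrightarrow> 0" by simp
  show "(\<lambda>k. \<bar>t\<bar> ^ (2 * k) / fact (2 * k) * even_moment_sequence (limit_even_moment m) (2 * k)) \<longlonglongrightarrow> 0"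
    by (rule tendsto_sandwich[OF _ _ tendsto_const lim];
        rule eventually_mono[OF eventually_ge_at_top[of 1]]) (use ub lb in auto)
qed

text \<open>The exponent is \<open>2k - f(\<pi>)\<close> for the solutions minus \<open>k + 1\<close> for the normalisation of the trace.\<close>

lemma card_paired_components:
  assumes k: "1 \<le> k" and m: "1 \<le> m"
  shows "real (card (paired_components (2 * k) \<pi> m)) / real m ^ (k + 1) =
    real m powi (int k - 1 - int (equation_rank k \<pi>))"
proof -
  have "m ^ equation_rank k \<pi> * card (paired_components (2 * k) \<pi> m) = m ^ (2 * k)"
    unfolding paired_components_def using card_labellings_equation_rank[of k m \<pi>] k by simp
  then have "real m ^ equation_rank k \<pi> * real (card (paired_components (2 * k) \<pi> m)) = real m ^ (2 * k)"
    by (metis of_nat_mult of_nat_power)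
  then have "real (card (paired_components (2 * k) \<pi> m)) = real m ^ (2 * k) / real m ^ equation_rank k \<pi>"
    using m by (simp add: field_simps)
  then have "real (card (paired_components (2 * k) \<pi> m)) / real m ^ (k + 1) =
      real m powi int (2 * k) / real m powi int (equation_rank k \<pi>) / real m powi int (k + 1)"
    by (simp only: power_int_of_nat)
  also have "\<dots> = real m powi (int (2 * k) - int (equation_rank k \<pi>) - int (k + 1))"
  proof -
    have nz: "real m \<noteq> 0" using m by simp
    show ?thesis unfolding power_int_diff[OF disjI1[OF nz]] by (rule refl)
  qed
  also have "int (2 * k) - int (equation_rank k \<pi>) - int (k + 1) = int k - 1 - int (equation_rank k \<pi>)" by simp
  finally show ?thesis .
qed

context block_toeplitz_model
begin

text \<open>The dimension \<open>m N\<close>, from averaging over the eigenvalues, times the scaling of the matrix to the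
  power \<open>p\<close>.\<close>

definition trace_scale :: "nat \<Rightarrow> nat \<Rightarrow> nat \<Rightarrow> real" where
  "trace_scale m p N = real (m * N) * sqrt (real (m * N)) ^ p"

lemma trace_scale_ge:
  assumes "1 \<le> m" "1 \<le> N"
  shows "real N * sqrt (real N) ^ p \<le> trace_scale m p N" "0 < trace_scale m p N"
proof -
  have "N \<le> m * N" using assms by simp
  then have NN: "real N \<le> real (m * N)" by (rule of_nat_mono)
  then show "real N * sqrt (real N) ^ p \<le> trace_scale m p N"
    unfolding trace_scale_def by (intro mult_mono power_mono) auto
  show "0 < trace_scale m p N" using assms unfolding trace_scale_def by simp
qed

text \<open>The normalisation grows like \<open>N\<close> to the power \<open>1 + p/2\<close>, which exceeds \<open>(p + 1) div 2\<close> by at least one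
  half.\<close>

lemma scaled_error_tendsto_0:
  assumes m: "1 \<le> m" and err: "\<And>N. 1 \<le> N \<Longrightarrow> \<bar>e N\<bar> \<le> K * real N ^ ((p + 1) div 2)"
  shows "(\<lambda>N. e N / trace_scale m p N) \<longlonglongrightarrow> 0"
proof (rule Lim_null_comparison)
  show "(\<lambda>N. \<bar>K\<bar> / sqrt (real N)) \<longlonglongrightarrow> 0" by real_asymp
  show "\<forall>\<^sub>F N in sequentially. norm (e N / trace_scale m p N) \<le> \<bar>K\<bar> / sqrt (real N)"
    unfolding eventually_sequentially
  proof (intro exI allI impI)
    fix N :: nat assume N: "1 \<le> N"
    let ?s = "sqrt (real N)"
    have s: "1 \<le> ?s" "?s\<^sup>2 = real N" using N by auto
    have "real N ^ ((p + 1) div 2) = ?s ^ (2 * ((p + 1) div 2))" by (simp add: power_mult s(2))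
    also have "\<dots> \<le> ?s ^ (p + 1)" using s by (intro power_increasing) auto
    finally have "\<bar>e N\<bar> \<le> \<bar>K\<bar> * ?s ^ (p + 1)"
      using err[OF N] by (intro order_trans[OF err[OF N]] mult_mono) auto
    then have "\<bar>e N\<bar> / trace_scale m p N \<le> (\<bar>K\<bar> * ?s ^ (p + 1)) / (real N * ?s ^ p)"
      using trace_scale_ge[OF m N, of p] s N by (intro frac_le) auto
    also have "\<dots> = \<bar>K\<bar> / ?s"
    proof -
      have "x \<noteq> 0 \<Longrightarrow> (\<bar>K\<bar> * x ^ (p + 1)) / (x\<^sup>2 * x ^ p) = \<bar>K\<bar> / x" for x :: real
        by (simp add: power2_eq_square field_simps)
      from this[of ?s] N show ?thesis by (simp only: s(2)) simp
    qed
    finally show "norm (e N / trace_scale m p N) \<le> \<bar>K\<bar> / sqrt (real N)"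
      using trace_scale_ge(2)[OF m N, of p] by (simp add: abs_divide)
  qed
qed

lemma expected_trace_tendsto:
  assumes m: "1 \<le> m" and p: "0 < p"
  shows "(\<lambda>N. expectation (toeplitz_trace m N p) / trace_scale m p N) \<longlonglongrightarrow>
    even_moment_sequence (limit_even_moment m) p"
proof -
  have odd_empty: "pair_partitions p = {}" if "odd p"
  proof (rule equals0I)
    fix \<pi> assume "\<pi> \<in> pair_partitions p"
    from finite_pair_partition(2)[OF this] that show False by auto
  qed
  have fin: "finite (pair_partitions p)"
  proof (cases "odd p")
    case False
    then obtain k where "p = 2 * k" by (auto elim: evenE)
    then show ?thesis using card_pair_partitions(1)[of k] by simp
  qed (simp add: odd_empty)
  define main where "main N = (\<Sum>\<pi>\<in>pair_partitions p.
      real (card (paired_components p \<pi> m)) * real (card (paired_blocks p \<pi> N)))" for N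
  obtain K where K: "\<And>N. 1 \<le> N \<Longrightarrow> \<bar>expectation (toeplitz_trace m N p) - main N\<bar> \<le> K * real N ^ ((p + 1) div 2)"
    using expected_trace_main_term[OF m p fin] unfolding main_def by blast
  have err: "(\<lambda>N. (expectation (toeplitz_trace m N p) - main N) / trace_scale m p N) \<longlonglongrightarrow> 0"
    by (rule scaled_error_tendsto_0[OF m K])
  have "(\<lambda>N. main N / trace_scale m p N) \<longlonglongrightarrow> even_moment_sequence (limit_even_moment m) p"
  proof (cases "odd p")
    case True
    then show ?thesis by (simp add: main_def odd_empty even_moment_sequence_def)
  next
    case False
    then obtain k where k2: "p = 2 * k" by (auto elim: evenE)
    then have k: "1 \<le> k" using p by simp
    have lim: "(\<lambda>N. \<Sum>\<pi>\<in>pair_partitions p. real m powi (int k - 1 - int (equation_rank k \<pi>)) *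
        (real (card (paired_blocks p \<pi> N)) / real N ^ (k + 1))) \<longlonglongrightarrow> limit_even_moment m k"
      unfolding limit_even_moment_def k2
      by (intro tendsto_sum tendsto_mult_left paired_blocks_tendsto_integral[OF k])
    have eq: "(\<Sum>\<pi>\<in>pair_partitions p. real m powi (int k - 1 - int (equation_rank k \<pi>)) *
        (real (card (paired_blocks p \<pi> N)) / real N ^ (k + 1))) = main N / trace_scale m p N" if N: "1 \<le> N" for N
    proof -
      have "sqrt (real (m * N)) ^ p = real (m * N) ^ k" unfolding k2 power_mult by simp
      then have "trace_scale m p N = real m ^ (k + 1) * real N ^ (k + 1)"
        unfolding trace_scale_def by (simp add: power_mult_distrib mult_ac)
      then have "main N / trace_scale m p N = (\<Sum>\<pi>\<in>pair_partitions p.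
          real (card (paired_components p \<pi> m)) / real m ^ (k + 1) * (real (card (paired_blocks p \<pi> N)) / real N ^ (k + 1)))"
        unfolding main_def by (simp only: sum_divide_distrib times_divide_times_eq)
      then show ?thesis unfolding k2 card_paired_components[OF k m] by simp
    qed
    have "(\<lambda>N. main N / trace_scale m p N) \<longlonglongrightarrow> limit_even_moment m k"
      by (rule Lim_transform_eventually[OF lim]) (use eq in \<open>auto simp: eventually_sequentially intro!: exI[of _ 1]\<close>)
    then show ?thesis using k by (simp add: k2 even_moment_sequence_def)
  qed
  from tendsto_add[OF err this] show ?thesis by (simp add: diff_divide_distrib)
qed

text \<open>The normalised fourth central moments are at most \<open>K/N\<^sup>2\<close>. The index starts at \<open>1\<close>, because for
  \<open>N = 0\<close> the matrix is empty and its spectral distribution is not a probability measure.\<close>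

lemma AE_scaled_trace_tendsto:
  assumes m: "1 \<le> m" and p: "0 < p"
  shows "AE \<omega> in M. (\<lambda>n. toeplitz_trace m (Suc n) p \<omega> / trace_scale m p (Suc n)) \<longlonglongrightarrow>
    even_moment_sequence (limit_even_moment m) p"
proof -
  let ?\<tau> = "\<lambda>n. toeplitz_trace m (Suc n) p" and ?s = "\<lambda>n. trace_scale m p (Suc n)"
  define Z where "Z n \<omega> = (?\<tau> n \<omega> - expectation (?\<tau> n)) / ?s n" for n \<omega>
  obtain K where K: "\<And>N. 1 \<le> N \<Longrightarrow> integrable M (\<lambda>\<omega>. (toeplitz_trace m N p \<omega> - expectation (toeplitz_trace m N p)) ^ 4)"
    "\<And>N. 1 \<le> N \<Longrightarrow> expectation (\<lambda>\<omega>. (toeplitz_trace m N p \<omega> - expectation (toeplitz_trace m N p)) ^ 4) \<le> K * real N ^ (2 * p + 2)"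
    using fourth_central_moment_bound[OF m p] by blast
  have Z4: "Z n \<omega> ^ 4 = (?\<tau> n \<omega> - expectation (?\<tau> n)) ^ 4 / ?s n ^ 4" for n \<omega>
    by (simp add: Z_def power_divide)
  have "AE \<omega> in M. (\<lambda>n. Z n \<omega>) \<longlonglongrightarrow> 0"
  proof (rule AE_tendsto_0_of_fourth_moments)
    show "integrable M (\<lambda>\<omega>. Z n \<omega> ^ 4)" for n
      unfolding Z4 by (intro integrable_divide K(1)) simp
    show "expectation (\<lambda>\<omega>. Z n \<omega> ^ 4) \<le> \<bar>K\<bar> * inverse (real (Suc n) ^ 2)" for n
    proof -
      let ?N = "Suc n"
      have gen: "(x * y ^ p) ^ 4 = x ^ (2 * p + 2) * x ^ 2" if "y\<^sup>2 = x" for x y :: real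
      proof -
        have "(x * y ^ p) ^ 4 = x ^ 4 * y ^ (p * 4)" by (simp only: power_mult_distrib power_mult)
        also have "p * 4 = 2 * (2 * p)" by simp
        also have "x ^ 4 * y ^ (2 * (2 * p)) = x ^ 4 * x ^ (2 * p)" by (simp only: power_mult that)
        also have "\<dots> = x ^ (4 + 2 * p)" by (rule power_add[symmetric])
        also have "4 + 2 * p = (2 * p + 2) + 2" by simp
        also have "x ^ \<dots> = x ^ (2 * p + 2) * x ^ 2" by (rule power_add)
        finally show ?thesis .
      qed
      have e: "(real ?N * sqrt (real ?N) ^ p) ^ 4 = real ?N ^ (2 * p + 2) * real ?N ^ 2"
        by (rule gen) simp
      have ge: "real ?N ^ (2 * p + 2) * real ?N ^ 2 \<le> ?s n ^ 4"
        unfolding e[symmetric] using trace_scale_ge(1)[OF m, of ?N p] by (intro power_mono) auto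
      have "expectation (\<lambda>\<omega>. Z n \<omega> ^ 4) =
          expectation (\<lambda>\<omega>. (?\<tau> n \<omega> - expectation (?\<tau> n)) ^ 4) / ?s n ^ 4"
        unfolding Z4 by simp
      also have "\<dots> \<le> (\<bar>K\<bar> * real ?N ^ (2 * p + 2)) / (real ?N ^ (2 * p + 2) * real ?N ^ 2)"
      proof (rule frac_le[OF _ _ _ ge])
        have le: "K * real ?N ^ (2 * p + 2) \<le> \<bar>K\<bar> * real ?N ^ (2 * p + 2)" by (intro mult_right_mono) auto
        show "expectation (\<lambda>\<omega>. (?\<tau> n \<omega> - expectation (?\<tau> n)) ^ 4) \<le> \<bar>K\<bar> * real ?N ^ (2 * p + 2)"
          by (rule order_trans[OF K(2) le]) simp
        show "0 \<le> \<bar>K\<bar> * real ?N ^ (2 * p + 2)" by simp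
        show "0 < real ?N ^ (2 * p + 2) * real ?N ^ 2" by simp
      qed
      also have "\<dots> = \<bar>K\<bar> * inverse (real ?N ^ 2)"
      proof -
        have cancel: "x \<noteq> 0 \<Longrightarrow> (\<bar>K\<bar> * x) / (x * y) = \<bar>K\<bar> * inverse y" for x y :: real
          by (simp add: divide_inverse)
        show ?thesis by (rule cancel) simp
      qed
      finally show ?thesis .
    qed
    have "summable (\<lambda>n. inverse (real n ^ 2))" by (rule inverse_power_summable) simp
    then have "summable (\<lambda>n. inverse (real (Suc n) ^ 2))" by (subst summable_Suc_iff)
    then show "summable (\<lambda>n. \<bar>K\<bar> * inverse (real (Suc n) ^ 2))" by (rule summable_mult)
  qed
  then show ?thesis
  proof eventually_elim
    case (elim \<omega>)
    have "(\<lambda>n. expectation (?\<tau> n) / ?s n) \<longlonglongrightarrow> even_moment_sequence (limit_even_moment m) p"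
      using expected_trace_tendsto[OF m p] by (rule LIMSEQ_Suc)
    from tendsto_add[OF elim this] show ?case by (simp add: Z_def diff_divide_distrib)
  qed
qed

lemma block_toeplitz_symmetric:
  assumes \<omega>: "\<omega> \<in> space M" and ij: "i < m * N" "j < m * N"
  shows "block_toeplitz a m N \<omega> $$ (i, j) = block_toeplitz a m N \<omega> $$ (j, i)"
proof -
  have b: "i div m < N" "j div m < N" "0 < m"
    using ij by (auto simp: less_mult_imp_div_less mult.commute intro: gr0I)
  have "a m N (- (int (j div m) - int (i div m))) (i mod m) (j mod m) \<omega> =
      a m N (int (j div m) - int (i div m)) (j mod m) (i mod m) \<omega>"
    using b by (intro transpose_entry[OF _ _ _ \<omega>]) auto
  then show ?thesis using ij by (simp add: block_toeplitz_def)
qed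

lemma scaled_eigenvalue_moments:
  assumes m: "1 \<le> m" and N: "1 \<le> N" and \<omega>: "\<omega> \<in> space M"
  defines "\<mu> \<equiv> eigenvalue_distribution ((1 / sqrt (real (m * N))) \<cdot>\<^sub>m block_toeplitz a m N \<omega>)"
  shows "has_moments \<mu> (\<lambda>p. toeplitz_trace m N p \<omega> / trace_scale m p N)"
proof -
  let ?T = "block_toeplitz a m N \<omega>" and ?c = "1 / sqrt (real (m * N))"
  have T: "?T \<in> carrier_mat (m * N) (m * N)" by (simp add: block_toeplitz_def)
  then have X: "?c \<cdot>\<^sub>m ?T \<in> carrier_mat (m * N) (m * N)" by simp
  have n: "0 < m * N" using m N by simp
  have sym: "(?c \<cdot>\<^sub>m ?T) $$ (i, j) = (?c \<cdot>\<^sub>m ?T) $$ (j, i)" if "i < m * N" "j < m * N" for i j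
    using T that block_toeplitz_symmetric[OF \<omega> that] by simp
  note E = eigenvalue_distribution_moments[OF X n sym]
  have "mat_trace ((?c \<cdot>\<^sub>m ?T) ^\<^sub>m p) / real (m * N) = toeplitz_trace m N p \<omega> / trace_scale m p N" for p
    unfolding pow_mat_smult[OF T] mat_trace_smult[OF pow_carrier_mat[OF T]] toeplitz_trace_def trace_scale_def
    by (simp add: power_divide)
  then show ?thesis
    unfolding has_moments_def \<mu>_def has_bochner_integral_iff using E by simp
qed

lemma AE_moments_tendsto:
  assumes m: "1 \<le> m"
  shows "AE \<omega> in M. \<forall>p. (\<lambda>n. toeplitz_trace m (Suc n) p \<omega> / trace_scale m p (Suc n)) \<longlonglongrightarrow>
    even_moment_sequence (limit_even_moment m) p"
  unfolding AE_all_countable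
proof
  fix p
  show "AE \<omega> in M. (\<lambda>n. toeplitz_trace m (Suc n) p \<omega> / trace_scale m p (Suc n)) \<longlonglongrightarrow>
    even_moment_sequence (limit_even_moment m) p"
  proof (cases "p = 0")
    case True
    have "toeplitz_trace m (Suc n) 0 \<omega> / trace_scale m 0 (Suc n) = 1" for n \<omega>
    proof -
      have tr: "toeplitz_trace m (Suc n) 0 \<omega> = real (m * Suc n)"
        by (simp add: toeplitz_trace_def mat_trace_def block_toeplitz_def)
      have "m * Suc n \<noteq> 0" using m by simp
      then have "real (m * Suc n) \<noteq> 0" by (simp only: of_nat_eq_0_iff not_False_eq_True)
      then show ?thesis unfolding tr trace_scale_def power_0 mult_1_right by (rule divide_self)
    qed
    then show ?thesis by (simp add: True even_moment_sequence_def)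
  qed (use AE_scaled_trace_tendsto[OF m] in simp)
qed

end

theorem theorem3p2:
  fixes M :: "'w measure"
    and a :: "nat \<Rightarrow> nat \<Rightarrow> int \<Rightarrow> nat \<Rightarrow> nat \<Rightarrow> 'w \<Rightarrow> real"
    and m :: nat
  assumes "block_toeplitz_model M a"
    and "1 \<le> m"
  shows "\<exists>\<gamma>. symmetric_distribution \<gamma> \<and>
    (\<forall>k\<ge>1. has_bochner_integral \<gamma> (\<lambda>x. x ^ (2 * k)) (limit_even_moment m k)) \<and>
    (\<forall>\<nu>. symmetric_distribution \<nu> \<and>
       (\<forall>k\<ge>1. has_bochner_integral \<nu> (\<lambda>x. x ^ (2 * k)) (limit_even_moment m k)) \<longrightarrow> \<nu> = \<gamma>) \<and>
    (AE \<omega> in M. weak_conv_m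
       (\<lambda>N. eigenvalue_distribution ((1 / sqrt (real (m * N))) \<cdot>\<^sub>m block_toeplitz a m N \<omega>)) \<gamma>)"
proof -
  interpret block_toeplitz_model M a by (rule assms(1))
  note m = assms(2)
  let ?mo = "even_moment_sequence (limit_even_moment m)"
  let ?mu = "\<lambda>\<omega> N. eigenvalue_distribution ((1 / sqrt (real (m * N))) \<cdot>\<^sub>m block_toeplitz a m N \<omega>)"
  let ?mn = "\<lambda>\<omega> n p. toeplitz_trace m (Suc n) p \<omega> / trace_scale m p (Suc n)"
  note small = small_moments_limit[OF m]
  have moments: "has_moments (?mu \<omega> (Suc n)) (?mn \<omega> n)" if "\<omega> \<in> space M" for \<omega> n
    by (rule scaled_eigenvalue_moments[OF m _ that]) simp
  have ae: "AE \<omega> in M. \<omega> \<in> space M \<and> (\<forall>p. (\<lambda>n. ?mn \<omega> n p) \<longlonglongrightarrow> ?mo p)"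
    using AE_moments_tendsto[OF m] AE_space by eventually_elim blast
  from eventually_happens'[OF ae_filter_bot this]
  \<comment> \<open>The limit distribution is obtained from a single outcome; its moments do not depend on the choice.\<close>
  obtain \<omega>0 where \<omega>0: "\<omega>0 \<in> space M" "\<And>p. (\<lambda>n. ?mn \<omega>0 n p) \<longlonglongrightarrow> ?mo p" by blast
  obtain \<gamma> where \<gamma>: "has_moments \<gamma> ?mo"
    by (rule limit_with_moments_exists[of "\<lambda>n. ?mu \<omega>0 (Suc n)" "?mn \<omega>0" ?mo])
       (use moments[OF \<omega>0(1)] \<omega>0(2) in auto)
  show ?thesis
  proof (intro exI[of _ \<gamma>] conjI allI impI)
    show "symmetric_distribution \<gamma>" by (rule has_moments_symmetric[OF \<gamma> small])
    fix k :: nat assume k: "1 \<le> k"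
    have "has_bochner_integral \<gamma> (\<lambda>x. x ^ (2 * k)) (?mo (2 * k))" using \<gamma> by (simp only: has_moments_def)
    then show "has_bochner_integral \<gamma> (\<lambda>x. x ^ (2 * k)) (limit_even_moment m k)"
      using k by (simp add: even_moment_sequence_def)
  next
    fix \<nu>
    assume "symmetric_distribution \<nu> \<and> (\<forall>k\<ge>1. has_bochner_integral \<nu> (\<lambda>x. x ^ (2 * k)) (limit_even_moment m k))"
    then have "has_moments \<nu> ?mo" by (intro symmetric_has_moments) auto
    then show "\<nu> = \<gamma>" using \<gamma> small by (rule has_moments_unique)
  next
    show "AE \<omega> in M. weak_conv_m (?mu \<omega>) \<gamma>"
      using ae
    proof eventually_elim
      case (elim \<omega>)
      have "weak_conv_m (\<lambda>n. ?mu \<omega> (Suc n)) \<gamma>"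
        by (rule weak_conv_of_moments[OF moments \<gamma> _ small]) (use elim in auto)
      then have shifted: "\<forall>x. isCont (cdf \<gamma>) x \<longrightarrow> (\<lambda>n. cdf (?mu \<omega> (Suc n)) x) \<longlonglongrightarrow> cdf \<gamma> x"
        unfolding weak_conv_m_def weak_conv_def .
      show ?case
        unfolding weak_conv_m_def weak_conv_def
      proof (intro allI impI)
        fix x assume cont: "isCont (cdf \<gamma>) x"
        have "(\<lambda>n. cdf (?mu \<omega> (Suc n)) x) \<longlonglongrightarrow> cdf \<gamma> x"
          by (rule shifted[rule_format, OF cont])
        then show "(\<lambda>n. cdf (?mu \<omega> n) x) \<longlonglongrightarrow> cdf \<gamma> x" by (rule LIMSEQ_imp_Suc)
      qed
    qed
  qed
qed

end
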